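(* Let $X$ be a connected, oriented, non-compact $C^\infty$ Riemannian manifold and $\mathcal D=C_0^\infty(X)$ (real-valued). Let $\rho$ be a measure on $(\Gamma_{X,0},\mathcal B(\Gamma_{X,0}))$ such that: (1) $\rho(\Gamma_X^{(0)})=1$; (2) for every compact $\Lambda\subset X$ there is a constant $C_\Lambda>0$ such that $\rho(\Gamma_\Lambda^{(n)})\le C_\Lambda^n$ for all $n\in\mathbb N$; (3) $\int_{\Gamma_{X,0}}(G\star\overline G)(\eta)\,\rho(d\eta)\ge 0$ for every $G\in\mathcal F_{\rm fin}(\mathcal D)$. Then the operators $A_\varphi$, $\varphi\in\mathcal D$, with domain $\widehat{\mathcal F}_{\rm fin}(\mathcal D)$ are essentially selfadjoint in $\mathcal H_\rho$, and their closures $A_\varphi^\sim$, $\varphi\in\mathcal D$, constitute a family of commuting selfadjoint operators, where commutation is understood in the sense of the resolutions of the identity (i.e. their spectral projections commute).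
   Context: **Function spaces.** $\mathcal D=C_0^\infty(X)$ carries its usual nuclear topology; $\mathcal D_{\mathbb C}$ is its complexification. $\mathcal F_0(\mathcal D)=\mathbb C$ and, for $n\ge1$, $\mathcal F_n(\mathcal D)=\mathcal D_{\mathbb C}^{\widehat\otimes n}$ ($\widehat\otimes$ = symmetric tensor product), i.e. the space of complex-valued symmetric $C^\infty$ functions on $X^n$ with compact support. $\mathcal F_{\rm fin}(\mathcal D)=\bigoplus_{n\ge0}\mathcal F_n(\mathcal D)$ is the topological direct sum, whose elements are finite sequences $G=(G^{(0)},\dots,G^{(n)},0,0,\dots)$. $G^{(n)}\in\mathcal F_n(\mathcal D)$ is identified with the sequence having $G^{(n)}$ at place $n$ and $0$ elsewhere; in particular $\varphi\in\mathcal D$ is an element of $\mathcal F_{\rm fin}(\mathcal D)$. **Configurations.** $\ddot\Gamma_{X,0}=\bigsqcup_{n\ge0}\ddot\Gamma_X^{(n)}$, where $\ddot\Gamma_X^{(0)}=\{\varnothing\}$ and $\ddot\Gamma_X^{(n)}=X^n/S_n$ with the quotient topology (disjoint-union topology on $\ddot\Gamma_{X,0}$); elements are written $[x_1,\dots,x_n]$. Each $G\in\mathcal F_{\rm fin}(\mathcal D)$ is a function on $\ddot\Gamma_{X,0}$ via $G(\varnothing)=G^{(0)}$, $G([x_1,\dots,x_n])=G^{(n)}(x_1,\dots,x_n)$. $\Gamma_{X,0}\subset\ddot\Gamma_{X,0}$ (relative topology) consists of $\varnothing$ and all $[x_1,\dots,x_n]$ with pairwise distinct $x_i$, identified with finite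 subsets of $X$; $\Gamma_X^{(n)}$ is the set of $n$-point elements of $\Gamma_{X,0}$, and for $\Lambda\subset X$, $\Gamma_\Lambda^{(n)}$ is the set of $n$-point subsets of $\Lambda$. **Convolution.** For $G_1,G_2\in\mathcal F_{\rm fin}(\mathcal D)$, $$(G_1\star G_2)(\eta)=\sum_{(\xi_1,\xi_2,\xi_3)\in\mathcal P_3(\eta)}G_1(\xi_1\cup\xi_2)\,G_2(\xi_2\cup\xi_3),$$ where for $\eta=[x_1,\dots,x_n]$ the sum is over all ordered triples of pairwise disjoint, possibly empty, subsets of $\{1,\dots,n\}$ with union $\{1,\dots,n\}$, and an index set $\xi$ is identified with the class $[x_i]_{i\in\xi}$ (and $\varnothing$ with $\varnothing$). One has $G_1\star G_2\in\mathcal F_{\rm fin}(\mathcal D)$. **Hilbert space and operators.** $a_\rho(G_1,G_2)=\int_{\Gamma_{X,0}}(G_1\star G_2)(\eta)\,\rho(d\eta)$. $\widehat{\mathcal F}_{\rm fin}(\mathcal D)=\mathcal F_{\rm fin}(\mathcal D)/\{G':a_\rho(G',\overline{G'})=0\}$, with classes denoted $\widehat G$; $\mathcal H_\rho$ is the complex Hilbert space obtained by completing $\widehat{\mathcal F}_{\rm fin}(\mathcal D)$ in the scalar product $(\widehat G_1,\widehat G_2)_{\mathcal H_\rho}=a_\rho(G_1,\overline{G_2})$. For $\varphi\in\mathcal D$, $A_\varphi$ is the (well-defined) operator in $\mathcal H_\rho$ with domain $\widehat{\mathcal F}_{\rm fin}(\mathcal D)$ given by $A_\varphi\widehat G=\widehat{\varphi\star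 G}$. *)

theory Defs
  imports "HOL-Analysis.Analysis" "HOL-Combinatorics.Combinatorics"
begin

section \<open>Smooth manifolds\<close>

text \<open>On an open set, being of class \<open>C\<^sup>k\<close> is expressed by existence and continuity of all
  iterated partial derivatives of order at most \<open>k\<close>.\<close>

primrec Ck_on :: "nat \<Rightarrow> 'e::euclidean_space set \<Rightarrow> ('e \<Rightarrow> 'f::real_normed_vector) \<Rightarrow> bool" where
  "Ck_on 0 W f \<longleftrightarrow> continuous_on W f"
| "Ck_on (Suc k) W f \<longleftrightarrow> continuous_on W f \<and>
     (\<forall>b\<in>Basis. \<exists>h. Ck_on k W h \<and>
        (\<forall>y\<in>W. ((\<lambda>t. f (y + t *\<^sub>R b)) has_vector_derivative h y) (at 0)))"

definition smooth_on :: "'e::euclidean_space set \<Rightarrow> ('e \<Rightarrow> 'f::real_normed_vector) \<Rightarrow> bool" where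
  "smooth_on W f \<longleftrightarrow> (\<forall>k. Ck_on k W f)"

text \<open>A chart is a pair of its domain and its coordinate map; only the values of the coordinate map
  on the domain matter. The dimension of the manifold is \<open>CARD('d) \<ge> 1\<close>; a connected
  manifold of dimension 0 is a point, hence compact.\<close>

type_synonym ('a, 'd) chart = "'a set \<times> ('a \<Rightarrow> real ^ 'd)"

definition chart_inv :: "('a, 'd::finite) chart \<Rightarrow> real ^ 'd \<Rightarrow> 'a" where
  "chart_inv C = inv_into (fst C) (snd C)"

definition chart_range :: "('a, 'd::finite) chart \<Rightarrow> (real ^ 'd) set" where
  "chart_range C = snd C ` fst C"

definition is_chart :: "('a::topological_space, 'd::finite) chart \<Rightarrow> bool" where
  "is_chart C \<longleftrightarrow> open (fst C) \<and> open (chart_range C) \<and>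
     homeomorphism (fst C) (chart_range C) (snd C) (chart_inv C)"

definition transition :: "('a, 'd::finite) chart \<Rightarrow> ('a, 'd) chart \<Rightarrow> real ^ 'd \<Rightarrow> real ^ 'd" where
  "transition C C' = snd C' \<circ> chart_inv C"

definition smooth_atlas :: "('a::topological_space, 'd::finite) chart set \<Rightarrow> bool" where
  "smooth_atlas A \<longleftrightarrow> (\<forall>C\<in>A. is_chart C) \<and> (\<Union>C\<in>A. fst C) = UNIV \<and>
     (\<forall>C\<in>A. \<forall>C'\<in>A. smooth_on (snd C ` (fst C \<inter> fst C')) (transition C C'))"

definition oriented_atlas :: "('a::topological_space, 'd::finite) chart set \<Rightarrow> bool" where
  "oriented_atlas A \<longleftrightarrow> smooth_atlas A \<and>
     (\<forall>C\<in>A. \<forall>C'\<in>A. \<forall>x\<in>fst C \<inter> fst C'. det (jacobian (transition C C') (at (snd C x))) > 0)"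

text \<open>A Riemannian metric is given by its matrices \<open>g C x\<close> in the charts \<open>C\<close> around \<open>x\<close>,
  which transform as the components of a covariant tensor of degree 2.\<close>

definition riemannian_metric ::
  "('a::topological_space, 'd::finite) chart set \<Rightarrow> (('a, 'd) chart \<Rightarrow> 'a \<Rightarrow> real ^ 'd ^ 'd) \<Rightarrow> bool" where
  "riemannian_metric A g \<longleftrightarrow>
     (\<forall>C\<in>A. \<forall>x\<in>fst C. transpose (g C x) = g C x \<and> (\<forall>v. v \<noteq> 0 \<longrightarrow> v \<bullet> (g C x *v v) > 0)) \<and>
     (\<forall>C\<in>A. smooth_on (chart_range C) (\<lambda>y. g C (chart_inv C y))) \<and>
     (\<forall>C\<in>A. \<forall>C'\<in>A. \<forall>x\<in>fst C \<inter> fst C'.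
        (let J = jacobian (transition C C') (at (snd C x))
         in g C x = transpose J ** g C' x ** J))"

definition oriented_riemannian_manifold ::
  "('a::{t2_space, second_countable_topology}, 'd::finite) chart set \<Rightarrow>
     (('a, 'd) chart \<Rightarrow> 'a \<Rightarrow> real ^ 'd ^ 'd) \<Rightarrow> bool" where
  "oriented_riemannian_manifold A g \<longleftrightarrow> oriented_atlas A \<and> riemannian_metric A g"

definition test_functions :: "('a::topological_space, 'd::finite) chart set \<Rightarrow> ('a \<Rightarrow> real) set" where
  "test_functions A =
     {\<phi>. (\<forall>C\<in>A. smooth_on (chart_range C) (\<phi> \<circ> chart_inv C)) \<and> compact (closure {x. \<phi> x \<noteq> 0})}"


section \<open>Smooth functions on powers of the manifold\<close>

text \<open>The power \<open>Z\<^sup>n\<close> is the space of extensional functions on \<open>{..<n}\<close>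
  with the product topology.\<close>

abbreviation power_top :: "nat \<Rightarrow> (nat \<Rightarrow> 'z::topological_space) topology" where
  "power_top n \<equiv> product_topology (\<lambda>_. euclidean) {..<n}"

primrec Ck_on_power ::
  "nat \<Rightarrow> nat \<Rightarrow> (nat \<Rightarrow> 'e::euclidean_space) set \<Rightarrow> ((nat \<Rightarrow> 'e) \<Rightarrow> complex) \<Rightarrow> bool" where
  "Ck_on_power 0 n W f \<longleftrightarrow> continuous_map (subtopology (power_top n) W) euclidean f"
| "Ck_on_power (Suc k) n W f \<longleftrightarrow> continuous_map (subtopology (power_top n) W) euclidean f \<and>
     (\<forall>i<n. \<forall>b\<in>Basis. \<exists>h. Ck_on_power k n W h \<and>
        (\<forall>y\<in>W. ((\<lambda>t. f (y(i := y i + t *\<^sub>R b))) has_vector_derivative h y) (at 0)))"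

definition smooth_on_power ::
  "nat \<Rightarrow> (nat \<Rightarrow> 'e::euclidean_space) set \<Rightarrow> ((nat \<Rightarrow> 'e) \<Rightarrow> complex) \<Rightarrow> bool" where
  "smooth_on_power n W f \<longleftrightarrow> (\<forall>k. Ck_on_power k n W f)"

definition smooth_compact_power ::
  "('a::topological_space, 'd::finite) chart set \<Rightarrow> nat \<Rightarrow> ((nat \<Rightarrow> 'a) \<Rightarrow> complex) \<Rightarrow> bool" where
  "smooth_compact_power A n f \<longleftrightarrow>
     (\<forall>C. (\<forall>i<n. C i \<in> A) \<longrightarrow>
        smooth_on_power n (\<Pi>\<^sub>E i\<in>{..<n}. chart_range (C i))
          (\<lambda>y. f (\<lambda>i\<in>{..<n}. chart_inv (C i) (y i)))) \<and>
     compactin (power_top n) (power_top n closure_of {x \<in> topspace (power_top n). f x \<noteq> 0})"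


section \<open>Configurations\<close>

text \<open>The class \<open>[x\<^sub>1, \<dots>, x\<^sub>n]\<close> is a multiset of size \<open>n\<close>. If \<open>x\<close> enumerates the points,
  \<open>pts x \<xi>\<close> is the class of the points with index in \<open>\<xi>\<close>.\<close>

definition pts :: "(nat \<Rightarrow> 'a) \<Rightarrow> nat set \<Rightarrow> 'a multiset" where
  "pts x \<xi> = image_mset x (mset_set \<xi>)"

definition conf_topology :: "'a::topological_space multiset topology" where
  "conf_topology =
     topology (\<lambda>U. \<forall>n. openin (power_top n) {x \<in> topspace (power_top n). pts x {..<n} \<in> U})"

lemma openin_conf_topology:
  fixes U :: "'a::topological_space multiset set"
  shows "openin conf_topology U \<longleftrightarrow>
     (\<forall>n. openin (power_top n) {x \<in> topspace (power_top n). pts x {..<n} \<in> U})"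
proof -
  let ?q = "\<lambda>n (U :: 'a multiset set). {x \<in> topspace (power_top n). pts x {..<n} \<in> U}"
  have "istopology (\<lambda>U. \<forall>n. openin (power_top n) (?q n U))"
    unfolding istopology_def
  proof (intro conjI allI impI)
    fix S T :: "'a multiset set" and n
    assume "\<forall>n. openin (power_top n) (?q n S)" "\<forall>n. openin (power_top n) (?q n T)"
    then have "openin (power_top n) (?q n S \<inter> ?q n T)" by blast
    moreover have "?q n S \<inter> ?q n T = ?q n (S \<inter> T)" by blast
    ultimately show "openin (power_top n) (?q n (S \<inter> T))" by simp
  next
    fix K :: "'a multiset set set" and n
    assume "\<forall>S\<in>K. \<forall>n. openin (power_top n) (?q n S)"
    then have "openin (power_top n) (\<Union>S\<in>K. ?q n S)" by blast
    moreover have "(\<Union>S\<in>K. ?q n S) = ?q n (\<Union>K)" by blast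
    ultimately show "openin (power_top n) (?q n (\<Union>K))" by simp
  qed
  then show ?thesis by (simp only: conf_topology_def topology_inverse')
qed

definition simple_confs :: "'a multiset set" where
  "simple_confs = {\<eta>. \<forall>x. count \<eta> x \<le> 1}"

definition simple_confs_in :: "'a set \<Rightarrow> nat \<Rightarrow> 'a multiset set" where
  "simple_confs_in \<Lambda> n = {\<eta> \<in> simple_confs. set_mset \<eta> \<subseteq> \<Lambda> \<and> size \<eta> = n}"

definition conf_borel :: "'a::topological_space multiset measure" where
  "conf_borel = sigma simple_confs {U. openin (subtopology conf_topology simple_confs) U}"


section \<open>Finite sequences of test functions and their convolution\<close>

text \<open>A symmetric function on the \<open>n\<close>-th power of the manifold is a function on multisets of size
  \<open>n\<close>; a sequence of such functions is a function on all multisets.\<close>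

definition Ffin :: "('a::topological_space, 'd::finite) chart set \<Rightarrow> ('a multiset \<Rightarrow> complex) set" where
  "Ffin A = {G. (\<forall>n. smooth_compact_power A n (\<lambda>x. G (pts x {..<n}))) \<and>
                (\<exists>N. \<forall>\<eta>. size \<eta> > N \<longrightarrow> G \<eta> = 0)}"

definition one_particle :: "('a \<Rightarrow> real) \<Rightarrow> 'a multiset \<Rightarrow> complex" where
  "one_particle \<phi> \<eta> = (if size \<eta> = 1 then complex_of_real (\<phi> (the_elem (set_mset \<eta>))) else 0)"

definition P3 :: "nat \<Rightarrow> (nat set \<times> nat set \<times> nat set) set" where
  "P3 n = {(\<xi>\<^sub>1, \<xi>\<^sub>2, \<xi>\<^sub>3). \<xi>\<^sub>1 \<union> \<xi>\<^sub>2 \<union> \<xi>\<^sub>3 = {..<n} \<and>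
             \<xi>\<^sub>1 \<inter> \<xi>\<^sub>2 = {} \<and> \<xi>\<^sub>1 \<inter> \<xi>\<^sub>3 = {} \<and> \<xi>\<^sub>2 \<inter> \<xi>\<^sub>3 = {}}"

text \<open>The value does not depend on the chosen enumeration, see \<open>conv_eq\<close> below.\<close>

definition conv ::
  "('a multiset \<Rightarrow> complex) \<Rightarrow> ('a multiset \<Rightarrow> complex) \<Rightarrow> 'a multiset \<Rightarrow> complex" (infixl "\<star>" 70) where
  "(G\<^sub>1 \<star> G\<^sub>2) \<eta> = (let x = (SOME x. pts x {..<size \<eta>} = \<eta>) in
     \<Sum>(\<xi>\<^sub>1, \<xi>\<^sub>2, \<xi>\<^sub>3) \<in> P3 (size \<eta>). G\<^sub>1 (pts x (\<xi>\<^sub>1 \<union> \<xi>\<^sub>2)) * G\<^sub>2 (pts x (\<xi>\<^sub>2 \<union> \<xi>\<^sub>3)))"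

lemma P3_sum_permute:
  assumes p: "p permutes {..<n}" and xy: "\<forall>i\<in>{..<n}. x i = y (p i)"
  shows "(\<Sum>(a, b, c) \<in> P3 n. F (pts x (a \<union> b)) (pts x (b \<union> c))) =
         (\<Sum>(a, b, c) \<in> P3 n. F (pts y (a \<union> b)) (pts y (b \<union> c)))"
proof -
  have inj: "inj p" using p by (rule permutes_inj)
  have inv: "p ` (inv p ` S) = S" "inv p ` (p ` S) = S" for S
    using permutes_inverses[OF p] by (auto simp: image_iff)
  have q: "inv p permutes {..<n}" using p by (rule permutes_inv)
  have mem: "(r ` a, r ` b, r ` c) \<in> P3 n"
    if "(a, b, c) \<in> P3 n" "r permutes {..<n}" for a b c and r :: "nat \<Rightarrow> nat"
    using that permutes_inj[OF that(2)] permutes_image[OF that(2)]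
    by (auto simp only: P3_def mem_Collect_eq prod.case image_Un[symmetric] image_Int[symmetric] image_empty)
  have pt: "pts x S = pts y (p ` S)" if "S \<subseteq> {..<n}" for S
  proof -
    have "pts y (p ` S) = image_mset y (image_mset p (mset_set S))"
      using inj by (simp add: pts_def image_mset_mset_set inj_on_subset)
    also have "\<dots> = pts x S"
      unfolding pts_def multiset.map_comp
      using that xy finite_subset[OF that] by (intro image_mset_cong) auto
    finally show ?thesis by simp
  qed
  show ?thesis
  proof (rule sum.reindex_bij_witness[where
          i = "\<lambda>(a, b, c). (inv p ` a, inv p ` b, inv p ` c)" and
          j = "\<lambda>(a, b, c). (p ` a, p ` b, p ` c)"], goal_cases)
    case (5 t)
    obtain a b c where t: "t = (a, b, c)" by (cases t)
    have "a \<union> b \<subseteq> {..<n}" "b \<union> c \<subseteq> {..<n}" using 5 by (auto simp: t P3_def)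
    then show ?case unfolding t prod.case by (simp only: pt image_Un)
  qed (use mem p q in \<open>auto simp: inv permutes_inverses[OF p] simp del: image_Un split: prod.splits\<close>)
qed

lemma conv_eq:
  assumes "pts x {..<n} = \<eta>"
  shows "(G\<^sub>1 \<star> G\<^sub>2) \<eta> =
    (\<Sum>(\<xi>\<^sub>1, \<xi>\<^sub>2, \<xi>\<^sub>3) \<in> P3 n. G\<^sub>1 (pts x (\<xi>\<^sub>1 \<union> \<xi>\<^sub>2)) * G\<^sub>2 (pts x (\<xi>\<^sub>2 \<union> \<xi>\<^sub>3)))"
proof -
  have n: "size \<eta> = n" using assms by (auto simp: pts_def)
  define y where "y = (SOME x. pts x {..<n} = \<eta>)"
  have y: "pts y {..<n} = \<eta>" unfolding y_def by (rule someI[of "\<lambda>x. pts x {..<n} = \<eta>", OF assms])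
  then have "image_mset y (mset_set {..<n}) = image_mset x (mset_set {..<n})"
    using assms by (simp add: pts_def)
  then obtain p where "p permutes {..<n}" "\<forall>i\<in>{..<n}. y i = x (p i)"
    using image_mset_eq_implies_permutes[OF finite_lessThan] by metis
  from P3_sum_permute[OF this, of "\<lambda>u v. G\<^sub>1 u * G\<^sub>2 v"]
  show ?thesis by (simp add: conv_def n y_def Let_def)
qed

definition a_form ::
  "'a multiset measure \<Rightarrow> ('a multiset \<Rightarrow> complex) \<Rightarrow> ('a multiset \<Rightarrow> complex) \<Rightarrow> complex" where
  "a_form \<rho> G\<^sub>1 G\<^sub>2 = (\<integral>\<eta>. (G\<^sub>1 \<star> G\<^sub>2) \<eta> \<partial>\<rho>)"


section \<open>Complex Hilbert spaces\<close>

text \<open>The scalar product is linear in its first argument.\<close>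

class complex_hilbert = banach +
  fixes scaleC :: "complex \<Rightarrow> 'a \<Rightarrow> 'a" (infixr "*\<^sub>C" 75)
    and cinner :: "'a \<Rightarrow> 'a \<Rightarrow> complex"
  assumes scaleR_scaleC: "r *\<^sub>R x = complex_of_real r *\<^sub>C x"
    and scaleC_add_right: "c *\<^sub>C (x + y) = c *\<^sub>C x + c *\<^sub>C y"
    and scaleC_add_left: "(c + d) *\<^sub>C x = c *\<^sub>C x + d *\<^sub>C x"
    and scaleC_scaleC: "c *\<^sub>C d *\<^sub>C x = (c * d) *\<^sub>C x"
    and scaleC_one: "1 *\<^sub>C x = x"
    and cinner_commute: "cinner x y = cnj (cinner y x)"
    and cinner_add_left: "cinner (x + y) z = cinner x z + cinner y z"
    and cinner_scaleC_left: "cinner (c *\<^sub>C x) y = c * cinner x y"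
    and cinner_self: "cinner x x = complex_of_real ((norm x)\<^sup>2)"

text \<open>\<open>\<iota>\<close> sends \<open>G\<close> to its class in the completion. By the isometry condition
  its kernel on \<open>Ffin A\<close> is the null space of \<open>a_form \<rho>\<close>, so the quotient of
  \<open>Ffin A\<close> is the image of \<open>\<iota>\<close>.\<close>

definition hilbert_completion ::
  "('a::topological_space, 'd::finite) chart set \<Rightarrow> 'a multiset measure \<Rightarrow>
     (('a multiset \<Rightarrow> complex) \<Rightarrow> 'h::complex_hilbert) \<Rightarrow> bool" where
  "hilbert_completion A \<rho> \<iota> \<longleftrightarrow>
     (\<forall>G\<^sub>1\<in>Ffin A. \<forall>G\<^sub>2\<in>Ffin A. \<iota> (\<lambda>\<eta>. G\<^sub>1 \<eta> + G\<^sub>2 \<eta>) = \<iota> G\<^sub>1 + \<iota> G\<^sub>2) \<and>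
     (\<forall>c. \<forall>G\<in>Ffin A. \<iota> (\<lambda>\<eta>. c * G \<eta>) = c *\<^sub>C \<iota> G) \<and>
     (\<forall>G\<^sub>1\<in>Ffin A. \<forall>G\<^sub>2\<in>Ffin A. cinner (\<iota> G\<^sub>1) (\<iota> G\<^sub>2) = a_form \<rho> G\<^sub>1 (cnj \<circ> G\<^sub>2)) \<and>
     closure (\<iota> ` Ffin A) = UNIV"


section \<open>Unbounded operators\<close>

text \<open>Operators are identified with their graphs; the closure of an operator is the topological
  closure of its graph in the product space.\<close>

definition lin_operator :: "('h::complex_hilbert \<times> 'h) set \<Rightarrow> bool" where
  "lin_operator T \<longleftrightarrow> single_valued T \<and> (0, 0) \<in> T \<and>
     (\<forall>(x, y)\<in>T. \<forall>(x', y')\<in>T. (x + x', y + y') \<in> T) \<and>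
     (\<forall>c. \<forall>(x, y)\<in>T. (c *\<^sub>C x, c *\<^sub>C y) \<in> T)"

definition adjoint_op :: "('h::complex_hilbert \<times> 'h) set \<Rightarrow> ('h \<times> 'h) set" where
  "adjoint_op T = {(u, v). \<forall>(x, y)\<in>T. cinner y u = cinner x v}"

definition selfadjoint_op :: "('h::complex_hilbert \<times> 'h) set \<Rightarrow> bool" where
  "selfadjoint_op T \<longleftrightarrow> lin_operator T \<and> closure (Domain T) = UNIV \<and> adjoint_op T = T"

definition essentially_selfadjoint_op :: "('h::complex_hilbert \<times> 'h) set \<Rightarrow> bool" where
  "essentially_selfadjoint_op T \<longleftrightarrow>
     lin_operator T \<and> closure (Domain T) = UNIV \<and> selfadjoint_op (closure T)"

definition projection_valued_measure :: "(real set \<Rightarrow> 'h::complex_hilbert \<Rightarrow> 'h) \<Rightarrow> bool" where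
  "projection_valued_measure E \<longleftrightarrow>
     (\<forall>\<Delta>\<in>sets borel.
        (\<forall>x y. E \<Delta> (x + y) = E \<Delta> x + E \<Delta> y) \<and> (\<forall>c x. E \<Delta> (c *\<^sub>C x) = c *\<^sub>C E \<Delta> x) \<and>
        E \<Delta> \<circ> E \<Delta> = E \<Delta> \<and> (\<forall>x y. cinner (E \<Delta> x) y = cinner x (E \<Delta> y))) \<and>
     E UNIV = id \<and>
     (\<forall>\<Delta> :: nat \<Rightarrow> real set. range \<Delta> \<subseteq> sets borel \<longrightarrow> disjoint_family \<Delta> \<longrightarrow>
        (\<forall>x. (\<lambda>i. E (\<Delta> i) x) sums E (\<Union>i. \<Delta> i) x))"

definition spectral_measure_at :: "(real set \<Rightarrow> 'h::complex_hilbert \<Rightarrow> 'h) \<Rightarrow> 'h \<Rightarrow> real measure" where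
  "spectral_measure_at E x = measure_of UNIV (sets borel) (\<lambda>\<Delta>. ennreal ((norm (E \<Delta> x))\<^sup>2))"

text \<open>\<open>T = \<integral>\<lambda> dE(\<lambda>)\<close>: the domain of \<open>T\<close> consists of all \<open>x\<close> with
  \<open>\<integral>\<lambda>\<^sup>2 d(E(\<lambda>)x, x) < \<infinity>\<close>, and \<open>(T x, x) = \<integral>\<lambda> d(E(\<lambda>)x, x)\<close> on it, which
  determines \<open>T\<close> by polarization.\<close>

definition resolution_of_identity ::
  "('h::complex_hilbert \<times> 'h) set \<Rightarrow> (real set \<Rightarrow> 'h \<Rightarrow> 'h) \<Rightarrow> bool" where
  "resolution_of_identity T E \<longleftrightarrow>
     projection_valued_measure E \<and>
     Domain T = {x. integrable (spectral_measure_at E x) (\<lambda>t. t\<^sup>2)} \<and>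
     (\<forall>(x, y)\<in>T. cinner y x = complex_of_real (\<integral>t. t \<partial>spectral_measure_at E x))"

definition commuting_ops :: "('h::complex_hilbert \<times> 'h) set \<Rightarrow> ('h \<times> 'h) set \<Rightarrow> bool" where
  "commuting_ops S T \<longleftrightarrow>
     (\<exists>E F. resolution_of_identity S E \<and> resolution_of_identity T F \<and>
        (\<forall>\<Delta>\<in>sets borel. \<forall>\<Delta>'\<in>sets borel. E \<Delta> \<circ> F \<Delta>' = F \<Delta>' \<circ> E \<Delta>))"

definition A_op ::
  "('a::topological_space, 'd::finite) chart set \<Rightarrow> (('a multiset \<Rightarrow> complex) \<Rightarrow> 'h::complex_hilbert) \<Rightarrow>
     ('a \<Rightarrow> real) \<Rightarrow> ('h \<times> 'h) set" where
  "A_op A \<iota> \<phi> = {(\<iota> G, \<iota> (one_particle \<phi> \<star> G)) | G. G \<in> Ffin A}"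

end

theory Submission
  imports Defs
begin

text \<open>For \<open>G \<in> Ffin A\<close> the square of the norm of \<open>A\<^sub>\<phi>\<^sup>k G\<close> is an integral of a \<open>2 k\<close>-fold
  convolution with \<open>\<phi>\<close>, which the bound on \<open>\<rho>\<close> makes at most of order \<open>(2 k)!\<close>. So all vectors of the
  domain are analytic for \<open>A\<^sub>\<phi>\<close>, and as in Nelson's theorem \<open>A\<^sub>\<phi> + c\<close> maps every dense subspace
  that is invariant under the operators onto a dense subspace, for all nonreal \<open>c\<close>. For the domain this
  is essential selfadjointness. Since the range of \<open>A\<^sub>\<psi> + d\<close> is again invariant, also
  \<open>(A\<^sub>\<phi> + c) (A\<^sub>\<psi> + d)\<close> has dense range, and there the resolvents of the two closures visibly
  commute.

  The spectral theorem for a selfadjoint \<open>T\<close> is obtained from its resolvents: the projection for the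
  half line up to \<open>l\<close> is the projection for the nonpositive part of the bounded operator
  \<open>(T - l) (1 + T\<^sup>2)\<^sup>-\<^sup>1\<close>. It is a limit of polynomials in the resolvents, so that commutation passes
  from the resolvents to the spectral projections.\<close>

section \<open>Hilbert space geometry\<close>

text \<open>Summation over all subconfigurations (\<open>K_transform\<close>) turns the convolution
  into a pointwise product. Associativity, commutativity and compatibility with conjugation follow
  at once, and with them the symmetry of the operators and their commutation on the common domain.
  This alone does not make the spectral projections commute: Nelson's counterexample has two
  operators that commute on a common invariant core and are essentially selfadjoint there. The
  missing information is dense range for the product of two shifted operators, which is why density
  is proved for arbitrary invariant dense subspaces. Growth of order k! just suffices. By (2k)!
  \<le> 4^k (k!)^2, the square root of the moment bound has the form D^k k!, so the exponential
  series of an orbit has a positive radius, which may be finite. The radius depends only on D, and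
  the exponential of a symmetric operator preserves D, so steps of one fixed length can be repeated
  to reach arbitrarily long times.\<close>

lemma cinner_add_right: "cinner x (y + z) = cinner x y + cinner x (z :: 'h::complex_hilbert)"
  by (metis cinner_add_left cinner_commute complex_cnj_add)

lemma cinner_scaleC_right: "cinner x (c *\<^sub>C y) = cnj c * cinner x (y :: 'h::complex_hilbert)"
  by (metis cinner_commute cinner_scaleC_left complex_cnj_mult)

lemma cinner_scaleR_left: "cinner (r *\<^sub>R x) y = of_real r * cinner x (y :: 'h::complex_hilbert)"
  by (simp add: scaleR_scaleC cinner_scaleC_left)

lemma cinner_scaleR_right: "cinner x (r *\<^sub>R y) = of_real r * cinner x (y :: 'h::complex_hilbert)"
  by (simp add: scaleR_scaleC cinner_scaleC_right)

lemma cinner_minus_left: "cinner (- x) y = - cinner x (y :: 'h::complex_hilbert)"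
  using cinner_scaleR_left[of "-1" x y] by simp

lemma cinner_minus_right: "cinner x (- y) = - cinner x (y :: 'h::complex_hilbert)"
  using cinner_scaleR_right[of x "-1" y] by simp

lemma cinner_diff_left: "cinner (x - y) z = cinner x z - cinner y (z :: 'h::complex_hilbert)"
  using cinner_add_left[of x "-y" z] by (simp add: cinner_minus_left)

lemma cinner_diff_right: "cinner x (y - z) = cinner x y - cinner x (z :: 'h::complex_hilbert)"
  using cinner_add_right[of x y "-z"] by (simp add: cinner_minus_right)

lemma cinner_zero [simp]:
  "cinner 0 x = 0" "cinner x (0 :: 'h::complex_hilbert) = 0"
  using cinner_diff_left[of 0 0 x] cinner_diff_right[of x 0 0] by auto

lemmas cinner_simps = cinner_add_left cinner_add_right cinner_diff_left cinner_diff_right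
  cinner_minus_left cinner_minus_right cinner_scaleR_left cinner_scaleR_right
  cinner_scaleC_left cinner_scaleC_right

lemma scaleC_minus_one: "(-1) *\<^sub>C x = - (x :: 'h::complex_hilbert)"
  using scaleR_scaleC[of "-1" x] by simp

lemma scaleC_zero [simp]: "c *\<^sub>C 0 = (0 :: 'h::complex_hilbert)" "0 *\<^sub>C x = (0 :: 'h::complex_hilbert)"
  using scaleC_add_right[of c 0 0] scaleR_scaleC[of 0 x] by auto

lemma scaleC_minus_right: "c *\<^sub>C (- x) = - (c *\<^sub>C (x :: 'h::complex_hilbert))"
  using scaleC_add_right[of c x "-x"] by (simp add: eq_neg_iff_add_eq_0 add.commute)

lemma scaleC_diff_right: "c *\<^sub>C (x - y) = c *\<^sub>C x - c *\<^sub>C (y :: 'h::complex_hilbert)"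
  using scaleC_add_right[of c x "-y"] by (simp add: scaleC_minus_right)

lemma scaleC_minus_left: "(- c) *\<^sub>C x = - (c *\<^sub>C (x :: 'h::complex_hilbert))"
  using scaleC_add_left[of c "-c" x] by (simp add: eq_neg_iff_add_eq_0 add.commute)

lemma norm_sq_cinner: "(norm (x :: 'h::complex_hilbert))\<^sup>2 = Re (cinner x x)"
  by (simp add: cinner_self)

lemma norm_scaleC: "norm (c *\<^sub>C x) = norm c * norm (x :: 'h::complex_hilbert)"
proof -
  have "(norm (c *\<^sub>C x))\<^sup>2 = Re (c * cnj c * cinner x x)"
    by (simp only: norm_sq_cinner cinner_simps mult.assoc) (simp add: mult.left_commute)
  also have "\<dots> = (norm c * norm x)\<^sup>2"
    by (simp add: cinner_self complex_norm_square[symmetric] power_mult_distrib del: complex_mult_cnj)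
  finally show ?thesis by (metis norm_ge_zero mult_nonneg_nonneg power2_eq_imp_eq)
qed

lemma norm_sq_add:
  "(norm (x + y))\<^sup>2 = (norm x)\<^sup>2 + (norm y)\<^sup>2 + 2 * Re (cinner x (y :: 'h::complex_hilbert))"
proof -
  have "Re (cinner y x) = Re (cinner x y)" by (metis cinner_commute cnj.sel(1))
  then show ?thesis by (simp add: norm_sq_cinner cinner_simps)
qed

lemma norm_sq_diff:
  "(norm (x - y))\<^sup>2 = (norm x)\<^sup>2 + (norm y)\<^sup>2 - 2 * Re (cinner x (y :: 'h::complex_hilbert))"
  using norm_sq_add[of x "-y"] by (simp add: cinner_simps)

lemma Cauchy_Schwarz_cinner: "norm (cinner x y) \<le> norm x * norm (y :: 'h::complex_hilbert)"
proof (cases "y = 0")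
  case False
  \<comment> \<open>The coefficient of the orthogonal projection of \<open>x\<close> onto the line
    through \<open>y\<close>; the inequality is the nonnegativity of the squared norm of the
    remainder.\<close>
  define c where "c = cinner x y / of_real ((norm y)\<^sup>2)"
  have ny: "norm y > 0" using False by simp
  have "0 \<le> Re (cinner (x - c *\<^sub>C y) (x - c *\<^sub>C y))" by (simp flip: norm_sq_cinner)
  also have "cinner (x - c *\<^sub>C y) (x - c *\<^sub>C y) =
      cinner x x - cnj c * cinner x y - c * cnj (cinner x y) + c * cnj c * cinner y y"
    by (simp add: cinner_simps cinner_commute[of y x] algebra_simps)
  also have "\<dots> = of_real ((norm x)\<^sup>2 - (norm (cinner x y))\<^sup>2 / (norm y)\<^sup>2)"
  proof -
    have 1: "cinner x y * cnj (cinner x y) = of_real ((norm (cinner x y))\<^sup>2)"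
      by (simp only: complex_norm_square)
    have y0: "(of_real ((norm y)\<^sup>2) :: complex) \<noteq> 0" using ny by simp
    have c1: "c * cnj (cinner x y) = of_real ((norm (cinner x y))\<^sup>2 / (norm y)\<^sup>2)"
      unfolding c_def times_divide_eq_left 1 of_real_divide ..
    then have "cnj (c * cnj (cinner x y)) = of_real ((norm (cinner x y))\<^sup>2 / (norm y)\<^sup>2)"
      by (simp only: complex_cnj_complex_of_real)
    then have c2: "cnj c * cinner x y = of_real ((norm (cinner x y))\<^sup>2 / (norm y)\<^sup>2)"
      by simp
    have "cnj c * cinner y y = cnj (cinner x y)"
      using y0 by (simp add: c_def cinner_self del: of_real_power)
    then have c3: "c * cnj c * cinner y y = of_real ((norm (cinner x y))\<^sup>2 / (norm y)\<^sup>2)"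
      using c1 by (simp only: mult.assoc)
    show ?thesis unfolding c1 c2 c3 by (simp add: cinner_self)
  qed
  finally have "(norm (cinner x y))\<^sup>2 / (norm y)\<^sup>2 \<le> (norm x)\<^sup>2" by simp
  then have "(norm (cinner x y))\<^sup>2 \<le> (norm x * norm y)\<^sup>2"
    using ny by (simp add: divide_le_eq power_mult_distrib)
  then show ?thesis by (rule power2_le_imp_le) simp
qed simp

lemma bounded_bilinear_cinner: "bounded_bilinear (cinner :: 'h::complex_hilbert \<Rightarrow> 'h \<Rightarrow> complex)"
proof
  show "\<exists>K. \<forall>a b :: 'h. norm (cinner a b) \<le> norm a * norm b * K"
    by (rule exI[of _ 1]) (simp add: Cauchy_Schwarz_cinner)
qed (simp_all add: cinner_simps scaleR_conv_of_real)

interpretation cinner: bounded_bilinear "cinner :: 'h::complex_hilbert \<Rightarrow> 'h \<Rightarrow> complex"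
  by (rule bounded_bilinear_cinner)

lemma bounded_linear_scaleC: "bounded_linear (\<lambda>x :: 'h::complex_hilbert. c *\<^sub>C x)"
proof
  show "\<exists>K. \<forall>x :: 'h. norm (c *\<^sub>C x) \<le> norm x * K"
    by (rule exI[of _ "norm c"]) (simp add: norm_scaleC mult.commute)
qed (simp_all add: scaleC_add_right scaleR_scaleC scaleC_scaleC mult.commute)

lemma cinner_eqI:
  assumes "\<And>z. cinner x z = cinner y z" shows "x = (y :: 'h::complex_hilbert)"
proof -
  have "cinner (x - y) (x - y) = 0" by (simp add: assms cinner_diff_left)
  then show ?thesis by (simp add: cinner_self)
qed

lemma eq_zero_if_orthogonal_dense:
  fixes x :: "'h::complex_hilbert"
  assumes "closure V = UNIV" "\<And>v. v \<in> V \<Longrightarrow> cinner v x = 0"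
  shows "x = 0"
proof -
  have "x \<in> closure V" using assms(1) by simp
  then obtain v where v: "\<And>n. v n \<in> V" "v \<longlonglongrightarrow> x" unfolding closure_sequential by blast
  have "(\<lambda>n. cinner (v n) x) \<longlonglongrightarrow> cinner x x"
    by (intro cinner.tendsto v tendsto_const)
  then have "cinner x x = 0" using v(1) assms(2) LIMSEQ_unique tendsto_const by (metis (no_types, lifting) ext)
  then show ?thesis by (simp add: cinner_self)
qed

text \<open>By the parallelogram law, two points of \<open>M\<close> that almost attain the infimum
  are close to each other, because their midpoint cannot beat the infimum. So a minimizing sequence
  is Cauchy, and only midpoints are needed from convexity.\<close>

lemma nearest_point_exists:
  fixes M :: "'h::complex_hilbert set"
  assumes cl: "closed M" and ne: "M \<noteq> {}" and mid: "\<And>x y. x \<in> M \<Longrightarrow> y \<in> M \<Longrightarrow> (1/2) *\<^sub>R (x + y) \<in> M"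
  shows "\<exists>p\<in>M. \<forall>q\<in>M. norm (h - p) \<le> norm (h - q)"
proof -
  define d where "d = infdist h M"
  have d0: "d \<ge> 0" by (simp add: d_def infdist_nonneg)
  have dle: "d \<le> norm (h - q)" if "q \<in> M" for q
    using infdist_le[OF that, of h] by (simp add: d_def dist_norm)
  have "\<exists>q\<in>M. norm (h - q) < d + 1 / Suc n" for n
  proof -
    have "bdd_below ((\<lambda>q. norm (h - q)) ` M)" by (rule bdd_belowI2[of _ 0]) simp
    moreover have "(INF q\<in>M. norm (h - q)) < d + 1 / Suc n"
      using ne by (simp add: d_def dist_norm infdist_notempty)
    ultimately show ?thesis using cINF_less_iff[OF ne, of "\<lambda>q. norm (h - q)"] by blast
  qed
  then obtain s where s: "\<And>n. s n \<in> M" "\<And>n. norm (h - s n) < d + 1 / Suc n" by metis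
  have lim: "(\<lambda>n. norm (h - s n)) \<longlonglongrightarrow> d"
  proof (rule real_tendsto_sandwich[of "\<lambda>_. d" _ _ "\<lambda>n. d + 1 / Suc n"])
    show "\<forall>\<^sub>F n in sequentially. d \<le> norm (h - s n)"
      "\<forall>\<^sub>F n in sequentially. norm (h - s n) \<le> d + 1 / Suc n"
      using less_imp_le[OF s(2)] s(1) dle by (auto simp del: of_nat_Suc)
    show "(\<lambda>n. d + 1 / Suc n) \<longlonglongrightarrow> d"
      using tendsto_add[OF tendsto_const[of d] LIMSEQ_inverse_real_of_nat] by (simp add: inverse_eq_divide)
  qed simp
  have par: "(norm (s m - s n))\<^sup>2 \<le> 2 * (norm (h - s m))\<^sup>2 + 2 * (norm (h - s n))\<^sup>2 - 4 * d\<^sup>2" for m n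
  proof -
    have "(norm ((h - s m) + (h - s n)))\<^sup>2 + (norm ((h - s m) - (h - s n)))\<^sup>2
        = 2 * (norm (h - s m))\<^sup>2 + 2 * (norm (h - s n))\<^sup>2"
      using norm_sq_add[of "h - s m" "h - s n"] norm_sq_diff[of "h - s m" "h - s n"] by linarith
    moreover have "(h - s m) + (h - s n) = 2 *\<^sub>R (h - (1/2) *\<^sub>R (s m + s n))"
      by (simp add: algebra_simps scaleR_2)
    then have "(norm ((h - s m) + (h - s n)))\<^sup>2 = 4 * (norm (h - (1/2) *\<^sub>R (s m + s n)))\<^sup>2"
      by (simp add: power_mult_distrib)
    moreover have "d\<^sup>2 \<le> (norm (h - (1/2) *\<^sub>R (s m + s n)))\<^sup>2"
      using d0 by (intro power_mono dle mid s)
    moreover have "norm ((h - s m) - (h - s n)) = norm (s m - s n)" by (simp add: norm_minus_commute)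
    ultimately show ?thesis by simp
  qed
  have "Cauchy s"
  proof (rule metric_CauchyI)
    fix e :: real assume e: "e > 0"
    have "(\<lambda>n. (norm (h - s n))\<^sup>2) \<longlonglongrightarrow> d\<^sup>2" by (intro tendsto_intros lim)
    then have "\<forall>\<^sub>F n in sequentially. (norm (h - s n))\<^sup>2 < d\<^sup>2 + e\<^sup>2 / 4"
      by (rule order_tendstoD) (use e in auto)
    then obtain N where N: "\<And>n. n \<ge> N \<Longrightarrow> (norm (h - s n))\<^sup>2 < d\<^sup>2 + e\<^sup>2 / 4"
      by (auto simp: eventually_sequentially)
    have "dist (s m) (s n) < e" if "m \<ge> N" "n \<ge> N" for m n
    proof -
      have "(norm (s m - s n))\<^sup>2 < e\<^sup>2" using par[of m n] N[OF that(1)] N[OF that(2)] by simp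
      then show ?thesis using e by (simp add: dist_norm power2_less_imp_less)
    qed
    then show "\<exists>N. \<forall>m\<ge>N. \<forall>n\<ge>N. dist (s m) (s n) < e" by blast
  qed
  then obtain p where p: "s \<longlonglongrightarrow> p" using Cauchy_convergent convergent_def by blast
  have "p \<in> M" using closed_sequentially[OF cl _ p] s by blast
  moreover have "norm (h - p) = d"
    using LIMSEQ_unique[OF tendsto_norm[OF tendsto_diff[OF tendsto_const p]] lim] .
  ultimately show ?thesis using dle by auto
qed

text \<open>For a point outside the closure, the difference to its nearest point in the closure
  would be a nonzero vector orthogonal to \<open>V\<close>. All density statements below are reduced
  to this.\<close>

lemma dense_if_orthogonal_trivial:
  fixes V :: "'h::complex_hilbert set"
  assumes z: "0 \<in> V" and add: "\<And>x y. x \<in> V \<Longrightarrow> y \<in> V \<Longrightarrow> x + y \<in> V"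
    and sc: "\<And>c x. x \<in> V \<Longrightarrow> c *\<^sub>C x \<in> V"
    and orth: "\<And>u. (\<And>v. v \<in> V \<Longrightarrow> cinner v u = 0) \<Longrightarrow> u = 0"
  shows "closure V = UNIV"
proof (rule ccontr)
  assume "closure V \<noteq> UNIV"
  then obtain h where h: "h \<notin> closure V" by blast
  have "(1/2) *\<^sub>R (x + y) \<in> closure V" if xy: "x \<in> closure V" "y \<in> closure V" for x y
  proof -
    obtain a b where ab: "\<And>n. a n \<in> V" "a \<longlonglongrightarrow> x" "\<And>n. b n \<in> V" "b \<longlonglongrightarrow> y"
      using xy unfolding closure_sequential by metis
    have "(1/2) *\<^sub>R (a n + b n) \<in> V" for n
      unfolding scaleR_scaleC by (intro sc add ab)
    moreover have "(\<lambda>n. (1/2) *\<^sub>R (a n + b n)) \<longlonglongrightarrow> (1/2) *\<^sub>R (x + y)"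
      by (intro tendsto_intros ab)
    ultimately show ?thesis unfolding closure_sequential
      by (intro exI[of _ "\<lambda>n. (1/2) *\<^sub>R (a n + b n)"]) auto
  qed
  moreover have "closure V \<noteq> {}" using z closure_subset by blast
  ultimately obtain p where p: "p \<in> closure V" "\<And>q. q \<in> closure V \<Longrightarrow> norm (h - p) \<le> norm (h - q)"
    using nearest_point_exists[OF closed_closure, of V h] by blast
  define u where "u = h - p"
  have real0: "Re (cinner u v) = 0" if v: "v \<in> V" for v
  proof (rule ccontr)
    assume a: "Re (cinner u v) \<noteq> 0"
    define r where "r = Re (cinner u v)"
    have nv: "v \<noteq> 0" using a by auto
    \<comment> \<open>The real \<open>t\<close> that minimizes the norm of
      \<open>u - t *\<^sub>R v\<close>; it would beat the nearest point unless \<open>r\<close>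
      vanishes.\<close>
    define t where "t = r / (norm v)\<^sup>2"
    have "p + t *\<^sub>R v \<in> closure V"
    proof -
      obtain a where a: "\<And>n. a n \<in> V" "a \<longlonglongrightarrow> p" using p(1) unfolding closure_sequential by metis
      have "a n + t *\<^sub>R v \<in> V" for n unfolding scaleR_scaleC by (intro sc add a v)
      moreover have "(\<lambda>n. a n + t *\<^sub>R v) \<longlonglongrightarrow> p + t *\<^sub>R v" by (intro tendsto_intros a)
      ultimately show ?thesis unfolding closure_sequential
        by (intro exI[of _ "\<lambda>n. a n + t *\<^sub>R v"]) auto
    qed
    from p(2)[OF this] have "(norm u)\<^sup>2 \<le> (norm (u - t *\<^sub>R v))\<^sup>2"
      by (simp add: u_def diff_diff_eq)
    also have "\<dots> = (norm u)\<^sup>2 + t\<^sup>2 * (norm v)\<^sup>2 - 2 * t * r"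
      by (simp add: norm_sq_diff cinner_simps power_mult_distrib r_def)
    also have "\<dots> = (norm u)\<^sup>2 - r\<^sup>2 / (norm v)\<^sup>2"
      using nv by (simp add: t_def field_simps power2_eq_square)
    finally show False using a nv by (simp add: r_def divide_le_0_iff)
  qed
  have "u = 0"
  proof (rule orth)
    fix v assume v: "v \<in> V"
    \<comment> \<open>\<open>V\<close> is a complex subspace, so the result for real parts applies
      to \<open>\<i> *\<^sub>C v\<close> as well.\<close>
    have "Im (cinner u v) = Re (cinner u (\<i> *\<^sub>C v))" by (simp add: cinner_simps)
    also have "\<dots> = 0" by (intro real0 sc v)
    finally have "cinner u v = 0" using real0[OF v] by (simp add: complex_eq_iff)
    then show "cinner v u = 0" by (metis cinner_commute complex_cnj_zero)
  qed
  then show False using h p by (simp add: u_def)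
qed

section \<open>Analytic vectors\<close>

text \<open>The sums over the squares i, j < N converge by continuity of the scalar product. The
  terms between square and triangle are dominated by the products of the norms, whose sum tends to
  zero by the Cauchy product theorem for numbers.\<close>

lemma cinner_Cauchy_product_sums:
  fixes a b :: "nat \<Rightarrow> 'h::complex_hilbert"
  assumes a: "summable (\<lambda>n. norm (a n))" and b: "summable (\<lambda>n. norm (b n))"
  shows "(\<lambda>k. \<Sum>i\<le>k. cinner (a i) (b (k - i))) sums cinner (\<Sum>n. a n) (\<Sum>n. b n)"
proof -
  let ?T = "\<lambda>N. {(i, j). i + j < N} :: (nat \<times> nat) set"
  let ?Q = "\<lambda>N. {..<N} \<times> {..<N} :: (nat \<times> nat) set"
  have TQ: "?T N \<subseteq> ?Q N" for N by auto
  have sq: "cinner (sum a {..<N}) (sum b {..<N}) = (\<Sum>(i, j)\<in>?Q N. cinner (a i) (b j))" for N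
    by (simp only: cinner.sum_left) (simp only: cinner.sum_right sum.cartesian_product)
  have sqn: "(\<Sum>i<N. norm (a i)) * (\<Sum>j<N. norm (b j)) = (\<Sum>(i, j)\<in>?Q N. norm (a i) * norm (b j))" for N
    by (simp add: sum_product sum.cartesian_product)
  have lim0: "(\<lambda>N. (\<Sum>(i, j)\<in>?Q N. norm (a i) * norm (b j)) - (\<Sum>(i, j)\<in>?T N. norm (a i) * norm (b j)))
      \<longlonglongrightarrow> (\<Sum>n. norm (a n)) * (\<Sum>n. norm (b n)) - (\<Sum>n. norm (a n)) * (\<Sum>n. norm (b n))"
  proof (intro tendsto_diff)
    show "(\<lambda>N. \<Sum>(i, j)\<in>?Q N. norm (a i) * norm (b j)) \<longlonglongrightarrow> (\<Sum>n. norm (a n)) * (\<Sum>n. norm (b n))"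
      unfolding sqn[symmetric] by (intro tendsto_mult summable_LIMSEQ a b)
    have "(\<lambda>k. \<Sum>i\<le>k. norm (a i) * norm (b (k - i))) sums ((\<Sum>n. norm (a n)) * (\<Sum>n. norm (b n)))"
      by (rule Cauchy_product_sums) (use a b in auto)
    then show "(\<lambda>N. \<Sum>(i, j)\<in>?T N. norm (a i) * norm (b j)) \<longlonglongrightarrow> (\<Sum>n. norm (a n)) * (\<Sum>n. norm (b n))"
      unfolding sums_def sum.triangle_reindex .
  qed
  have lim1: "(\<lambda>N. (\<Sum>(i, j)\<in>?Q N. cinner (a i) (b j)) - (\<Sum>(i, j)\<in>?T N. cinner (a i) (b j))) \<longlonglongrightarrow> 0"
  proof (rule Lim_null_comparison[OF _ lim0[unfolded diff_self]], intro always_eventually allI)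
    fix N
    have f: "finite (?Q N)" by simp
    have "(\<Sum>(i, j)\<in>?Q N. cinner (a i) (b j)) - (\<Sum>(i, j)\<in>?T N. cinner (a i) (b j)) =
        (\<Sum>(i, j)\<in>?Q N - ?T N. cinner (a i) (b j))"
      using sum_diff[OF f TQ] by metis
    moreover have "norm (\<Sum>(i, j)\<in>?Q N - ?T N. cinner (a i) (b j)) \<le>
        (\<Sum>(i, j)\<in>?Q N - ?T N. norm (a i) * norm (b j))"
      by (rule sum_norm_le) (auto simp: Cauchy_Schwarz_cinner)
    moreover have "(\<Sum>(i, j)\<in>?Q N - ?T N. norm (a i) * norm (b j)) =
        (\<Sum>(i, j)\<in>?Q N. norm (a i) * norm (b j)) - (\<Sum>(i, j)\<in>?T N. norm (a i) * norm (b j))"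
      using sum_diff[OF f TQ] by metis
    ultimately show "norm ((\<Sum>(i, j)\<in>?Q N. cinner (a i) (b j)) - (\<Sum>(i, j)\<in>?T N. cinner (a i) (b j))) \<le>
        (\<Sum>(i, j)\<in>?Q N. norm (a i) * norm (b j)) - (\<Sum>(i, j)\<in>?T N. norm (a i) * norm (b j))"
      by simp
  qed
  have "(\<lambda>N. \<Sum>(i, j)\<in>?Q N. cinner (a i) (b j)) \<longlonglongrightarrow> cinner (\<Sum>n. a n) (\<Sum>n. b n)"
    unfolding sq[symmetric]
    by (intro cinner.tendsto summable_LIMSEQ summable_norm_cancel[OF a] summable_norm_cancel[OF b])
  from tendsto_diff[OF this lim1]
  have "(\<lambda>N. \<Sum>(i, j)\<in>?T N. cinner (a i) (b j)) \<longlonglongrightarrow> cinner (\<Sum>n. a n) (\<Sum>n. b n)" by simp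
  then show ?thesis unfolding sums_def sum.triangle_reindex .
qed

text \<open>The defining equation says that \<open>v\<close> behaves like the orbit \<open>T\<^sup>n v\<^sub>0\<close> of a
  symmetric operator \<open>T\<close>.\<close>

definition analytic_orbit :: "real \<Rightarrow> (nat \<Rightarrow> 'h::complex_hilbert) \<Rightarrow> bool" where
  "analytic_orbit C v \<longleftrightarrow> (\<forall>j k. cinner (v (Suc j)) (v k) = cinner (v j) (v (Suc k))) \<and>
     (\<exists>M\<ge>0. \<forall>k. norm (v k) \<le> M * C ^ k * fact k)"

text \<open>The orbit of the vector exp(itT) \<open>v 0\<close>: since the exponential commutes with
  the powers of T, its k-th member is exp(itT) \<open>v k\<close>.\<close>

definition exp_shift :: "real \<Rightarrow> (nat \<Rightarrow> 'h::complex_hilbert) \<Rightarrow> nat \<Rightarrow> 'h" where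
  "exp_shift t v k = (\<Sum>n. ((\<i> * of_real t) ^ n /\<^sub>R fact n) *\<^sub>C v (n + k))"

lemma orbit_cinner_eq:
  fixes v :: "nat \<Rightarrow> 'h::complex_hilbert"
  assumes "\<And>j k. cinner (v (Suc j)) (v k) = cinner (v j) (v (Suc k))"
  shows "cinner (v j) (v k) = cinner (v (j + k)) (v 0)"
proof (induction k arbitrary: j)
  case (Suc k)
  then show ?case using assms[of j k] by (metis add_Suc_shift)
qed simp

text \<open>Bounding the binomial coefficient in (n+k)! by 2^(n+k) costs one factor 2 in the ratio
  of the terms, and the ratio 1/2 costs the other; hence the 4. The admissible \<open>t\<close> does
  not depend on \<open>k\<close>.\<close>

lemma exp_shift_summable:
  fixes v :: "nat \<Rightarrow> 'h::complex_hilbert"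
  assumes "analytic_orbit C v" "C > 0" "\<bar>t\<bar> \<le> 1 / (4 * C)"
  shows "summable (\<lambda>n. norm (((\<i> * of_real t) ^ n /\<^sub>R fact n) *\<^sub>C v (n + k)))"
proof -
  obtain M where M: "M \<ge> 0" "\<And>k. norm (v k) \<le> M * C ^ k * fact k"
    using assms by (auto simp: analytic_orbit_def)
  have "norm (norm (((\<i> * of_real t) ^ n /\<^sub>R fact n) *\<^sub>C v (n + k))) \<le>
      (M * (2 * C) ^ k * fact k) * (1/2) ^ n" for n
  proof -
    have "(fact (n + k) :: real) = fact n * fact k * real ((n + k) choose n)"
      using arg_cong[OF binomial_fact_lemma[of n "n + k"], of "real"] by simp
    also have "real ((n + k) choose n) \<le> 2 ^ (n + k)"
      using binomial_le_pow2[of "n + k" n] by (metis of_nat_le_iff of_nat_numeral of_nat_power)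
    finally have f: "(fact (n + k) :: real) / fact n \<le> fact k * 2 ^ (n + k)"
      by (simp add: field_simps)
    have "norm (norm (((\<i> * of_real t) ^ n /\<^sub>R fact n) *\<^sub>C v (n + k))) = \<bar>t\<bar> ^ n / fact n * norm (v (n + k))"
      by (simp add: norm_scaleC norm_power norm_mult divide_inverse mult.commute)
    also have "\<dots> \<le> \<bar>t\<bar> ^ n / fact n * (M * C ^ (n + k) * fact (n + k))"
      by (intro mult_left_mono M) simp
    also have "\<dots> = (\<bar>t\<bar> ^ n * M * C ^ (n + k)) * (fact (n + k) / fact n)"
      by simp
    also have "\<dots> \<le> (\<bar>t\<bar> ^ n * M * C ^ (n + k)) * (fact k * 2 ^ (n + k))"
      using M assms by (intro mult_left_mono f) auto
    also have "\<dots> = (M * (2 * C) ^ k * fact k) * (\<bar>t\<bar> * (2 * C)) ^ n"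
      by (simp add: power_add power_mult_distrib algebra_simps)
    also have "\<dots> \<le> (M * (2 * C) ^ k * fact k) * (1/2) ^ n"
      using M assms by (intro mult_left_mono power_mono) (auto simp: field_simps)
    finally show ?thesis .
  qed
  moreover have "summable (\<lambda>n. (M * (2 * C) ^ k * fact k) * (1/2 :: real) ^ n)"
    by (rule summable_mult[OF summable_geometric]) simp
  ultimately show ?thesis by (rule summable_comparison_test'[rotated])
qed

text \<open>Scalar products of orbit members depend only on the sum of the indices. So the N-th
  diagonal of the Cauchy product contains the binomial expansion of (s - s)^N, which leaves only N =
  0. This is the isometry of exp(itT), obtained without the operator itself.\<close>

lemma cinner_exp_shift:
  fixes v :: "nat \<Rightarrow> 'h::complex_hilbert"
  assumes v: "analytic_orbit C v" "C > 0" "\<bar>t\<bar> \<le> 1 / (4 * C)"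
  shows "cinner (exp_shift t v j) (exp_shift t v k) = cinner (v j) (v k)"
proof -
  define s where "s = \<i> * complex_of_real t"
  have h: "cinner (v i) (v l) = cinner (v (i + l)) (v 0)" for i l
    using v by (intro orbit_cinner_eq) (auto simp: analytic_orbit_def)
  have cs: "cnj s = - s" by (simp add: s_def)
  let ?a = "\<lambda>n. (s ^ n /\<^sub>R fact n) *\<^sub>C v (n + j)" and ?b = "\<lambda>n. (s ^ n /\<^sub>R fact n) *\<^sub>C v (n + k)"
  have "(\<lambda>N. \<Sum>i\<le>N. cinner (?a i) (?b (N - i))) sums cinner (\<Sum>n. ?a n) (\<Sum>n. ?b n)"
    unfolding s_def by (intro cinner_Cauchy_product_sums exp_shift_summable[OF v])
  moreover have "(\<Sum>i\<le>N. cinner (?a i) (?b (N - i))) = (if N = 0 then cinner (v j) (v k) else 0)" for N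
  proof -
    have "(\<Sum>i\<le>N. cinner (?a i) (?b (N - i))) =
        (\<Sum>i\<le>N. (s ^ i /\<^sub>R fact i) * ((- s) ^ (N - i) /\<^sub>R fact (N - i)) * cinner (v (N + j + k)) (v 0))"
    proof (rule sum.cong[OF refl])
      fix i assume "i \<in> {..N}"
      then have "i + j + (N - i + k) = N + j + k" by auto
      then have "cinner (v (i + j)) (v (N - i + k)) = cinner (v (N + j + k)) (v 0)"
        by (simp only: h[of "i + j"])
      then show "cinner (?a i) (?b (N - i)) =
          (s ^ i /\<^sub>R fact i) * ((- s) ^ (N - i) /\<^sub>R fact (N - i)) * cinner (v (N + j + k)) (v 0)"
        by (simp add: cinner_simps cs mult.assoc mult.left_commute mult.commute)
    qed
    also have "\<dots> = ((s + - s) ^ N /\<^sub>R fact N) * cinner (v (N + j + k)) (v 0)"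
      by (subst exp_series_add_commuting) (simp_all add: sum_distrib_right)
    also have "\<dots> = (if N = 0 then cinner (v j) (v k) else 0)"
      using h[of j k] by simp
    finally show ?thesis .
  qed
  ultimately have "(\<lambda>N. if N = 0 then cinner (v j) (v k) else 0) sums cinner (\<Sum>n. ?a n) (\<Sum>n. ?b n)"
    by simp
  moreover have "(\<lambda>N. if N = 0 then cinner (v j) (v k) else 0) sums cinner (v j) (v k)"
    using sums_single[of 0 "\<lambda>_. cinner (v j) (v k)"] by simp
  ultimately show ?thesis unfolding exp_shift_def s_def[symmetric] by (rule sums_unique2)
qed

text \<open>The same constant \<open>C\<close> is kept, so the step length does not shrink when the
  step is iterated.\<close>

lemma analytic_orbit_exp_shift:
  assumes v: "analytic_orbit C v" "C > 0" "\<bar>t\<bar> \<le> 1 / (4 * C)"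
  shows "analytic_orbit C (exp_shift t v)"
proof -
  have "norm (exp_shift t v k) = norm (v k)" for k
    using cinner_exp_shift[OF v, of k k] by (simp add: cinner_self flip: of_real_power)
  then show ?thesis using v unfolding analytic_orbit_def cinner_exp_shift[OF v] by simp
qed

lemma cinner_exp_shift_eigen:
  fixes v :: "nat \<Rightarrow> 'h::complex_hilbert"
  assumes v: "analytic_orbit C v" "C > 0" "\<bar>t\<bar> \<le> 1 / (4 * C)"
    and eig: "\<And>k. cinner (v (Suc k)) u = z * cinner (v k) u"
  shows "cinner (exp_shift t v k) u = exp (\<i> * of_real t * z) * cinner (v k) u"
proof -
  have e: "cinner (v (n + k)) u = z ^ n * cinner (v k) u" for n
    by (induction n) (simp_all add: eig)
  have "(\<lambda>n. cinner (((\<i> * of_real t) ^ n /\<^sub>R fact n) *\<^sub>C v (n + k)) u) sums cinner (exp_shift t v k) u"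
    unfolding exp_shift_def
    by (intro bounded_linear.sums[OF cinner.bounded_linear_left] summable_sums
        summable_norm_cancel[OF exp_shift_summable[OF v]])
  moreover have "cinner (((\<i> * of_real t) ^ n /\<^sub>R fact n) *\<^sub>C v (n + k)) u =
      ((\<i> * of_real t * z) ^ n /\<^sub>R fact n) * cinner (v k) u" for n
    by (simp add: cinner_simps e power_mult_distrib)
  ultimately have "(\<lambda>n. ((\<i> * of_real t * z) ^ n /\<^sub>R fact n) * cinner (v k) u) sums cinner (exp_shift t v k) u"
    by simp
  moreover have "(\<lambda>n. ((\<i> * of_real t * z) ^ n /\<^sub>R fact n) * cinner (v k) u) sums
      (exp (\<i> * of_real t * z) * cinner (v k) u)"
    by (intro sums_mult2 exp_converges)
  ultimately show ?thesis by (rule sums_unique2)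
qed

text \<open>If \<open>T\<close> is symmetric with analytic vector \<open>v\<^sub>0\<close> and \<open>T\<^sup>* u = cnj z u\<close>, then
  \<open>(exp (itT) v\<^sub>0, u) = exp (itz) (v\<^sub>0, u)\<close> has to stay bounded in \<open>t\<close>, although
  \<open>exp (itT)\<close> is given by its power series only for small \<open>t\<close>: the isometric
  step \<open>exp_shift t\<close> can be iterated.\<close>

lemma analytic_orbit_orthogonal:
  fixes v :: "nat \<Rightarrow> 'h::complex_hilbert"
  assumes v: "analytic_orbit C v" "C > 0"
    and eig: "\<And>k. cinner (v (Suc k)) u = z * cinner (v k) u" and z: "Im z \<noteq> 0"
  shows "cinner (v 0) u = 0"
proof (rule ccontr)
  assume nz: "cinner (v 0) u \<noteq> 0"
  \<comment> \<open>The longest admissible step, with the sign for which exp(itz) has modulus exp(-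
    t Im z) > 1.\<close>
  define t where "t = (if Im z > 0 then - 1 / (4 * C) else 1 / (4 * C))"
  have t: "\<bar>t\<bar> \<le> 1 / (4 * C)" using v by (simp add: t_def)
  have tz: "t * Im z < 0" using v z by (auto simp: t_def field_simps mult_less_0_iff)
  define r where "r = exp (\<i> * of_real t * z)"
  have "norm r = exp (- (t * Im z))" by (simp add: r_def)
  then have r: "norm r > 1" using tz by simp
  define w where "w m = (exp_shift t ^^ m) v" for m
  have w: "analytic_orbit C (w m) \<and> (\<forall>k. cinner (w m (Suc k)) u = z * cinner (w m k) u) \<and>
      norm (w m 0) = norm (v 0) \<and> cinner (w m 0) u = r ^ m * cinner (v 0) u" for m
  proof (induction m)
    case 0
    then show ?case using v eig by (simp add: w_def)
  next
    case (Suc m)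
    have ws: "w (Suc m) = exp_shift t (w m)" by (simp add: w_def)
    have o: "analytic_orbit C (w m)" "C > 0" "\<bar>t\<bar> \<le> 1 / (4 * C)" using Suc v t by auto
    have e: "cinner (w (Suc m) k) u = r * cinner (w m k) u" for k
      unfolding ws r_def using Suc by (intro cinner_exp_shift_eigen[OF o]) auto
    have "norm (w (Suc m) 0) = norm (w m 0)"
      using cinner_exp_shift[OF o, of 0 0] unfolding ws by (simp add: cinner_self flip: of_real_power)
    then show ?case using Suc analytic_orbit_exp_shift[OF o] by (simp add: e flip: ws)
  qed
  obtain m where m: "norm (v 0) * norm u / norm (cinner (v 0) u) < norm r ^ m"
    using real_arch_pow[OF r] by blast
  have "norm r ^ m * norm (cinner (v 0) u) \<le> norm (v 0) * norm u"
    using Cauchy_Schwarz_cinner[of "w m 0" u] w[of m] by (simp add: norm_mult norm_power)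
  then show False using m nz by (simp add: field_simps)
qed

section \<open>Bounded selfadjoint operators\<close>

text \<open>Linearity is a consequence of the symmetry, since the sum can be moved to the other
  argument of the scalar product; see \<open>bounded_sa_add\<close> and
  \<open>bounded_sa_scaleC\<close>.\<close>

definition bounded_sa :: "('h::complex_hilbert \<Rightarrow> 'h) \<Rightarrow> bool" where
  "bounded_sa B \<longleftrightarrow> (\<forall>x y. cinner (B x) y = cinner x (B y)) \<and> (\<exists>M. \<forall>x. norm (B x) \<le> M * norm x)"

definition positive_op :: "('h::complex_hilbert \<Rightarrow> 'h) \<Rightarrow> bool" where
  "positive_op B \<longleftrightarrow> bounded_sa B \<and> (\<forall>x. 0 \<le> Re (cinner (B x) x))"

definition projection_op :: "('h::complex_hilbert \<Rightarrow> 'h) \<Rightarrow> bool" where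
  "projection_op P \<longleftrightarrow> bounded_sa P \<and> (\<forall>x. P (P x) = P x)"

definition commutes :: "('h \<Rightarrow> 'h) \<Rightarrow> ('h \<Rightarrow> 'h) \<Rightarrow> bool" where
  "commutes A B \<longleftrightarrow> (\<forall>x. A (B x) = B (A x))"

lemma bounded_saI:
  assumes "\<And>x y. cinner (B x) y = cinner x (B y)" "\<And>x. norm (B x) \<le> M * norm x"
  shows "bounded_sa B"
  using assms by (auto simp: bounded_sa_def)

lemma bounded_sa_cinner: "bounded_sa B \<Longrightarrow> cinner (B x) y = cinner x (B y)"
  by (simp add: bounded_sa_def)

lemma bounded_sa_add: "bounded_sa B \<Longrightarrow> B (x + y) = B x + B y"
  by (rule cinner_eqI) (simp add: bounded_sa_cinner cinner_simps)

lemma bounded_sa_scaleC: "bounded_sa B \<Longrightarrow> B (c *\<^sub>C x) = c *\<^sub>C B x"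
  by (rule cinner_eqI) (simp add: bounded_sa_cinner cinner_simps)

lemma bounded_sa_bound:
  assumes "bounded_sa B" obtains M where "M > 0" "\<And>x. norm (B x) \<le> M * norm x"
proof -
  obtain M where M: "\<And>x. norm (B x) \<le> M * norm x" using assms by (auto simp: bounded_sa_def)
  have "norm (B x) \<le> (\<bar>M\<bar> + 1) * norm x" for x
    by (rule order_trans[OF M mult_right_mono]) auto
  then show ?thesis by (intro that[of "\<bar>M\<bar> + 1"]) auto
qed

lemma bounded_sa_bounded_linear:
  assumes "bounded_sa B" shows "bounded_linear B"
proof -
  obtain M where "\<And>x. norm (B x) \<le> M * norm x" using bounded_sa_bound[OF assms] by blast
  then show ?thesis
    using assms by (intro bounded_linear_intro[where K = M])
      (auto simp: bounded_sa_add bounded_sa_scaleC scaleR_scaleC mult.commute)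
qed

lemma bounded_sa_diff: "bounded_sa B \<Longrightarrow> B (x - y) = B x - B y"
  by (rule linear_diff[OF bounded_linear.linear[OF bounded_sa_bounded_linear]])

lemma bounded_sa_scaleR: "bounded_sa B \<Longrightarrow> B (r *\<^sub>R x) = r *\<^sub>R B x"
  by (simp add: scaleR_scaleC bounded_sa_scaleC)

lemma bounded_sa_zero [simp]: "bounded_sa B \<Longrightarrow> B 0 = 0"
  using bounded_sa_diff[of B 0 0] by simp

lemmas bounded_sa_simps = bounded_sa_add bounded_sa_diff bounded_sa_scaleR bounded_sa_scaleC

lemma bounded_sa_ident [simp]: "bounded_sa (\<lambda>x. x)"
  by (rule bounded_saI[where M = 1]) auto

lemma bounded_sa_plus [intro]:
  assumes "bounded_sa A" "bounded_sa B" shows "bounded_sa (\<lambda>x. A x + B x)"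
proof -
  obtain M N where "\<And>x. norm (A x) \<le> M * norm x" "\<And>x. norm (B x) \<le> N * norm x"
    using assms by (auto simp: bounded_sa_def)
  then have "norm (A x + B x) \<le> (M + N) * norm x" for x
    by (metis norm_triangle_mono distrib_right)
  then show ?thesis using assms by (intro bounded_saI) (simp_all add: cinner_simps bounded_sa_cinner)
qed

lemma bounded_sa_times [intro]:
  assumes "bounded_sa A" shows "bounded_sa (\<lambda>x. r *\<^sub>R A x)"
proof -
  obtain M where "\<And>x. norm (A x) \<le> M * norm x" using assms by (auto simp: bounded_sa_def)
  then have "norm (r *\<^sub>R A x) \<le> (\<bar>r\<bar> * M) * norm x" for x
    by (simp add: mult.assoc mult_left_mono)
  then show ?thesis using assms by (intro bounded_saI) (simp_all add: cinner_simps bounded_sa_cinner)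
qed

lemma bounded_sa_minus [intro]:
  assumes "bounded_sa A" "bounded_sa B" shows "bounded_sa (\<lambda>x. A x - B x)"
  using bounded_sa_plus[OF assms(1) bounded_sa_times[OF assms(2), of "-1"]] by simp

lemma bounded_sa_comp:
  assumes "bounded_sa A" "bounded_sa B" "commutes A B" shows "bounded_sa (\<lambda>x. A (B x))"
proof -
  obtain M N where M: "M > 0" "\<And>x. norm (A x) \<le> M * norm x" and N: "N > 0" "\<And>x. norm (B x) \<le> N * norm x"
    using bounded_sa_bound assms(1,2) by metis
  have "norm (A (B x)) \<le> (M * N) * norm x" for x
  proof -
    have "norm (A (B x)) \<le> M * norm (B x)" by (rule M)
    also have "\<dots> \<le> M * (N * norm x)" using M by (intro mult_left_mono N) auto
    finally show ?thesis by (simp add: mult.assoc)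
  qed
  moreover have "cinner (A (B x)) y = cinner x (A (B y))" for x y
    using assms by (simp add: bounded_sa_cinner commutes_def)
  ultimately show ?thesis by (rule bounded_saI[rotated])
qed

lemma bounded_sa_funpow: "bounded_sa A \<Longrightarrow> bounded_sa (A ^^ n)"
proof (induction n)
  case (Suc n)
  have "commutes A (A ^^ n)" unfolding commutes_def by (metis funpow_swap1)
  then show ?case using bounded_sa_comp[of A "A ^^ n"] Suc by (simp add: o_def)
qed (simp add: id_def)

lemma bounded_sa_limit:
  assumes "\<And>n. bounded_sa (Y n)" "\<And>n x. norm (Y n x) \<le> M * norm x" "\<And>x. (\<lambda>n. Y n x) \<longlonglongrightarrow> S x"
  shows "bounded_sa S" "norm (S x) \<le> M * norm x"
proof -
  show b: "norm (S x) \<le> M * norm x" for x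
    by (rule LIMSEQ_le_const2[OF tendsto_norm[OF assms(3)]]) (use assms(2) in auto)
  have "cinner (S x) y = cinner x (S y)" for x y
  proof (rule LIMSEQ_unique)
    show "(\<lambda>n. cinner (Y n x) y) \<longlonglongrightarrow> cinner (S x) y" by (intro cinner.tendsto assms tendsto_const)
    have "(\<lambda>n. cinner x (Y n y)) \<longlonglongrightarrow> cinner x (S y)" by (intro cinner.tendsto assms tendsto_const)
    then show "(\<lambda>n. cinner (Y n x) y) \<longlonglongrightarrow> cinner x (S y)" by (simp add: bounded_sa_cinner[OF assms(1)])
  qed
  then show "bounded_sa S" using b by (rule bounded_saI)
qed

lemma commutes_limit:
  assumes "\<And>n. commutes (Y n) B" "\<And>x. (\<lambda>n. Y n x) \<longlonglongrightarrow> S x" "bounded_linear B"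
  shows "commutes S B"
  unfolding commutes_def
proof
  fix x
  have "(\<lambda>n. B (Y n x)) \<longlonglongrightarrow> B (S x)" by (rule bounded_linear.tendsto[OF assms(3,2)])
  moreover have "(\<lambda>n. B (Y n x)) \<longlonglongrightarrow> S (B x)"
    using assms(2)[of "B x"] assms(1) by (simp add: commutes_def)
  ultimately show "S (B x) = B (S x)" using LIMSEQ_unique by blast
qed

section \<open>Positive operators and monotone strong limits\<close>

lemma positive_op_bounded_sa: "positive_op P \<Longrightarrow> bounded_sa P"
  by (simp add: positive_op_def)

lemma positive_op_square:
  assumes "bounded_sa Q" shows "positive_op (\<lambda>x. Q (Q x))"
proof -
  have "cinner (Q (Q x)) x = cinner (Q x) (Q x)" for x by (rule bounded_sa_cinner[OF assms])
  moreover have "bounded_sa (\<lambda>x. Q (Q x))" using bounded_sa_comp[OF assms assms] by (simp add: commutes_def)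
  ultimately show ?thesis by (simp add: positive_op_def flip: norm_sq_cinner)
qed

text \<open>Expand the nonnegative form of \<open>P\<close> at x - P x / L. It takes the place of
  the Cauchy-Schwarz inequality for the form of \<open>P\<close> and turns smallness of the form
  into smallness of the vector.\<close>

lemma positive_op_norm_le:
  assumes P: "positive_op P" and L: "\<And>x. Re (cinner (P x) x) \<le> L * (norm x)\<^sup>2" "L > 0"
  shows "(norm (P x))\<^sup>2 \<le> L * Re (cinner (P x) x)"
proof -
  have sa: "bounded_sa P" by (rule positive_op_bounded_sa[OF P])
  define s where "s = 1 / L"
  have "0 \<le> Re (cinner (P (x - s *\<^sub>R P x)) (x - s *\<^sub>R P x))"
    using P by (simp add: positive_op_def)
  also have "\<dots> = Re (cinner (P x) x) - 2 * s * (norm (P x))\<^sup>2 + s * s * Re (cinner (P (P x)) (P x))"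
    by (simp add: bounded_sa_simps[OF sa] cinner_simps norm_sq_cinner bounded_sa_cinner[OF sa, of "P x" x]
        algebra_simps)
  also have "\<dots> \<le> Re (cinner (P x) x) - 2 * s * (norm (P x))\<^sup>2 + s * s * (L * (norm (P x))\<^sup>2)"
    by (intro add_left_mono mult_left_mono L) simp
  also have "s * s * (L * (norm (P x))\<^sup>2) = s * (norm (P x))\<^sup>2"
    using L by (simp add: s_def)
  finally have "s * (norm (P x))\<^sup>2 \<le> Re (cinner (P x) x)" by simp
  then show ?thesis using L by (simp add: s_def field_simps)
qed

lemma positive_op_form_zero:
  assumes P: "positive_op P" and "Re (cinner (P x) x) \<le> 0" shows "P x = 0"
proof -
  obtain M where M: "M > 0" "\<And>x. norm (P x) \<le> M * norm x"
    using bounded_sa_bound[OF positive_op_bounded_sa[OF P]] by blast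
  have "Re (cinner (P x) x) \<le> M * (norm x)\<^sup>2" for x
    by (rule order_trans[OF complex_Re_le_cmod order_trans[OF Cauchy_Schwarz_cinner]])
      (use mult_right_mono[OF M(2)[of x] norm_ge_zero[of x]] in \<open>simp add: power2_eq_square mult.assoc\<close>)
  from positive_op_norm_le[OF P this M(1), of x] have "(norm (P x))\<^sup>2 \<le> 0"
    using assms(2) M(1) by (meson mult_nonneg_nonpos less_imp_le order_trans)
  then show ?thesis by simp
qed

lemma positive_op_contraction:
  assumes P: "positive_op P" and L: "\<And>x. Re (cinner (P x) x) \<le> (norm x)\<^sup>2"
  shows "norm (P x) \<le> norm x"
proof -
  have "(norm (P x))\<^sup>2 \<le> (norm x)\<^sup>2"     using order_trans[OF positive_op_norm_le[OF P, of 1 x], of "(norm x)\<^sup>2"] L by simp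
  then show ?thesis by (rule power2_le_imp_le) simp
qed

text \<open>The forms increase and are bounded, hence converge. \<open>positive_op_norm_le\<close>,
  applied to the positive differences with bound 2L, carries the Cauchy property over to the
  vectors.\<close>

lemma monotone_op_convergent:
  assumes sa: "\<And>n. bounded_sa (Y n)"
    and mono: "\<And>m n x. m \<le> n \<Longrightarrow> Re (cinner (Y m x) x) \<le> Re (cinner (Y n x) x)"
    and bound: "\<And>n x. norm (Y n x) \<le> L * norm x" and L: "L > 0"
  shows "convergent (\<lambda>n. Y n x)"
proof -
  let ?a = "\<lambda>n. Re (cinner (Y n x) x)"
  have est: "(norm (Y n x - Y m x))\<^sup>2 \<le> 2 * L * (?a n - ?a m)" if "m \<le> n" for m n
  proof -
    let ?P = "\<lambda>x. Y n x - Y m x"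
    have "positive_op ?P" using mono[OF that] sa by (auto simp: positive_op_def cinner_simps)
    moreover have "Re (cinner (?P x) x) \<le> 2 * L * (norm x)\<^sup>2" for x
    proof -
      have "Re (cinner (?P x) x) \<le> norm (?P x) * norm x"
        by (rule order_trans[OF complex_Re_le_cmod Cauchy_Schwarz_cinner])
      also have "\<dots> \<le> (L * norm x + L * norm x) * norm x"
        by (intro mult_right_mono order_trans[OF norm_triangle_ineq4] add_mono bound) simp
      finally show ?thesis by (simp add: power2_eq_square algebra_simps)
    qed
    ultimately show ?thesis using positive_op_norm_le[of ?P "2 * L" x] L by (simp add: cinner_simps)
  qed
  have "incseq ?a" by (intro monoI mono)
  moreover have "?a n \<le> L * norm x * norm x" for n
    by (intro order_trans[OF complex_Re_le_cmod] order_trans[OF Cauchy_Schwarz_cinner] mult_right_mono bound) simp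
  ultimately have "convergent ?a" by (metis incseq_convergent convergentI)
  then have "Cauchy ?a" by (rule convergent_Cauchy)
  have "Cauchy (\<lambda>n. Y n x)"
  proof (rule metric_CauchyI)
    fix e :: real assume e: "e > 0"
    then obtain N where N: "\<And>m n. m \<ge> N \<Longrightarrow> n \<ge> N \<Longrightarrow> norm (?a m - ?a n) < e\<^sup>2 / (2 * L)"
      using CauchyD[OF \<open>Cauchy ?a\<close>, of "e\<^sup>2 / (2 * L)"] L by auto
    have *: "dist (Y n x) (Y m x) < e" if "m \<ge> N" "n \<ge> N" "m \<le> n" for m n
    proof -
      have "2 * L * (?a n - ?a m) < e\<^sup>2" using N[OF that(2,1)] L by (simp add: field_simps abs_less_iff)
      then have "(norm (Y n x - Y m x))\<^sup>2 < e\<^sup>2" using est[OF that(3)] by linarith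
      then show ?thesis using e by (simp add: dist_norm power2_less_imp_less)
    qed
    then show "\<exists>N. \<forall>m\<ge>N. \<forall>n\<ge>N. dist (Y m x) (Y n x) < e"
      by (metis dist_commute nle_le)
  qed
  then show ?thesis by (rule Cauchy_convergent)
qed

text \<open>Polynomials in \<open>W\<close> with nonnegative coefficients: for these positivity is closed under
  composition without appeal to square roots.\<close>

inductive npoly :: "('h::complex_hilbert \<Rightarrow> 'h) \<Rightarrow> ('h \<Rightarrow> 'h) \<Rightarrow> bool" for W where
  npoly_zero: "npoly W (\<lambda>x. 0)"
| npoly_step: "npoly W P \<Longrightarrow> r \<ge> 0 \<Longrightarrow> npoly W (\<lambda>x. r *\<^sub>R (W ^^ k) x + P x)"

lemma npoly_add: "npoly W P \<Longrightarrow> npoly W Q \<Longrightarrow> npoly W (\<lambda>x. P x + Q x)"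
  by (induction rule: npoly.induct) (auto simp: add.assoc intro: npoly.intros)

lemma npoly_scaleR: "npoly W P \<Longrightarrow> r \<ge> 0 \<Longrightarrow> npoly W (\<lambda>x. r *\<^sub>R P x)"
  by (induction rule: npoly.induct) (auto simp: scaleR_add_right intro: npoly.intros)

lemma npoly_self: "npoly W W"
  using npoly_step[OF npoly_zero, of 1 W 1] by simp

lemma npoly_comp:
  assumes W: "bounded_sa W" and "npoly W P" "npoly W Q"
  shows "npoly W (\<lambda>x. P (Q x))"
  using assms(2)
proof (induction rule: npoly.induct)
  case (npoly_step P r k)
  have "npoly W (\<lambda>x. r *\<^sub>R (W ^^ k) (Q x))"
    using assms(3)
  proof (induction rule: npoly.induct)
    case npoly_zero
    then show ?case using bounded_sa_funpow[OF W, of k] by (simp add: npoly.npoly_zero)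
  next
    case (npoly_step Q s j)
    have "r *\<^sub>R (W ^^ k) (s *\<^sub>R (W ^^ j) x + Q x) = (r * s) *\<^sub>R (W ^^ (k + j)) x + r *\<^sub>R (W ^^ k) (Q x)" for x
      by (simp add: bounded_sa_simps[OF bounded_sa_funpow[OF W]] scaleR_add_right funpow_add)
    then show ?case using npoly.npoly_step[OF npoly_step.IH, of "r * s" "k + j"] npoly_step.hyps \<open>r \<ge> 0\<close> by simp
  qed
  then show ?case using npoly_step by (auto intro: npoly_add)
qed (simp add: npoly.npoly_zero)

lemma npoly_commutes:
  assumes "npoly W P" "commutes W B" "bounded_linear B" shows "commutes P B"
  using assms(1)
proof (induction rule: npoly.induct)
  case npoly_zero
  then show ?case using assms(3) by (simp add: commutes_def linear_simps)
next
  case (npoly_step P r k)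
  have "(W ^^ k) (B x) = B ((W ^^ k) x)" for x
    using assms(2) by (induction k) (simp_all add: commutes_def)
  then show ?case using npoly_step assms(3) by (simp add: commutes_def linear_simps)
qed

text \<open>An even power is a square, and an odd power is \<open>W\<close> between two equal
  powers, so both forms reduce to nonnegative ones.\<close>

lemma positive_op_funpow:
  assumes W: "positive_op W" shows "positive_op (W ^^ n)"
proof -
  have sa: "bounded_sa W" by (rule positive_op_bounded_sa[OF W])
  have "Re (cinner ((W ^^ n) x) x) \<ge> 0" for x
  proof -
    have c: "cinner ((W ^^ (k + k)) x) x = cinner ((W ^^ k) x) ((W ^^ k) x)"
      "cinner ((W ^^ Suc (k + k)) x) x = cinner (W ((W ^^ k) x)) ((W ^^ k) x)" for k
      by (simp_all add: funpow_add bounded_sa_cinner[OF bounded_sa_funpow[OF sa]] bounded_sa_cinner[OF sa] funpow_swap1)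
    show ?thesis
    proof (cases "even n")
      case True
      then obtain k where "n = k + k" by (metis evenE mult_2)
      then show ?thesis using c(1)[of k] by (simp flip: norm_sq_cinner)
    next
      case False
      then obtain k where "n = Suc (k + k)" by (metis oddE mult_2 Suc_eq_plus1)
      then show ?thesis using c(2)[of k] W by (simp add: positive_op_def)
    qed
  qed
  then show ?thesis using bounded_sa_funpow[OF sa] by (simp add: positive_op_def)
qed

lemma npoly_positive:
  assumes "npoly W P" "positive_op W" shows "positive_op P"
  using assms(1)
proof (induction rule: npoly.induct)
  case npoly_zero
  then show ?case by (auto simp: positive_op_def intro: bounded_saI[where M = 0])
next
  case (npoly_step P r k)
  then show ?case using positive_op_funpow[OF assms(2), of k]
    by (auto simp: positive_op_def cinner_simps)
qed

lemma positive_op_one_minus: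
  assumes A: "positive_op A" and c: "\<And>x. norm (A x) \<le> norm x"
  shows "positive_op (\<lambda>x. x - A x)" "norm (x - A x) \<le> norm x"
proof -
  have "Re (cinner (A x) x) \<le> (norm x)\<^sup>2" for x
    by (rule order_trans[OF complex_Re_le_cmod order_trans[OF Cauchy_Schwarz_cinner]])
      (use mult_right_mono[OF c[of x] norm_ge_zero[of x]] in \<open>simp add: power2_eq_square\<close>)
  then show p: "positive_op (\<lambda>x. x - A x)"
    using A by (auto simp: positive_op_def cinner_simps norm_sq_cinner)
  show "norm (x - A x) \<le> norm x"
    by (rule positive_op_contraction[OF p]) (use A in \<open>simp add: positive_op_def cinner_simps norm_sq_cinner\<close>)
qed

text \<open>With \<open>A = 1 - W\<close>, the iteration \<open>Y \<mapsto> (W + Y\<^sup>2) / 2\<close> increases to a fixed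
  point \<open>Y\<close>, for which \<open>(1 - Y)\<^sup>2 = A\<close>.\<close>

lemma positive_contraction_sqrt:
  assumes A: "positive_op A" and c: "\<And>x. norm (A x) \<le> norm x"
  shows "\<exists>S. positive_op S \<and> (\<forall>x. S (S x) = A x) \<and> (\<forall>B. bounded_linear B \<longrightarrow> commutes A B \<longrightarrow> commutes S B)"
proof -
  define W where "W x = x - A x" for x
  have W: "positive_op W" and Wc: "norm (W x) \<le> norm x" for x
    using positive_op_one_minus[OF A c] by (simp_all add: W_def[abs_def])
  have Wsa: "bounded_sa W" by (rule positive_op_bounded_sa[OF W])
  define Y where "Y = rec_nat (\<lambda>x. 0) (\<lambda>_ Z x. (1/2) *\<^sub>R (W x + Z (Z x)))"
  have Y0: "Y 0 = (\<lambda>x. 0)" and YS: "\<And>n. Y (Suc n) = (\<lambda>x. (1/2) *\<^sub>R (W x + Y n (Y n x)))"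
    by (simp_all add: Y_def)
  have np: "npoly W (Y n)" for n
  proof (induction n)
    case (Suc n)
    show ?case
      unfolding YS by (rule npoly_scaleR[OF npoly_add[OF npoly_self npoly_comp[OF Wsa Suc Suc]]]) simp
  qed (simp add: Y0 npoly_zero)
  have sa: "bounded_sa (Y n)" for n
    by (rule positive_op_bounded_sa[OF npoly_positive[OF np W]])
  have d: "npoly W (\<lambda>x. Y (Suc n) x - Y n x)" for n
  proof (induction n)
    case 0
    show ?case using npoly_scaleR[OF npoly_self, of "1/2" W] by (simp add: Y0 YS)
  next
    case (Suc n)
    \<comment> \<open>The difference of two squares without commutativity: with D = Y(n+1) - Y(n),
      Y(n+1)^2 - Y(n)^2 = D Y(n+1) + Y(n) D. So the increments remain polynomials with nonnegative
      coefficients, and their forms are nonnegative.\<close>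
    have "(\<lambda>x. Y (Suc (Suc n)) x - Y (Suc n) x) =
        (\<lambda>x. (1/2) *\<^sub>R ((\<lambda>x. Y (Suc n) x - Y n x) (Y (Suc n) x) + Y n ((\<lambda>x. Y (Suc n) x - Y n x) x)))"
    proof
      fix x
      have "Y (Suc (Suc n)) x - Y (Suc n) x = (1/2) *\<^sub>R (Y (Suc n) (Y (Suc n) x) - Y n (Y n x))"
        unfolding YS[of "Suc n"] using YS[of n] by (simp add: scaleR_diff_right[symmetric] del: scaleR_diff_right)
      then show "Y (Suc (Suc n)) x - Y (Suc n) x =
          (1/2) *\<^sub>R ((\<lambda>x. Y (Suc n) x - Y n x) (Y (Suc n) x) + Y n ((\<lambda>x. Y (Suc n) x - Y n x) x))"
        by (simp add: bounded_sa_diff[OF sa])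
    qed
    moreover have "npoly W (\<lambda>x. (1/2) *\<^sub>R ((\<lambda>x. Y (Suc n) x - Y n x) (Y (Suc n) x) + Y n ((\<lambda>x. Y (Suc n) x - Y n x) x)))"
      by (rule npoly_scaleR[OF npoly_add[OF npoly_comp[OF Wsa Suc np] npoly_comp[OF Wsa np Suc]]]) simp
    ultimately show ?case by simp
  qed
  have Yc: "norm (Y n x) \<le> norm x" for n x
  proof (induction n arbitrary: x)
    case (Suc n)
    have "norm (Y (Suc n) x) \<le> (1/2) * (norm (W x) + norm (Y n (Y n x)))"
      unfolding YS by (simp add: norm_triangle_ineq)
    also have "\<dots> \<le> (1/2) * (norm x + norm x)"
      by (intro mult_left_mono add_mono Wc order_trans[OF Suc Suc]) auto
    finally show ?case by simp
  qed (simp add: Y0)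
  have "incseq (\<lambda>n. Re (cinner (Y n x) x))" for x
    using npoly_positive[OF d W] by (intro incseq_SucI) (auto simp: positive_op_def cinner_simps)
  then have "convergent (\<lambda>n. Y n x)" for x
    by (intro monotone_op_convergent[where L = 1] sa) (use Yc in \<open>auto simp: incseq_def\<close>)
  then obtain Z where Z: "\<And>x. (\<lambda>n. Y n x) \<longlonglongrightarrow> Z x" unfolding convergent_def by metis
  have Zsa: "bounded_sa Z" and Zc: "norm (Z x) \<le> norm x" for x
    using bounded_sa_limit[of Y 1 Z, OF sa _ Z] Yc by auto
  have fixpt: "Z x = (1/2) *\<^sub>R (W x + Z (Z x))" for x
  proof (rule LIMSEQ_unique)
    show "(\<lambda>n. Y (Suc n) x) \<longlonglongrightarrow> Z x" using Z by (rule LIMSEQ_Suc)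
    \<comment> \<open>The squares converge although only strong convergence is known, because all
      \<open>Y n\<close> are contractions.\<close>
    have "(\<lambda>n. Y n (Y n x - Z x)) \<longlonglongrightarrow> 0"
      by (rule Lim_null_comparison[of _ "\<lambda>n. norm (Y n x - Z x)"])
        (use Yc Z[of x] in \<open>auto simp: LIM_zero_iff tendsto_norm_zero_iff\<close>)
    from tendsto_add[OF this Z[of "Z x"]] have "(\<lambda>n. Y n (Y n x)) \<longlonglongrightarrow> Z (Z x)"
      by (simp add: bounded_sa_diff[OF sa])
    then show "(\<lambda>n. Y (Suc n) x) \<longlonglongrightarrow> (1/2) *\<^sub>R (W x + Z (Z x))"
      unfolding YS by (intro tendsto_intros)
  qed
  define S where "S x = x - Z x" for x
  have "positive_op S"
    unfolding positive_op_def
  proof (intro conjI allI)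
    show "bounded_sa S" unfolding S_def[abs_def] using Zsa by auto
    fix x
    have "Re (cinner (Z x) x) \<le> (norm x)\<^sup>2"
      by (rule order_trans[OF complex_Re_le_cmod order_trans[OF Cauchy_Schwarz_cinner]])
        (use mult_right_mono[OF Zc[of x] norm_ge_zero[of x]] in \<open>simp add: power2_eq_square\<close>)
    then show "0 \<le> Re (cinner (S x) x)" by (simp add: S_def cinner_simps norm_sq_cinner)
  qed
  moreover have "S (S x) = A x" for x
  proof -
    have "2 *\<^sub>R Z x = W x + Z (Z x)" using fixpt[of x] by (metis scaleR_half_double scaleR_2 scaleR_scaleR scaleR_one scaleR_left.add field_sum_of_halves)
    then have "Z x + Z x = W x + Z (Z x)" by (simp add: scaleR_2)
    then show ?thesis by (simp add: S_def bounded_sa_diff[OF Zsa] W_def algebra_simps)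
  qed
  moreover have "commutes S B" if B: "bounded_linear B" "commutes A B" for B
  proof -
    have "commutes W B" using B by (simp add: commutes_def W_def linear_simps)
    then have "commutes Z B" by (intro commutes_limit[OF npoly_commutes[OF np] Z] B)
    then show ?thesis using B by (simp add: commutes_def S_def linear_simps)
  qed
  ultimately show ?thesis by blast
qed

lemma positive_op_sqrt:
  assumes A: "positive_op A"
  shows "\<exists>S. positive_op S \<and> (\<forall>x. S (S x) = A x) \<and> (\<forall>B. bounded_linear B \<longrightarrow> commutes A B \<longrightarrow> commutes S B)"
proof -
  have sa: "bounded_sa A" by (rule positive_op_bounded_sa[OF A])
  obtain M where M: "M > 0" "\<And>x. norm (A x) \<le> M * norm x" using bounded_sa_bound[OF sa] by blast
  let ?A = "\<lambda>x. (1 / M) *\<^sub>R A x"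
  have "positive_op ?A" using A M by (auto simp: positive_op_def cinner_simps)
  moreover have "norm (?A x) \<le> norm x" for x using M by (simp add: field_simps)
  ultimately obtain S where S: "positive_op S" "\<And>x. S (S x) = ?A x"
      "\<And>B. bounded_linear B \<Longrightarrow> commutes ?A B \<Longrightarrow> commutes S B"
    using positive_contraction_sqrt by blast
  have Ssa: "bounded_sa S" by (rule positive_op_bounded_sa[OF S(1)])
  have "positive_op (\<lambda>x. sqrt M *\<^sub>R S x)" using S(1) M by (auto simp: positive_op_def cinner_simps)
  moreover have "sqrt M *\<^sub>R S (sqrt M *\<^sub>R S x) = A x" for x
    using M by (simp add: bounded_sa_simps[OF Ssa] S(2))
  moreover have "commutes (\<lambda>x. sqrt M *\<^sub>R S x) B" if "bounded_linear B" "commutes A B" for B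
  proof -
    have "commutes ?A B" using that by (simp add: commutes_def linear_simps)
    from S(3)[OF that(1) this] show ?thesis using that by (simp add: commutes_def linear_simps)
  qed
  ultimately show ?thesis by (intro exI[of _ "\<lambda>x. sqrt M *\<^sub>R S x"]) blast
qed

text \<open>The square root of \<open>Q\<close> commutes with \<open>P\<close>, so the form of the
  product at \<open>x\<close> is the form of \<open>P\<close> at the root applied to
  \<open>x\<close>.\<close>

lemma positive_op_comp:
  assumes "positive_op P" "positive_op Q" "commutes P Q"
  shows "0 \<le> Re (cinner (P (Q x)) x)"
proof -
  obtain S where S: "positive_op S" "\<And>x. S (S x) = Q x"
      "\<And>B. bounded_linear B \<Longrightarrow> commutes Q B \<Longrightarrow> commutes S B"
    using positive_op_sqrt[OF assms(2)] by blast
  have Ssa: "bounded_sa S" by (rule positive_op_bounded_sa[OF S(1)])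
  have "commutes S P"
    using assms by (intro S(3) bounded_sa_bounded_linear positive_op_bounded_sa) (auto simp: commutes_def)
  then have "P (Q x) = S (P (S x))" by (simp add: commutes_def flip: S(2))
  then have "cinner (P (Q x)) x = cinner (P (S x)) (S x)" by (simp add: bounded_sa_cinner[OF Ssa])
  then show ?thesis using assms(1) by (simp add: positive_op_def)
qed

text \<open>If \<open>\<parallel>L\<parallel> \<le> 1\<close>, the projection onto the kernel of \<open>L\<close> is the strong limit of
  \<open>(1 - L\<^sup>2)\<^sup>n\<close>.\<close>

lemma kernel_projection:
  assumes L: "bounded_sa L"
  shows "\<exists>F. projection_op F \<and> (\<forall>x. F x = x \<longleftrightarrow> L x = 0) \<and>
    (\<forall>B. bounded_linear B \<longrightarrow> commutes L B \<longrightarrow> commutes F B)"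
proof -
  obtain M where M: "M > 0" "\<And>x. norm (L x) \<le> M * norm x" using bounded_sa_bound[OF L] by blast
  define Q where "Q x = (1 / M) *\<^sub>R L x" for x
  have Q: "bounded_sa Q" unfolding Q_def[abs_def] using L by auto
  have Qc: "norm (Q x) \<le> norm x" for x using M by (simp add: Q_def field_simps)
  define A where "A x = Q (Q x)" for x
  have A: "positive_op A"
    unfolding A_def[abs_def] by (rule positive_op_square[OF Q])
  have Ac: "norm (A x) \<le> norm x" for x unfolding A_def by (rule order_trans[OF Qc Qc])
  define W where "W x = x - A x" for x
  have W: "positive_op W" and Wc: "norm (W x) \<le> norm x" for x
    using positive_op_one_minus[OF A Ac] by (simp_all add: W_def[abs_def])
  have Wsa: "bounded_sa W" by (rule positive_op_bounded_sa[OF W])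
  have WQ: "(W ^^ n) (Q x) = Q ((W ^^ n) x)" for n x
    by (induction n) (simp_all add: W_def A_def bounded_sa_diff[OF Q])
  have Wnc: "norm ((W ^^ n) x) \<le> norm x" for n x
    by (induction n) (auto intro: order_trans[OF Wc])
  have Wn: "bounded_sa (W ^^ n)" for n by (rule bounded_sa_funpow[OF Wsa])
  \<comment> \<open>As \<open>W\<close> is 1 - Q^2 and commutes with \<open>Q\<close>, passing to
    the next power subtracts the form of \<open>W ^^ n\<close> at \<open>Q x\<close>.\<close>
  have "Re (cinner ((W ^^ Suc n) x) x) \<le> Re (cinner ((W ^^ n) x) x)" for n x
  proof -
    have "(W ^^ Suc n) x = (W ^^ n) x - Q ((W ^^ n) (Q x))"
      by (simp add: W_def[of "(W ^^ n) x"] A_def WQ)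
    then have "cinner ((W ^^ Suc n) x) x = cinner ((W ^^ n) x) x - cinner ((W ^^ n) (Q x)) (Q x)"
      by (simp add: cinner_simps bounded_sa_cinner[OF Q])
    then show ?thesis using positive_op_funpow[OF W, of n] by (simp add: positive_op_def)
  qed
  then have dec: "decseq (\<lambda>n. Re (cinner ((W ^^ n) x) x))" for x by (rule decseq_SucI)
  \<comment> \<open>The sign turns the decreasing sequence into an increasing one.\<close>
  have "convergent (\<lambda>n. (-1) *\<^sub>R (W ^^ n) x)" for x
    by (rule monotone_op_convergent[where L = 1])
      (use Wn Wnc dec in \<open>auto simp: decseq_def cinner_simps intro: bounded_sa_times[where r = "-1", simplified]\<close>)
  then have "convergent (\<lambda>n. (W ^^ n) x)" for x using convergent_minus_iff[of "\<lambda>n. (W ^^ n) x"] by simp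
  then obtain F where F: "\<And>x. (\<lambda>n. (W ^^ n) x) \<longlonglongrightarrow> F x" unfolding convergent_def by metis
  have Fsa: "bounded_sa F" using bounded_sa_limit(1)[of "\<lambda>n. W ^^ n" 1 F, OF Wn _ F] Wnc by auto
  have WF: "W (F x) = F x" for x
  proof (rule LIMSEQ_unique)
    show "(\<lambda>n. W ((W ^^ n) x)) \<longlonglongrightarrow> W (F x)"
      by (rule bounded_linear.tendsto[OF bounded_sa_bounded_linear[OF Wsa] F])
    show "(\<lambda>n. W ((W ^^ n) x)) \<longlonglongrightarrow> F x" using LIMSEQ_Suc[OF F, of x] by simp
  qed
  have QF: "Q (F x) = 0" for x
  proof -
    have "Q (Q (F x)) = 0" using WF[of x] by (simp add: W_def A_def)
    then have "cinner (Q (F x)) (Q (F x)) = 0" by (metis bounded_sa_cinner[OF Q] cinner_zero(1))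
    then show ?thesis by (simp add: cinner_self)
  qed
  have Fx: "F x = x" if "Q x = 0" for x
  proof -
    have "W x = x" using that Q by (simp add: W_def A_def)
    then have "(W ^^ n) x = x" for n by (induction n) auto
    then show ?thesis using F[of x] LIMSEQ_unique[OF tendsto_const] by force
  qed
  have "projection_op F" using Fsa Fx QF by (simp add: projection_op_def)
  moreover have "F x = x \<longleftrightarrow> L x = 0" for x
    using Fx[of x] QF[of x] M by (auto simp: Q_def)
  moreover have "commutes F B" if B: "bounded_linear B" "commutes L B" for B
  proof -
    have "commutes Q B" using B by (simp add: commutes_def Q_def linear_simps)
    then have "commutes W B" using B by (simp add: commutes_def W_def A_def linear_simps)
    then have "(W ^^ n) (B x) = B ((W ^^ n) x)" for n x by (induction n) (auto simp: commutes_def)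
    then show ?thesis by (intro commutes_limit[OF _ F] B) (simp add: commutes_def)
  qed
  ultimately show ?thesis by blast
qed

text \<open>The spectral projection of \<open>K\<close> for the half line of nonpositive numbers: the projection
  onto the kernel of \<open>\<bar>K\<bar> + K\<close>.\<close>

lemma nonpositive_part_projection:
  assumes K: "bounded_sa K"
  shows "\<exists>F. projection_op F \<and> (\<forall>x. F x = x \<longrightarrow> Re (cinner (K x) x) \<le> 0) \<and>
    (\<forall>x. F x = 0 \<longrightarrow> Re (cinner (K x) x) \<ge> 0) \<and>
    (\<forall>x. F x = 0 \<longrightarrow> Re (cinner (K x) x) \<le> 0 \<longrightarrow> x = 0) \<and>
    (\<forall>B. bounded_linear B \<longrightarrow> commutes K B \<longrightarrow> commutes F B)"
proof -
  obtain S where S: "positive_op S" "\<And>x. S (S x) = K (K x)"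
      "\<And>B. bounded_linear B \<Longrightarrow> commutes (\<lambda>x. K (K x)) B \<Longrightarrow> commutes S B"
    using positive_op_sqrt[OF positive_op_square[OF K]] by blast
  have Ssa: "bounded_sa S" by (rule positive_op_bounded_sa[OF S(1)])
  have SK: "S (K x) = K (S x)" for x
    using S(3)[OF bounded_sa_bounded_linear[OF K]] by (simp add: commutes_def)
  define L where "L x = S x + K x" for x
  have L: "bounded_sa L" unfolding L_def[abs_def] using Ssa K by auto
  obtain F where F: "projection_op F" "\<And>x. F x = x \<longleftrightarrow> L x = 0"
      "\<And>B. bounded_linear B \<Longrightarrow> commutes L B \<Longrightarrow> commutes F B"
    using kernel_projection[OF L] by blast
  have LB: "commutes L B" if "bounded_linear B" "commutes K B" for B
    using that S(3)[OF that(1)] by (simp add: commutes_def L_def linear_simps)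
  have neg: "Re (cinner (K x) x) \<le> 0" if "F x = x" for x
  proof -
    have "K x = - S x" using that F(2) by (simp add: L_def add_eq_0_iff)
    then show ?thesis using S(1) by (simp add: positive_op_def cinner_simps)
  qed
  \<comment> \<open>From S^2 = K^2, (S + K)(S - K) = 0, so \<open>F\<close> fixes the range of S -
    K. Because \<open>F\<close> commutes with S - K, the latter vanishes where \<open>F\<close>
    does.\<close>
  have eq: "K x = S x" if "F x = 0" for x
  proof -
    let ?D = "\<lambda>x. S x - K x"
    have Dsa: "bounded_sa ?D" using Ssa K by auto
    have "L (?D x) = 0"
      by (simp add: L_def bounded_sa_diff[OF Ssa] bounded_sa_diff[OF K] S(2) SK)
    then have "F (?D x) = ?D x" by (simp add: F(2))
    moreover have "commutes F ?D"
      by (intro F(3) bounded_sa_bounded_linear Dsa)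
        (simp add: commutes_def L_def bounded_sa_simps[OF Ssa] bounded_sa_simps[OF K] SK algebra_simps S(2))
    ultimately have "?D x = ?D (F x)" by (simp add: commutes_def)
    then show ?thesis using that Ssa K by simp
  qed
  \<comment> \<open>Where \<open>F\<close> vanishes, \<open>K\<close> is the positive
    \<open>S\<close>; a nonpositive form then puts \<open>x\<close> into the kernel of S + K, which
    is the range of \<open>F\<close>.\<close>
  have zero: "x = 0" if "F x = 0" "Re (cinner (K x) x) \<le> 0" for x
  proof -
    have "S x = 0" using that eq by (intro positive_op_form_zero[OF S(1)]) simp
    then have "L x = 0" using eq[OF that(1)] by (simp add: L_def)
    then show ?thesis using F(2)[of x] that(1) by simp
  qed
  have "Re (cinner (K x) x) \<ge> 0" if "F x = 0" for x
    using eq[OF that] S(1) by (simp add: positive_op_def)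
  then show ?thesis using F(1,3) LB neg zero by blast
qed

section \<open>Orthogonal projections and their series\<close>

lemma projection_op_norm:
  assumes "projection_op P" shows "Re (cinner (P x) x) = (norm (P x))\<^sup>2" "norm (P x) \<le> norm x"
proof -
  have "cinner (P x) x = cinner (P x) (P x)"
    using assms bounded_sa_cinner[of P "P x" x] by (simp add: projection_op_def)
  then show 1: "Re (cinner (P x) x) = (norm (P x))\<^sup>2" by (simp add: norm_sq_cinner)
  have "(norm (P x))\<^sup>2 \<le> norm (P x) * norm x"
    unfolding 1[symmetric] by (rule order_trans[OF complex_Re_le_cmod Cauchy_Schwarz_cinner])
  then show "norm (P x) \<le> norm x"
    by (cases "P x = 0") (auto simp: power2_eq_square)
qed

lemma projection_op_bounded_sa: "projection_op P \<Longrightarrow> bounded_sa P"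
  by (simp add: projection_op_def)

lemma projection_op_pythagoras:
  assumes "projection_op P" shows "(norm (x - P x))\<^sup>2 = (norm x)\<^sup>2 - (norm (P x))\<^sup>2"
proof -
  have "Re (cinner x (P x)) = (norm (P x))\<^sup>2"
    using projection_op_norm(1)[OF assms, of x] projection_op_bounded_sa[OF assms]
    by (simp add: bounded_sa_cinner)
  then show ?thesis by (simp add: norm_sq_diff)
qed

lemma projection_op_compl:
  assumes "projection_op P" shows "projection_op (\<lambda>x. x - P x)"
  using assms by (auto simp: projection_op_def bounded_sa_diff)

text \<open>The form of a projection is the square of the norm of the projected vector, so the
  difference has zero form and vanishes by \<open>positive_op_form_zero\<close>. This makes the
  spectral projections unique.\<close>

lemma projection_op_eq:
  assumes P: "projection_op P" and Q: "projection_op Q" and eq: "\<And>x. norm (P x) = norm (Q x)"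
  shows "P = Q"
proof
  fix x
  have "positive_op (\<lambda>x. P x - Q x)"
    using projection_op_bounded_sa P Q
    by (auto simp: positive_op_def cinner_simps projection_op_norm(1) eq)
  from positive_op_form_zero[OF this, of x] show "P x = Q x"
    using P Q by (simp add: cinner_simps projection_op_norm(1) eq)
qed

text \<open>The Bessel inequality already forces orthogonality of the ranges: at a vector
  \<open>P j x\<close> the j-th term alone exhausts the right side. The partial sums are then
  increasing projections.\<close>

lemma projection_series:
  assumes P: "\<And>i. projection_op (P i)" and le: "\<And>n x. (\<Sum>i<n. (norm (P i x))\<^sup>2) \<le> (norm x)\<^sup>2"
  shows "\<exists>Q. projection_op Q \<and> (\<forall>x. (\<lambda>i. P i x) sums Q x) \<and> (\<forall>x. (\<lambda>i. (norm (P i x))\<^sup>2) sums (norm (Q x))\<^sup>2)"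
proof -
  have sa: "bounded_sa (P i)" for i by (rule projection_op_bounded_sa[OF P])
  have orth: "P i (P j x) = 0" if "i \<noteq> j" for i j x
  proof -
    have "(\<Sum>k\<in>{i, j}. (norm (P k (P j x)))\<^sup>2) \<le> (\<Sum>k<Suc (max i j). (norm (P k (P j x)))\<^sup>2)"
      by (rule sum_mono2) auto
    also have "\<dots> \<le> (norm (P j x))\<^sup>2" by (rule le)
    finally show ?thesis using that P[of j] by (simp add: projection_op_def)
  qed
  define S where "S n x = (\<Sum>i<n. P i x)" for n x
  have Ssa: "bounded_sa (S n)" for n
  proof (induction n)
    case 0
    then show ?case by (auto simp: S_def intro: bounded_saI[where M = 0])
  next
    case (Suc n)
    then show ?case using sa[of n] by (auto simp: S_def[abs_def])
  qed
  have PS: "P k (S n x) = (if k < n then P k x else 0)" for k n x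
  proof -
    have "P k (S n x) = (\<Sum>i<n. P k (P i x))"
      unfolding S_def by (rule linear_sum[OF bounded_linear.linear[OF bounded_sa_bounded_linear[OF sa]]])
    also have "\<dots> = (\<Sum>i<n. if i = k then P k x else 0)"
      using orth P by (intro sum.cong) (auto simp: projection_op_def)
    finally show ?thesis by simp
  qed
  have nS: "(norm (S n x))\<^sup>2 = (\<Sum>i<n. (norm (P i x))\<^sup>2)" and fS: "Re (cinner (S n x) x) = (\<Sum>i<n. (norm (P i x))\<^sup>2)" for n x
  proof -
    show f: "Re (cinner (S n x) x) = (\<Sum>i<n. (norm (P i x))\<^sup>2)"
      by (simp add: S_def cinner.sum_left projection_op_norm(1)[OF P])
    have "S n (S n x) = (\<Sum>i<n. P i (S n x))" by (rule S_def)
    also have "\<dots> = (\<Sum>i<n. P i x)" by (intro sum.cong) (auto simp: PS)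
    finally have "S n (S n x) = S n x" by (simp add: S_def)
    then have "cinner (S n x) (S n x) = cinner (S n x) x"
      using bounded_sa_cinner[OF Ssa, of n "S n x" x] by simp
    then show "(norm (S n x))\<^sup>2 = (\<Sum>i<n. (norm (P i x))\<^sup>2)" using f by (simp add: norm_sq_cinner)
  qed
  have bd: "norm (S n x) \<le> 1 * norm x" for n x
    using le[where n = n and x = x] nS[of n x] by (auto intro: power2_le_imp_le)
  have "convergent (\<lambda>n. S n x)" for x
    by (rule monotone_op_convergent[where L = 1, OF Ssa _ bd]) (auto simp: fS intro!: sum_mono2)
  then obtain Q where Q: "\<And>x. (\<lambda>n. S n x) \<longlonglongrightarrow> Q x" unfolding convergent_def by metis
  have Qsa: "bounded_sa Q" by (rule bounded_sa_limit(1)[OF Ssa bd Q])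
  have PQ: "P k (Q x) = P k x" for k x
  proof (rule LIMSEQ_unique)
    show "(\<lambda>n. P k (S n x)) \<longlonglongrightarrow> P k (Q x)"
      by (rule bounded_linear.tendsto[OF bounded_sa_bounded_linear[OF sa] Q])
    show "(\<lambda>n. P k (S n x)) \<longlonglongrightarrow> P k x"
      by (rule tendsto_eventually, rule eventually_mono[OF eventually_gt_at_top[of k]]) (simp add: PS)
  qed
  have "S n (Q x) = S n x" for n x by (simp add: S_def PQ)
  then have "Q (Q x) = Q x" for x using Q[of "Q x"] Q[of x] LIMSEQ_unique by simp
  then have "projection_op Q" using Qsa by (simp add: projection_op_def)
  moreover have "(\<lambda>i. P i x) sums Q x" for x using Q[of x] by (simp add: sums_def S_def)
  moreover have "(\<lambda>i. (norm (P i x))\<^sup>2) sums (norm (Q x))\<^sup>2" for x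
    unfolding sums_def nS[symmetric] by (intro tendsto_intros Q)
  ultimately show ?thesis by blast
qed

text \<open>The form of a symmetric operator is real, so the cross term in the squared norm of y
  \<plusminus> ix drops out and leaves the sum of the squares.\<close>

lemma symmetric_graph_norm_le:
  fixes x y :: "'h::complex_hilbert"
  assumes "cinner y x = cinner x y" "c = \<i> \<or> c = - \<i>" shows "norm x \<le> norm (y + c *\<^sub>C x)"
proof -
  have "Im (cinner x y) = 0"
    using assms(1) by (metis cinner_commute Reals_cnj_iff complex_is_Real_iff)
  then have "Re (cinner y (c *\<^sub>C x)) = 0" using assms by (auto simp: cinner_simps)
  then have "(norm (y + c *\<^sub>C x))\<^sup>2 = (norm y)\<^sup>2 + (norm x)\<^sup>2"
    using assms(2) norm_sq_add[of y "c *\<^sub>C x"] by (auto simp: norm_scaleC)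
  then show ?thesis using power2_le_imp_le[of "norm x" "norm (y + c *\<^sub>C x)"] by simp
qed

section \<open>The spectral family of a selfadjoint operator\<close>

text \<open>The basic criterion for selfadjointness: closed, symmetric, with T + i and T - i onto.
  Density of the domain and equality with the adjoint are derived in
  \<open>selfadjoint\<close>.\<close>

locale selfadjoint_graph =
  fixes T :: "('h::complex_hilbert \<times> 'h) set"
  assumes lin: "lin_operator T"
    and closed: "closed T"
    and sym: "\<And>x y x' y'. (x, y) \<in> T \<Longrightarrow> (x', y') \<in> T \<Longrightarrow> cinner y x' = cinner x y'"
    and surj: "\<And>c h. c = \<i> \<or> c = - \<i> \<Longrightarrow> \<exists>x. (x, h - c *\<^sub>C x) \<in> T"
begin

lemma graph_add: "(x, y) \<in> T \<Longrightarrow> (x', y') \<in> T \<Longrightarrow> (x + x', y + y') \<in> T"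
  using lin unfolding lin_operator_def by blast

lemma graph_scaleC: "(x, y) \<in> T \<Longrightarrow> (c *\<^sub>C x, c *\<^sub>C y) \<in> T"
  using lin unfolding lin_operator_def by blast

lemma graph_scaleR: "(x, y) \<in> T \<Longrightarrow> (r *\<^sub>R x, r *\<^sub>R y) \<in> T"
  unfolding scaleR_scaleC by (rule graph_scaleC)

lemma graph_diff: "(x, y) \<in> T \<Longrightarrow> (x', y') \<in> T \<Longrightarrow> (x - x', y - y') \<in> T"
  using graph_add[OF _ graph_scaleR[of x' y' "-1"], of x y] by simp

lemma graph_unique: "(x, y) \<in> T \<Longrightarrow> (x, y') \<in> T \<Longrightarrow> y = y'"
  using lin unfolding lin_operator_def single_valued_def by blast

lemma graph_form_real: "(x, y) \<in> T \<Longrightarrow> Im (cinner x y) = 0"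
  using sym[of x y x y] by (metis cinner_commute Reals_cnj_iff complex_is_Real_iff)

lemma graph_norm_le:
  assumes "(x, h - c *\<^sub>C x) \<in> T" "c = \<i> \<or> c = - \<i>" shows "norm x \<le> norm h"
  using symmetric_graph_norm_le[OF sym[OF assms(1) assms(1)] assms(2)] by simp

lemma selfadjoint: "selfadjoint_op T"
proof -
  have "closure (Domain T) = UNIV"
  proof (rule dense_if_orthogonal_trivial)
    show "0 \<in> Domain T" using lin by (auto simp: lin_operator_def)
    show "x + y \<in> Domain T" if "x \<in> Domain T" "y \<in> Domain T" for x y
      using that graph_add unfolding Domain_iff by blast
    show "c *\<^sub>C x \<in> Domain T" if "x \<in> Domain T" for c x
      using that graph_scaleC unfolding Domain_iff by blast
    fix u assume u: "\<And>v. v \<in> Domain T \<Longrightarrow> cinner v u = 0"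
    \<comment> \<open>For \<open>u\<close> orthogonal to the domain, solve (T + i) x = u. Then the
      form of T at \<open>x\<close> is i times the squared norm of \<open>x\<close>; being real, it
      is zero.\<close>
    obtain x where x: "(x, u - \<i> *\<^sub>C x) \<in> T" using surj[of \<i> u] by blast
    have "cinner x u = 0" using u x by blast
    then have "cinner x (u - \<i> *\<^sub>C x) = \<i> * (norm x)\<^sup>2" by (simp add: cinner_simps cinner_self)
    then have "x = 0" using graph_form_real[OF x] by simp
    then have "(0, u) \<in> T" "(0, 0) \<in> T" using x lin by (auto simp: lin_operator_def)
    then show "u = 0" by (rule graph_unique)
  qed
  moreover have "adjoint_op T = T"
  proof (intro equalityI subsetI)
    fix p assume "p \<in> T"
    then show "p \<in> adjoint_op T" using sym by (cases p) (auto simp: adjoint_op_def)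
  next
    fix p assume p: "p \<in> adjoint_op T"
    obtain u v where uv: "p = (u, v)" by fastforce
    \<comment> \<open>Choose \<open>x\<close> in the domain so that T + i maps it to the vector to
      which the adjoint plus i maps \<open>u\<close>. The difference \<open>w\<close> is orthogonal
      to the range of T - i, which is everything; \<open>q\<close> is the preimage of
      \<open>w\<close>.\<close>
    obtain x where x: "(x, v + \<i> *\<^sub>C u - \<i> *\<^sub>C x) \<in> T" using surj[of \<i>] by blast
    define w where "w = u - x"
    obtain q where q: "(q, w + \<i> *\<^sub>C q) \<in> T" using surj[of "-\<i>" w] by (auto simp: scaleC_minus_left)
    have "cinner (w + \<i> *\<^sub>C q) u = cinner q v" using p q by (auto simp: adjoint_op_def uv)
    moreover have "cinner (w + \<i> *\<^sub>C q) x = cinner q (v + \<i> *\<^sub>C u - \<i> *\<^sub>C x)" by (rule sym[OF q x])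
    ultimately have "cinner (w + \<i> *\<^sub>C q) w = - cinner q (\<i> *\<^sub>C w)"
      unfolding w_def by (simp add: cinner_simps algebra_simps)
    then have "cinner w w = 0" by (simp add: cinner_simps)
    then have "u = x" by (simp add: cinner_self w_def)
    then show "p \<in> T" using x by (simp add: uv)
  qed
  ultimately show ?thesis using lin by (simp add: selfadjoint_op_def)
qed

text \<open>\<open>res \<i>\<close> and \<open>res (- \<i>)\<close> are the resolvents \<open>(T + \<i>)\<^sup>-\<^sup>1\<close> and
  \<open>(T - \<i>)\<^sup>-\<^sup>1\<close>.\<close>

definition res :: "complex \<Rightarrow> 'h \<Rightarrow> 'h" where
  "res c h = (SOME x. (x, h - c *\<^sub>C x) \<in> T)"

context
  fixes c :: complex
  assumes c: "c = \<i> \<or> c = - \<i>"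
begin

lemma res_in: "(res c h, h - c *\<^sub>C res c h) \<in> T"
  unfolding res_def by (rule someI_ex[OF surj[OF c]])

lemma res_eq: assumes "(x, h - c *\<^sub>C x) \<in> T" shows "res c h = x"
proof -
  have "(x - res c h, 0 - c *\<^sub>C (x - res c h)) \<in> T"
    using graph_diff[OF assms res_in[of h]] by (simp add: scaleC_diff_right algebra_simps)
  from graph_norm_le[OF this c] show ?thesis by simp
qed

lemma res_bounded_linear: "bounded_linear (res c)"
proof (rule bounded_linear_intro)
  show "res c (x + y) = res c x + res c y" for x y
    using graph_add[OF res_in[of x] res_in[of y]] by (intro res_eq) (simp add: scaleC_add_right algebra_simps)
  show "res c (r *\<^sub>R x) = r *\<^sub>R res c x" for r x
    using graph_scaleR[OF res_in[of x], of r]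
    by (intro res_eq) (simp add: scaleC_diff_right scaleR_scaleC scaleC_scaleC mult.commute)
  show "norm (res c x) \<le> norm x * 1" for x using graph_norm_le[OF res_in c] by simp
qed

lemma res_scaleC: "res c (d *\<^sub>C x) = d *\<^sub>C res c x"
  using graph_scaleC[OF res_in[of x], of d]
  by (intro res_eq) (simp add: scaleC_diff_right scaleC_scaleC mult.commute)

lemma res_norm: "norm (res c x) \<le> norm x"
  by (rule graph_norm_le[OF res_in c])

lemma res_inj: "res c x = 0 \<Longrightarrow> x = 0"
  using res_in[of x] lin graph_unique by (auto simp: lin_operator_def)

end

lemma res_adjoint: "cinner (res \<i> x) y = cinner x (res (- \<i>) y)"
proof -
  have "cinner (x - \<i> *\<^sub>C res \<i> x) (res (- \<i>) y) = cinner (res \<i> x) (y - (- \<i>) *\<^sub>C res (- \<i>) y)"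
    by (rule sym[OF res_in res_in]) auto
  then show ?thesis by (simp add: cinner_simps)
qed

lemma res_adjoint': "cinner (res (- \<i>) x) y = cinner x (res \<i> y)"
  using arg_cong[OF res_adjoint[of y x], of cnj] by (simp flip: cinner_commute)

text \<open>The resolvent identity with the two factors in either order; comparing them yields
  \<open>res_commute\<close>. The third line gives the value of T on the difference, from which the
  other two are read off.\<close>

lemma res_diff:
  "res \<i> h - res (- \<i>) h = (- 2 * \<i>) *\<^sub>C res \<i> (res (- \<i>) h)"
  "res \<i> h - res (- \<i>) h = (- 2 * \<i>) *\<^sub>C res (- \<i>) (res \<i> h)"
  "(res \<i> h - res (- \<i>) h, (- \<i>) *\<^sub>C (res \<i> h + res (- \<i>) h)) \<in> T"
proof -
  let ?a = "res \<i> h" and ?b = "res (- \<i>) h"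
  have t: "x + x = 2 *\<^sub>C x" for x :: 'h using scaleC_add_left[of 1 1 x] by (simp add: scaleC_one)
  show ab: "(?a - ?b, (- \<i>) *\<^sub>C (?a + ?b)) \<in> T"
    using graph_diff[OF res_in res_in, of \<i> "- \<i>" h h] by (simp add: scaleC_add_right scaleC_minus_left)
  have "(- \<i>) *\<^sub>C (?a + ?b) = (- 2 * \<i>) *\<^sub>C ?b - \<i> *\<^sub>C (?a - ?b)"
    "(- \<i>) *\<^sub>C (?a + ?b) = (- 2 * \<i>) *\<^sub>C ?a - (- \<i>) *\<^sub>C (?a - ?b)"
    using t[of "\<i> *\<^sub>C ?a"] t[of "\<i> *\<^sub>C ?b"]
    by (simp_all add: scaleC_add_right scaleC_diff_right scaleC_minus_left scaleC_scaleC algebra_simps)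
  then have "res \<i> ((- 2 * \<i>) *\<^sub>C ?b) = ?a - ?b" "res (- \<i>) ((- 2 * \<i>) *\<^sub>C ?a) = ?a - ?b"
    using ab by (auto intro!: res_eq)
  then show "?a - ?b = (- 2 * \<i>) *\<^sub>C res \<i> ?b" "?a - ?b = (- 2 * \<i>) *\<^sub>C res (- \<i>) ?a"
    by (simp_all add: res_scaleC)
qed

lemma res_commute: "res \<i> (res (- \<i>) h) = res (- \<i>) (res \<i> h)"
proof -
  have "(- 2 * \<i>) *\<^sub>C res \<i> (res (- \<i>) h) = (- 2 * \<i>) *\<^sub>C res (- \<i>) (res \<i> h)"
    using res_diff(1,2)[of h] by simp
  then have "(\<i> / 2) *\<^sub>C (- 2 * \<i>) *\<^sub>C res \<i> (res (- \<i>) h) = (\<i> / 2) *\<^sub>C (- 2 * \<i>) *\<^sub>C res (- \<i>) (res \<i> h)"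
    by simp
  then show ?thesis by (simp add: scaleC_scaleC scaleC_one)
qed

text \<open>\<open>opD\<close> is \<open>(1 + T\<^sup>2)\<^sup>-\<^sup>1\<close> and \<open>opC\<close> is \<open>T (1 + T\<^sup>2)\<^sup>-\<^sup>1\<close>, so
  \<open>opC - l opD\<close> has the sign of \<open>T - l\<close>.\<close>

definition opD :: "'h \<Rightarrow> 'h" where "opD h = res \<i> (res (- \<i>) h)"

definition opC :: "'h \<Rightarrow> 'h" where "opC h = (1/2) *\<^sub>R (res \<i> h + res (- \<i>) h)"

definition opK :: "real \<Rightarrow> 'h \<Rightarrow> 'h" where "opK l h = opC h - l *\<^sub>R opD h"

text \<open>Commutation with the unbounded T is expressed by its bounded resolvents, so no domains
  have to be compared.\<close>

definition commutant :: "('h \<Rightarrow> 'h) \<Rightarrow> bool" where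
  "commutant B \<longleftrightarrow> bounded_linear B \<and> commutes (res \<i>) B \<and> commutes (res (- \<i>)) B"

lemma opD_opC_in: "(opD h, opC h) \<in> T"
proof -
  have "opD h = (\<i> / 2) *\<^sub>C (res \<i> h - res (- \<i>) h)"
    unfolding res_diff(1) by (simp add: opD_def scaleC_scaleC scaleC_one)
  moreover have "opC h = (\<i> / 2) *\<^sub>C (- \<i>) *\<^sub>C (res \<i> h + res (- \<i>) h)"
    by (simp add: opC_def scaleC_scaleC scaleR_scaleC)
  ultimately show ?thesis using graph_scaleC[OF res_diff(3)] by simp
qed

lemma opD_bounded_sa: "bounded_sa opD"
proof (rule bounded_saI[where M = 1])
  show "cinner (opD x) y = cinner x (opD y)" for x y
    by (simp add: opD_def res_adjoint res_adjoint' flip: res_commute)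
  show "norm (opD x) \<le> 1 * norm x" for x
    unfolding opD_def using order_trans[OF res_norm res_norm, of \<i> "- \<i>"] by simp
qed

lemma opC_bounded_sa: "bounded_sa opC"
proof (rule bounded_saI[where M = 1])
  show "cinner (opC x) y = cinner x (opC y)" for x y
    by (simp add: opC_def cinner_simps res_adjoint res_adjoint')
  show "norm (opC x) \<le> 1 * norm x" for x
    using norm_triangle_mono[OF res_norm[of \<i> x] res_norm[of "- \<i>" x]] by (simp add: opC_def)
qed

lemma opD_positive: "positive_op opD"
  using opD_bounded_sa by (simp add: positive_op_def) (simp add: opD_def res_adjoint flip: norm_sq_cinner)

lemma opD_zero: "opD x = 0 \<Longrightarrow> x = 0"
  unfolding opD_def using res_inj by blast

lemma opK_bounded_sa: "bounded_sa (opK l)"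
  unfolding opK_def[abs_def] using opC_bounded_sa opD_bounded_sa by auto

lemma commutant_opC: "commutant B \<Longrightarrow> commutes opC B"
  by (simp add: commutant_def commutes_def opC_def linear_simps)

lemma commutant_opD: "commutant B \<Longrightarrow> commutes opD B"
  by (simp add: commutant_def commutes_def opD_def)

lemma commutant_opK: "commutant B \<Longrightarrow> commutes (opK l) B"
  using commutant_opC[of B] commutant_opD[of B]
  by (simp add: commutant_def commutes_def opK_def linear_simps)

lemma commutant_res: "commutant (res \<i>)" "commutant (res (- \<i>))"
  by (simp_all add: commutant_def commutes_def res_commute res_bounded_linear)

text \<open>Write \<open>x\<close> as a resolvent of y + ix and move \<open>B\<close> through the
  resolvent.\<close>

lemma commutant_graph:
  assumes B: "commutant B" and Bc: "\<And>c x. B (c *\<^sub>C x) = c *\<^sub>C B x" and xy: "(x, y) \<in> T"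
  shows "(B x, B y) \<in> T"
proof -
  define h where "h = y + \<i> *\<^sub>C x"
  have x: "res \<i> h = x" using xy by (intro res_eq) (simp_all add: h_def)
  have "B x = res \<i> (B h)" using B unfolding x[symmetric] by (simp add: commutant_def commutes_def)
  then have "(B x, B h - \<i> *\<^sub>C B x) \<in> T" using res_in[of \<i> "B h"] by simp
  moreover have "B h - \<i> *\<^sub>C B x = B y" using B by (simp add: h_def commutant_def linear_simps Bc)
  ultimately show ?thesis by simp
qed

section \<open>The projections for the half lines\<close>

definition F :: "real \<Rightarrow> 'h \<Rightarrow> 'h" where
  "F l = (SOME F. projection_op F \<and> (\<forall>x. F x = x \<longrightarrow> Re (cinner (opK l x) x) \<le> 0) \<and>
    (\<forall>x. F x = 0 \<longrightarrow> Re (cinner (opK l x) x) \<ge> 0) \<and>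
    (\<forall>x. F x = 0 \<longrightarrow> Re (cinner (opK l x) x) \<le> 0 \<longrightarrow> x = 0) \<and>
    (\<forall>B. bounded_linear B \<longrightarrow> commutes (opK l) B \<longrightarrow> commutes F B))"

text \<open>\<open>F_zero\<close> is the strict counterpart of \<open>F_nonneg\<close>: the
  eigenvectors of T for \<open>l\<close> belong to the range of \<open>F l\<close>. This fixes
  closed half lines and makes the family continuous from the right.\<close>

lemma
  shows F_projection: "projection_op (F l)"
    and F_nonpos: "\<And>x. F l x = x \<Longrightarrow> Re (cinner (opK l x) x) \<le> 0"
    and F_nonneg: "\<And>x. F l x = 0 \<Longrightarrow> Re (cinner (opK l x) x) \<ge> 0"
    and F_zero: "\<And>x. F l x = 0 \<Longrightarrow> Re (cinner (opK l x) x) \<le> 0 \<Longrightarrow> x = 0"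
    and F_commutes_opK: "\<And>B. bounded_linear B \<Longrightarrow> commutes (opK l) B \<Longrightarrow> commutes (F l) B"
  using someI_ex[OF nonpositive_part_projection[OF opK_bounded_sa[of l]]] unfolding F_def[symmetric] by blast+

lemma F_bounded_sa: "bounded_sa (F l)"
  by (rule projection_op_bounded_sa[OF F_projection])

lemma F_idem: "F l (F l x) = F l x"
  using F_projection[of l] by (simp add: projection_op_def)

lemma F_commutes: "commutant B \<Longrightarrow> commutes (F l) B"
  by (rule F_commutes_opK) (auto simp: commutant_opK commutant_def)

lemma commutant_F: "commutant (F l)"
  using F_commutes[OF commutant_res(1), of l] F_commutes[OF commutant_res(2), of l] F_bounded_sa[of l]
  by (simp add: commutant_def commutes_def bounded_sa_bounded_linear)

text \<open>The part of \<open>F l x\<close> that \<open>F m\<close> misses lies in the range of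
  \<open>F l\<close>. Raising \<open>l\<close> to \<open>m\<close> only lowers the form, because
  \<open>opD\<close> is positive, so this part has nonpositive form for \<open>opK m\<close> and
  vanishes by \<open>F_zero\<close>.\<close>

lemma F_mono: assumes "l \<le> m" shows "F m (F l x) = F l x" "F l (F m x) = F l x"
proof -
  define y where "y = F l x - F m (F l x)"
  have FF: "F l (F m z) = F m (F l z)" for z
    using F_commutes[OF commutant_F] by (simp add: commutes_def)
  have m: "F m y = 0" and l: "F l y = y"
    by (simp_all add: y_def bounded_sa_diff[OF F_bounded_sa] F_idem FF)
  have "Re (cinner (opK m y) y) = Re (cinner (opK l y) y) - (m - l) * Re (cinner (opD y) y)"
    by (simp add: opK_def cinner_simps algebra_simps)
  also have "\<dots> \<le> 0"
  proof -
    have "0 \<le> (m - l) * Re (cinner (opD y) y)"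
      using opD_positive assms by (simp add: positive_op_def)
    then show ?thesis using F_nonpos[OF l] by linarith
  qed
  finally have "y = 0" by (rule F_zero[OF m])
  then show "F m (F l x) = F l x" by (simp add: y_def)
  then show "F l (F m x) = F l x" by (simp add: FF)
qed

lemma F_norm_mono: assumes "l \<le> m" shows "norm (F l x) \<le> norm (F m x)"
  using projection_op_norm(2)[OF F_projection, of l "F m x"] by (simp add: F_mono[OF assms])

lemma F_convergent:
  assumes "incseq X \<or> decseq X" shows "convergent (\<lambda>n. F (X n) x)"
proof -
  have n: "norm (F l x) \<le> 1 * norm x" for l x using projection_op_norm(2)[OF F_projection] by simp
  from assms show ?thesis
  proof
    assume "incseq X"
    then show ?thesis
      by (intro monotone_op_convergent[where L = 1] F_bounded_sa n)
        (auto simp: projection_op_norm(1)[OF F_projection] incseq_def intro!: power_mono F_norm_mono)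
  next
    assume d: "decseq X"
    have "convergent (\<lambda>n. (-1) *\<^sub>R F (X n) x)"
      by (rule monotone_op_convergent[where L = 1])
        (use d n in \<open>auto simp: projection_op_norm(1)[OF F_projection] decseq_def cinner_simps
          intro!: power_mono F_norm_mono bounded_sa_times[OF F_bounded_sa, of "-1", simplified]\<close>)
    then show ?thesis using convergent_minus_iff[of "\<lambda>n. F (X n) x"] by simp
  qed
qed

lemma F_apply_limit:
  assumes "(\<lambda>n. F (X n) x) \<longlonglongrightarrow> y" "\<And>n. n \<ge> N \<Longrightarrow> F k (F (X n) x) = z n" "z \<longlonglongrightarrow> w"
  shows "F k y = w"
proof (rule LIMSEQ_unique)
  show "(\<lambda>n. F k (F (X n) x)) \<longlonglongrightarrow> F k y"
    by (rule bounded_linear.tendsto[OF bounded_sa_bounded_linear[OF F_bounded_sa] assms(1)])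
  have "\<forall>\<^sub>F n in sequentially. z n = F k (F (X n) x)"
    using assms(2) by (metis (mono_tags, lifting) eventually_sequentiallyI)
  then show "(\<lambda>n. F k (F (X n) x)) \<longlonglongrightarrow> w"
    by (rule Lim_transform_eventually[OF assms(3)])
qed

text \<open>The limit lies in the range of every \<open>F (l + 1 / Suc n)\<close>, and so does its
  part outside the range of \<open>F l\<close>. The form of \<open>opK\<close> is continuous in
  \<open>l\<close>, hence nonpositive on that part also at \<open>l\<close>, and
  \<open>F_zero\<close> applies.\<close>

lemma F_right_limit: "(\<lambda>n. F (l + 1 / Suc n) x) \<longlonglongrightarrow> F l x"
proof -
  let ?X = "\<lambda>n. l + 1 / real (Suc n)"
  have dec: "decseq ?X" by (auto simp: decseq_def frac_le simp del: of_nat_Suc)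
  have X: "?X \<longlonglongrightarrow> l"
    using tendsto_add[OF tendsto_const[of l] LIMSEQ_inverse_real_of_nat] by (simp add: inverse_eq_divide)
  have lX: "l \<le> ?X n" for n by simp
  obtain y where y: "(\<lambda>n. F (?X n) x) \<longlonglongrightarrow> y" using F_convergent[of ?X x] dec by (auto simp: convergent_def)
  have fy: "F (?X k) y = y" for k
    by (rule F_apply_limit[OF y _ y, of k]) (rule F_mono(1), use dec in \<open>auto simp: decseq_def simp del: of_nat_Suc\<close>)
  define z where "z = y - F l y"
  have z0: "F l z = 0" by (simp add: z_def bounded_sa_diff[OF F_bounded_sa] F_idem)
  have zX: "F (?X n) z = z" for n
    using fy F_mono(1)[OF lX[of n]] by (simp add: z_def bounded_sa_diff[OF F_bounded_sa])
  have "(\<lambda>n. Re (cinner (opK (?X n) z) z)) \<longlonglongrightarrow> Re (cinner (opK l z) z)"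
    unfolding opK_def by (intro tendsto_intros cinner.tendsto X)
  then have "Re (cinner (opK l z) z) \<le> 0"
    by (rule LIMSEQ_le_const2) (use F_nonpos[OF zX] in auto)
  then have "z = 0" by (rule F_zero[OF z0])
  then have "y = F l y" by (simp add: z_def)
  also have "F l y = F l x"
    by (rule F_apply_limit[OF y _ tendsto_const, of 0]) (rule F_mono(2)[OF lX])
  finally show ?thesis using y by simp
qed

text \<open>A vector annihilated by every \<open>F k\<close> has k (D z, z) \<le> (C z, z) for all
  k, so (D z, z) = 0, and \<open>opD\<close> is injective. At the bottom the same argument runs with
  the opposite sign.\<close>

lemma F_top_limit: "(\<lambda>n. F (real n) x) \<longlonglongrightarrow> x"
proof -
  have inc: "incseq (real :: nat \<Rightarrow> real)" by (auto simp: incseq_def)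
  obtain y where y: "(\<lambda>n. F (real n) x) \<longlonglongrightarrow> y"
    using F_convergent[of real x] inc by (auto simp: convergent_def)
  have fy: "F (real k) y = F (real k) x" for k
    by (rule F_apply_limit[OF y _ tendsto_const, of k]) (rule F_mono(2), simp)
  define z where "z = x - y"
  have z: "F (real k) z = 0" for k by (simp add: z_def bounded_sa_diff[OF F_bounded_sa] fy)
  have "real k * Re (cinner (opD z) z) \<le> Re (cinner (opC z) z)" for k
    using F_nonneg[OF z, of k] by (simp add: opK_def cinner_simps)
  then have "\<not> Re (cinner (opD z) z) > 0"
    using reals_Archimedean3 by (metis linorder_not_less)
  then have "opD z = 0" by (intro positive_op_form_zero[OF opD_positive]) simp
  then have "z = 0" by (rule opD_zero)
  then show ?thesis using y by (simp add: z_def)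
qed

lemma F_bot_limit: "(\<lambda>n. F (- real n) x) \<longlonglongrightarrow> 0"
proof -
  have dec: "decseq (\<lambda>n. - real n)" by (auto simp: decseq_def)
  obtain y where y: "(\<lambda>n. F (- real n) x) \<longlonglongrightarrow> y"
    using F_convergent[of "\<lambda>n. - real n" x] dec by (auto simp: convergent_def)
  have fy: "F (- real k) y = y" for k
    by (rule F_apply_limit[OF y _ y, of k]) (rule F_mono(1), simp)
  have "real k * Re (cinner (opD y) y) \<le> - Re (cinner (opC y) y)" for k
    using F_nonpos[OF fy, of k] by (simp add: opK_def cinner_simps)
  then have "\<not> Re (cinner (opD y) y) > 0"
    using reals_Archimedean3 by (metis linorder_not_less)
  then have "opD y = 0" by (intro positive_op_form_zero[OF opD_positive]) simp
  then have "y = 0" by (rule opD_zero)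
  then show ?thesis using y by simp
qed

end

section \<open>Resolution of the identity\<close>

context selfadjoint_graph
begin

text \<open>The Stieltjes measure of the spectral family at \<open>x\<close>. It is available before
  the projections \<open>E\<close> and governs their construction;
  \<open>spectral_measure_at_E\<close> identifies the two.\<close>

definition spec :: "'h \<Rightarrow> real measure" where
  "spec x = interval_measure (\<lambda>l. (norm (F l x))\<^sup>2)"

lemma sets_spec [simp, measurable_cong]: "sets (spec x) = sets borel"
  by (simp add: spec_def)

lemma space_spec [simp]: "space (spec x) = UNIV"
  by (simp add: spec_def)

lemma F_norm_sq_mono: "l \<le> m \<Longrightarrow> (norm (F l x))\<^sup>2 \<le> (norm (F m x))\<^sup>2"
  by (intro power_mono F_norm_mono) auto

lemma F_norm_sq_right_cont: "continuous (at_right a) (\<lambda>l. (norm (F l x))\<^sup>2)"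
  unfolding continuous_within
proof (rule order_tendstoI)
  fix y assume "y < (norm (F a x))\<^sup>2"
  then show "\<forall>\<^sub>F l in at_right a. y < (norm (F l x))\<^sup>2"
    using eventually_at_right_less[of a]
    by (auto elim!: eventually_mono intro: less_le_trans[OF _ F_norm_sq_mono])
next
  fix y assume y: "(norm (F a x))\<^sup>2 < y"
  have "(\<lambda>n. (norm (F (a + 1 / Suc n) x))\<^sup>2) \<longlonglongrightarrow> (norm (F a x))\<^sup>2"
    by (intro tendsto_intros F_right_limit)
  then have "\<forall>\<^sub>F n in sequentially. (norm (F (a + 1 / Suc n) x))\<^sup>2 < y" by (rule order_tendstoD) (rule y)
  then obtain n where n: "(norm (F (a + 1 / Suc n) x))\<^sup>2 < y" by (auto simp: eventually_sequentially)
  have "\<forall>\<^sub>F l in at_right a. l \<in> {a<..<a + 1 / Suc n}" by (rule eventually_at_right_real) simp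
  then show "\<forall>\<^sub>F l in at_right a. (norm (F l x))\<^sup>2 < y"
    by (rule eventually_mono) (use n in \<open>auto intro!: le_less_trans[OF F_norm_sq_mono n]\<close>)
qed

lemma emeasure_spec_Ioc:
  "a \<le> b \<Longrightarrow> emeasure (spec x) {a<..b} = ennreal ((norm (F b x))\<^sup>2 - (norm (F a x))\<^sup>2)"
  unfolding spec_def by (rule emeasure_interval_measure_Ioc) (use F_norm_sq_mono F_norm_sq_right_cont in auto)

lemma emeasure_spec_Iic: "emeasure (spec x) {..b} = ennreal ((norm (F b x))\<^sup>2)"
proof (rule LIMSEQ_unique)
  have "(\<Union>n. {- real n<..b}) = {..b}"
    by (auto simp: minus_less_iff) (metis reals_Archimedean2)
  then show "(\<lambda>n. emeasure (spec x) {- real n<..b}) \<longlonglongrightarrow> emeasure (spec x) {..b}"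
    using Lim_emeasure_incseq[of "\<lambda>n. {- real n<..b}" "spec x"] by (force simp: incseq_def)
  have "(\<lambda>n. ennreal ((norm (F b x))\<^sup>2 - (norm (F (- real n) x))\<^sup>2)) \<longlonglongrightarrow> ennreal ((norm (F b x))\<^sup>2 - (norm (0 :: 'h))\<^sup>2)"
    by (intro tendsto_intros F_bot_limit)
  moreover have "\<forall>\<^sub>F n in sequentially. ennreal ((norm (F b x))\<^sup>2 - (norm (F (- real n) x))\<^sup>2) =
      emeasure (spec x) {- real n<..b}"
  proof -
    obtain N where N: "- b < real N" using reals_Archimedean2 by blast
    show ?thesis
      by (rule eventually_sequentiallyI[of N]) (use N in \<open>auto intro!: emeasure_spec_Ioc[symmetric]\<close>)
  qed
  ultimately show "(\<lambda>n. emeasure (spec x) {- real n<..b}) \<longlonglongrightarrow> ennreal ((norm (F b x))\<^sup>2)"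
    using Lim_transform_eventually by force
qed

lemma emeasure_spec_UNIV: "emeasure (spec x) UNIV = ennreal ((norm x)\<^sup>2)"
proof (rule LIMSEQ_unique)
  have "(\<Union>n. {..real n}) = UNIV" by (auto intro: real_arch_simple)
  then show "(\<lambda>n. emeasure (spec x) {..real n}) \<longlonglongrightarrow> emeasure (spec x) UNIV"
    using Lim_emeasure_incseq[of "\<lambda>n. {..real n}" "spec x"] by (force simp: incseq_def)
  show "(\<lambda>n. emeasure (spec x) {..real n}) \<longlonglongrightarrow> ennreal ((norm x)\<^sup>2)"
    unfolding emeasure_spec_Iic by (intro tendsto_intros F_top_limit)
qed

lemma finite_measure_spec: "finite_measure (spec x)"
  by (rule finite_measureI) (simp add: emeasure_spec_UNIV)

lemma measure_spec_UNIV: "measure (spec x) UNIV = (norm x)\<^sup>2"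
  by (simp add: measure_def emeasure_spec_UNIV)

lemma measure_spec_Iic: "measure (spec x) {..b} = (norm (F b x))\<^sup>2"
  by (simp add: measure_def emeasure_spec_Iic)

text \<open>The prescribed norms determine \<open>P\<close> by \<open>projection_op_eq\<close>, so
  projections for different sets can be chosen separately and still fit together. The last clause
  carries commutation along.\<close>

definition spec_projection :: "real set \<Rightarrow> ('h \<Rightarrow> 'h) \<Rightarrow> bool" where
  "spec_projection \<Delta> P \<longleftrightarrow> projection_op P \<and> (\<forall>x. measure (spec x) \<Delta> = (norm (P x))\<^sup>2) \<and>
     (\<forall>B. bounded_linear B \<longrightarrow> (\<forall>l. commutes (F l) B) \<longrightarrow> commutes P B)"

lemma spec_projection_compl:
  assumes "spec_projection \<Delta> P" "\<Delta> \<in> sets borel"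
  shows "spec_projection (UNIV - \<Delta>) (\<lambda>x. x - P x)"
proof -
  interpret finite_measure "spec x" for x by (rule finite_measure_spec)
  have "measure (spec x) (UNIV - \<Delta>) = (norm (x - P x))\<^sup>2" for x
    using finite_measure_compl[of \<Delta> x] assms
    by (simp add: spec_projection_def measure_spec_UNIV projection_op_pythagoras)
  then show ?thesis
    using assms by (auto simp: spec_projection_def projection_op_compl commutes_def linear_simps)
qed

text \<open>Additivity of the measure bounds the sums of squares by the total mass, the squared norm
  of \<open>x\<close>. This is the Bessel inequality that \<open>projection_series\<close> asks
  for.\<close>

lemma spec_projection_UN:
  fixes \<Delta> :: "nat \<Rightarrow> real set"
  assumes P: "\<And>i. spec_projection (\<Delta> i) (P i)" and m: "range \<Delta> \<subseteq> sets borel" and d: "disjoint_family \<Delta>"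
  shows "\<exists>Q. spec_projection (\<Union>i. \<Delta> i) Q \<and> (\<forall>x. (\<lambda>i. P i x) sums Q x)"
proof -
  interpret finite_measure "spec x" for x by (rule finite_measure_spec)
  have pr: "projection_op (P i)" and n: "(norm (P i x))\<^sup>2 = measure (spec x) (\<Delta> i)" for i x
    using P by (auto simp: spec_projection_def)
  have m': "\<Delta> i \<in> sets borel" for i using m by auto
  have s: "(\<lambda>i. (norm (P i x))\<^sup>2) sums measure (spec x) (\<Union>i. \<Delta> i)" for x
    unfolding n by (rule finite_measure_UNION) (use m d in auto)
  have le: "(\<Sum>i<n. (norm (P i x))\<^sup>2) \<le> (norm x)\<^sup>2" for n x
  proof -
    have "(\<Sum>i<n. (norm (P i x))\<^sup>2) \<le> measure (spec x) (\<Union>i. \<Delta> i)"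
      using sum_le_suminf[OF sums_summable[OF s]] sums_unique[OF s] by (metis finite_lessThan zero_le_power2)
    also have "\<dots> \<le> measure (spec x) UNIV" by (rule finite_measure_mono) auto
    finally show ?thesis by (simp add: measure_spec_UNIV)
  qed
  obtain Q where Q: "projection_op Q" "\<And>x. (\<lambda>i. P i x) sums Q x" "\<And>x. (\<lambda>i. (norm (P i x))\<^sup>2) sums (norm (Q x))\<^sup>2"
    using projection_series[of P, OF pr le] by blast
  have "commutes Q B" if B: "bounded_linear B" "\<And>l. commutes (F l) B" for B
    unfolding commutes_def
  proof
    fix x
    have "(\<lambda>i. B (P i x)) sums B (Q x)" by (rule bounded_linear.sums[OF B(1) Q(2)])
    moreover have "B (P i x) = P i (B x)" for i using P B by (simp add: spec_projection_def commutes_def)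
    ultimately show "Q (B x) = B (Q x)" using Q(2)[of "B x"] sums_unique2 by simp
  qed
  then have "spec_projection (\<Union>i. \<Delta> i) Q"
    using Q s sums_unique2 unfolding spec_projection_def by blast
  then show ?thesis using Q by blast
qed

text \<open>Half lines form an intersection-stable generator, so only complements and disjoint
  unions have to be treated.\<close>

lemma spec_projection_exists:
  assumes "\<Delta> \<in> sets borel" shows "\<exists>P. spec_projection \<Delta> P"
proof -
  have "Int_stable (range (\<lambda>a. {..a :: real}))" by (auto simp: Int_stable_def)
  moreover have "range (\<lambda>a. {..a :: real}) \<subseteq> Pow UNIV" by simp
  moreover have "\<Delta> \<in> sigma_sets UNIV (range (\<lambda>a. {..a :: real}))"
    using assms unfolding borel_eq_atMost by simp
  ultimately show ?thesis
  proof (induction rule: sigma_sets_induct_disjoint)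
    case (basic A)
    then obtain a where "A = {..a}" by auto
    then have "spec_projection A (F a)"
      by (auto simp: spec_projection_def F_projection measure_spec_Iic)
    then show ?case by blast
  next
    case empty
    have "spec_projection {} (\<lambda>x. 0)"
      by (auto simp: spec_projection_def projection_op_def commutes_def linear_simps intro: bounded_saI[where M = 0])
    then show ?case by blast
  next
    case (compl A)
    then have "A \<in> sets borel" unfolding borel_eq_atMost by simp
    then show ?case using compl spec_projection_compl by blast
  next
    case (union A)
    then have "range A \<subseteq> sets borel" unfolding borel_eq_atMost by simp
    moreover obtain P where "\<And>i. spec_projection (A i) (P i)" using union by metis
    ultimately show ?case using spec_projection_UN[of A P] union by blast
  qed
qed

definition E :: "real set \<Rightarrow> 'h \<Rightarrow> 'h" where
  "E \<Delta> = (SOME P. spec_projection \<Delta> P)"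

lemma E_spec: "\<Delta> \<in> sets borel \<Longrightarrow> spec_projection \<Delta> (E \<Delta>)"
  unfolding E_def by (rule someI_ex[OF spec_projection_exists])

lemma E_eq:
  assumes "\<Delta> \<in> sets borel" "spec_projection \<Delta> P" shows "E \<Delta> = P"
proof (rule projection_op_eq)
  fix x
  have "(norm (E \<Delta> x))\<^sup>2 = (norm (P x))\<^sup>2"
    using assms E_spec[OF assms(1)] by (metis spec_projection_def)
  then show "norm (E \<Delta> x) = norm (P x)" by simp
qed (use assms E_spec[OF assms(1)] in \<open>auto simp: spec_projection_def\<close>)

lemma E_projection: "\<Delta> \<in> sets borel \<Longrightarrow> projection_op (E \<Delta>)"
  using E_spec by (simp add: spec_projection_def)

lemma E_measure: "\<Delta> \<in> sets borel \<Longrightarrow> (norm (E \<Delta> x))\<^sup>2 = measure (spec x) \<Delta>"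
  using E_spec by (simp add: spec_projection_def)

lemma E_commutes:
  "\<Delta> \<in> sets borel \<Longrightarrow> bounded_linear B \<Longrightarrow> (\<And>l. commutes (F l) B) \<Longrightarrow> commutes (E \<Delta>) B"
  using E_spec by (simp add: spec_projection_def)

lemma E_bounded_sa: "\<Delta> \<in> sets borel \<Longrightarrow> bounded_sa (E \<Delta>)"
  by (rule projection_op_bounded_sa[OF E_projection])

lemma E_commutant: assumes "\<Delta> \<in> sets borel" shows "commutant (E \<Delta>)"
  using E_commutes[OF assms, of "res \<i>"] E_commutes[OF assms, of "res (- \<i>)"]
    F_commutes[OF commutant_res(1)] F_commutes[OF commutant_res(2)] res_bounded_linear
    bounded_sa_bounded_linear[OF E_bounded_sa[OF assms]]
  by (simp add: commutant_def commutes_def)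

lemma E_Ioc: assumes "a \<le> b" shows "E {a<..b} = (\<lambda>x. F b x - F a x)"
proof (rule E_eq)
  have p: "projection_op (\<lambda>x. F b x - F a x)"
    using assms by (auto simp: projection_op_def bounded_sa_diff[OF F_bounded_sa] F_idem F_mono F_bounded_sa)
  moreover have "measure (spec x) {a<..b} = (norm (F b x - F a x))\<^sup>2" for x
    using projection_op_norm(1)[OF p, of x] emeasure_spec_Ioc[OF assms, of x] F_norm_sq_mono[OF assms, of x]
    by (simp add: cinner_simps projection_op_norm(1)[OF F_projection] measure_def)
  ultimately show "spec_projection {a<..b} (\<lambda>x. F b x - F a x)"
    by (auto simp: spec_projection_def commutes_def linear_simps)
qed simp

lemma E_sums:
  assumes "range \<Delta> \<subseteq> sets borel" "disjoint_family \<Delta>"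
  shows "(\<lambda>i. E (\<Delta> i) x) sums E (\<Union>i. \<Delta> i) x"
proof -
  have "\<And>i. spec_projection (\<Delta> i) (E (\<Delta> i))" using assms by (auto intro: E_spec)
  from spec_projection_UN[OF this assms] obtain Q where
    Q: "spec_projection (\<Union>i. \<Delta> i) Q" "\<And>x. (\<lambda>i. E (\<Delta> i) x) sums Q x" by blast
  moreover have "(\<Union>i. \<Delta> i) \<in> sets borel" using assms by blast
  ultimately show ?thesis using E_eq by metis
qed

lemma projection_valued_measure_E: "projection_valued_measure E"
  unfolding projection_valued_measure_def
proof (intro conjI ballI allI impI)
  fix \<Delta> :: "real set" assume \<Delta>: "\<Delta> \<in> sets borel"
  show "E \<Delta> (x + y) = E \<Delta> x + E \<Delta> y" for x y by (rule bounded_sa_add[OF E_bounded_sa[OF \<Delta>]])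
  show "E \<Delta> (c *\<^sub>C x) = c *\<^sub>C E \<Delta> x" for c x by (rule bounded_sa_scaleC[OF E_bounded_sa[OF \<Delta>]])
  show "E \<Delta> \<circ> E \<Delta> = E \<Delta>" using E_projection[OF \<Delta>] by (auto simp: projection_op_def)
  show "cinner (E \<Delta> x) y = cinner x (E \<Delta> y)" for x y by (rule bounded_sa_cinner[OF E_bounded_sa[OF \<Delta>]])
next
  show "E UNIV = id"
    by (rule E_eq) (auto simp: spec_projection_def projection_op_def measure_spec_UNIV commutes_def id_def)
qed (rule E_sums)

lemma spectral_measure_at_E: "spectral_measure_at E x = spec x"
proof -
  interpret finite_measure "spec x" by (rule finite_measure_spec)
  have "ennreal ((norm (E \<Delta> x))\<^sup>2) = emeasure (spec x) \<Delta>" if "\<Delta> \<in> sets borel" for \<Delta>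
    using that by (simp add: E_measure emeasure_eq_measure)
  then have "spectral_measure_at E x = measure_of UNIV (sets borel) (emeasure (spec x))"
    unfolding spectral_measure_at_def using sets.sigma_sets_eq[of borel]
    by (intro measure_of_eq) auto
  also have "\<dots> = spec x" using measure_of_of_measure[of "spec x"] by simp
  finally show ?thesis .
qed

end

text \<open>Cut the interval into n equal pieces. An error of the order length times mass on each
  piece adds up to the total mass times the mesh, which tends to zero. Operator quantities are
  compared with spectral integrals in this way.\<close>

lemma additive_interval_function_zero:
  fixes h m :: "real \<Rightarrow> real \<Rightarrow> real"
  assumes h: "\<And>a b c. A \<le> a \<Longrightarrow> a \<le> b \<Longrightarrow> b \<le> c \<Longrightarrow> c \<le> B \<Longrightarrow> h a c = h a b + h b c"
    and m: "\<And>a b c. A \<le> a \<Longrightarrow> a \<le> b \<Longrightarrow> b \<le> c \<Longrightarrow> c \<le> B \<Longrightarrow> m a c = m a b + m b c"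
    and le: "\<And>a b. A \<le> a \<Longrightarrow> a \<le> b \<Longrightarrow> b \<le> B \<Longrightarrow> \<bar>h a b\<bar> \<le> L * (b - a) * m a b"
    and AB: "A \<le> B"
  shows "h A B = 0"
proof -
  have "\<bar>h A B\<bar> \<le> L * (B - A) * m A B / real (Suc n)" for n
  proof -
    define d where "d = (B - A) / real (Suc n)"
    have d0: "d \<ge> 0" using AB by (simp add: d_def)
    have dn: "real (Suc n) * d = B - A" by (simp add: d_def del: of_nat_Suc)
    have "\<bar>h A (A + real k * d)\<bar> \<le> L * d * m A (A + real k * d)" if "k \<le> Suc n" for k
      using that
    proof (induction k)
      case 0
      have "h A A = 0" "m A A = 0" using h[of A A A] m[of A A A] AB by auto
      then show ?case by simp
    next
      case (Suc k)
      let ?a = "A + real k * d" and ?b = "A + real (Suc k) * d"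
      have "real (Suc k) * d \<le> real (Suc n) * d" using Suc.prems d0 by (intro mult_right_mono) auto
      then have o: "A \<le> ?a" "?a \<le> ?b" "?b \<le> B" using d0 dn by (auto simp: algebra_simps)
      have "\<bar>h A ?b\<bar> \<le> \<bar>h A ?a\<bar> + \<bar>h ?a ?b\<bar>" using h[of A ?a ?b] o by simp
      also have "\<dots> \<le> L * d * m A ?a + L * d * m ?a ?b"
        using Suc le[OF o] by (intro add_mono) (auto simp: algebra_simps)
      also have "\<dots> = L * d * m A ?b" using m[of A ?a ?b] o by (simp add: algebra_simps)
      finally show ?case .
    qed
    from this[of "Suc n"] show ?thesis using dn by (simp add: d_def del: of_nat_Suc)
  qed
  moreover have "(\<lambda>n. L * (B - A) * m A B / real (Suc n)) \<longlonglongrightarrow> 0"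
    using tendsto_mult_right_zero[OF LIMSEQ_inverse_real_of_nat, of "L * (B - A) * m A B"]
    by (simp add: divide_inverse)
  ultimately have "\<bar>h A B\<bar> \<le> 0" by (intro LIMSEQ_le_const) auto
  then show ?thesis by simp
qed

section \<open>The operator on bounded spectral intervals\<close>

context selfadjoint_graph
begin

text \<open>An injective selfadjoint operator has dense range; the range consists of vectors on
  which T is known.\<close>

lemma opD_dense: "closure (range opD) = UNIV"
proof (rule dense_if_orthogonal_trivial)
  show "0 \<in> range opD" using opD_bounded_sa by (metis bounded_sa_zero rangeI)
  show "x + y \<in> range opD" if "x \<in> range opD" "y \<in> range opD" for x y
    using that by (auto simp: bounded_sa_add[OF opD_bounded_sa, symmetric])
  show "c *\<^sub>C x \<in> range opD" if "x \<in> range opD" for c x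
    using that by (auto simp: bounded_sa_scaleC[OF opD_bounded_sa, symmetric])
  fix u assume "\<And>v. v \<in> range opD \<Longrightarrow> cinner v u = 0"
  then have "cinner (opD u) u = 0" by simp
  then have "opD u = 0" by (intro positive_op_form_zero[OF opD_positive]) simp
  then show "u = 0" by (rule opD_zero)
qed

lemma E_Ioc_F:
  assumes ab: "a \<le> b" shows "F a (E {a<..b} x) = 0" "F b (E {a<..b} x) = E {a<..b} x"
  by (simp_all add: E_Ioc[OF ab] bounded_sa_diff[OF F_bounded_sa] F_idem F_mono[OF ab])

text \<open>On the range of the projection, T - a and b - T are positive and commute, so their
  product is positive. Completing the square, T differs from the midpoint by at most half the
  length. Only vectors in the range of \<open>opD\<close> are accessible so far.\<close>

lemma E_Ioc_opD_bound:
  assumes ab: "a \<le> b"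
  shows "norm (opC (E {a<..b} z) - ((a + b) / 2) *\<^sub>R opD (E {a<..b} z)) \<le> (b - a) / 2 * norm (opD (E {a<..b} z))"
proof -
  let ?P = "E {a<..b}"
  have P: "projection_op ?P" and Psa: "bounded_sa ?P" and Pc: "commutant ?P"
    by (auto intro: E_projection E_bounded_sa E_commutant)
  have PP: "?P (?P x) = ?P x" for x using P by (simp add: projection_op_def)
  have PK: "opK l (?P x) = ?P (opK l x)" for l x using commutant_opK[OF Pc] by (simp add: commutes_def)
  have KK: "opK l (opK l' x) = opK l' (opK l x)" for l l' x
  proof -
    have "commutes opC opD" unfolding commutes_def opC_def opD_def
      by (simp add: res_commute linear_simps res_bounded_linear)
    then show ?thesis
      by (simp add: opK_def bounded_sa_simps[OF opC_bounded_sa] bounded_sa_simps[OF opD_bounded_sa] commutes_def algebra_simps)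
  qed
  define U V where "U x = opK a (?P x)" and "V x = - opK b (?P x)" for x
  have KP: "bounded_sa (\<lambda>x. opK l (?P x))" for l
    by (rule bounded_sa_comp[OF opK_bounded_sa Psa commutant_opK[OF Pc]])
  have q: "cinner (opK l (?P x)) x = cinner (opK l (?P x)) (?P x)" for l x
    by (metis PK PP bounded_sa_cinner[OF Psa])
  have "positive_op U"
    unfolding positive_op_def U_def[abs_def] using KP F_nonneg[OF E_Ioc_F(1)[OF ab]] by (simp add: q)
  moreover have "positive_op V"
    unfolding positive_op_def V_def[abs_def]
    using bounded_sa_times[OF KP, of "-1" b] F_nonpos[OF E_Ioc_F(2)[OF ab]] by (simp add: cinner_simps q)
  moreover have "commutes U V"
    by (simp add: commutes_def U_def V_def PK PP KK linear_simps bounded_sa_bounded_linear[OF Psa]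
        bounded_sa_bounded_linear[OF opK_bounded_sa])
  ultimately have "0 \<le> Re (cinner (U (V z)) z)" by (rule positive_op_comp)
  also have "cinner (U (V z)) z = - cinner (opK b (?P z)) (opK a (?P z))"
    by (simp add: U_def V_def linear_simps bounded_sa_bounded_linear[OF Psa] bounded_sa_bounded_linear[OF opK_bounded_sa]
        cinner_simps PK PP bounded_sa_cinner[OF Psa] bounded_sa_cinner[OF opK_bounded_sa])
  finally have *: "Re (cinner (opK b (?P z)) (opK a (?P z))) \<le> 0" by simp
  define u y where "u = opC (?P z)" and "y = opD (?P z)"
  have r: "Re (cinner y u) = Re (cinner u y)" by (metis cinner_commute cnj.sel(1))
  \<comment> \<open>Completing the square: the scalar product of u - by and u - ay is a quadratic
    form centred at the midpoint.\<close>
  have "(norm (u - ((a + b) / 2) *\<^sub>R y))\<^sup>2 =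
      Re (cinner (u - b *\<^sub>R y) (u - a *\<^sub>R y)) + ((b - a) / 2 * norm y)\<^sup>2"
    by (simp add: norm_sq_diff cinner_simps r norm_sq_cinner[symmetric] power_mult_distrib)
      (simp add: field_simps power2_eq_square)
  also have "\<dots> \<le> ((b - a) / 2 * norm y)\<^sup>2" using * by (simp add: opK_def u_def y_def)
  finally show ?thesis unfolding u_def y_def by (rule power2_le_imp_le) (use ab in simp)
qed

text \<open>Approximate \<open>x\<close> by vectors \<open>opD (h n)\<close>. The preceding bound
  makes the images under T converge, and closedness of T extends domain and bound to the whole range
  of the projection.\<close>

lemma E_Ioc_graph:
  assumes ab: "a \<le> b"
  shows "\<exists>u. (E {a<..b} x, u) \<in> T \<and>
    norm (u - ((a + b) / 2) *\<^sub>R E {a<..b} x) \<le> (b - a) / 2 * norm (E {a<..b} x)"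
proof -
  let ?P = "E {a<..b}" and ?c = "(a + b) / 2" and ?r = "(b - a) / 2"
  have Pl: "bounded_linear ?P" by (rule bounded_sa_bounded_linear[OF E_bounded_sa]) simp
  have Pc: "commutant ?P" by (rule E_commutant) simp
  obtain h where h: "(\<lambda>n. opD (h n)) \<longlonglongrightarrow> x"
  proof -
    have "x \<in> closure (range opD)" by (simp add: opD_dense)
    then obtain s where s: "\<forall>n. s n \<in> range opD" "s \<longlonglongrightarrow> x" unfolding closure_sequential by blast
    from s(1) have "\<forall>n. \<exists>h. s n = opD h" by blast
    then obtain h where "\<And>n. s n = opD (h n)" by metis
    then have "s = (\<lambda>n. opD (h n))" by auto
    then show ?thesis using s(2) by (intro that[of h]) simp
  qed
  define y u where "y n = opD (?P (h n))" and "u n = opC (?P (h n))" for n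
  have y: "y \<longlonglongrightarrow> ?P x"
    using bounded_linear.tendsto[OF Pl h] commutant_opD[OF Pc] by (simp add: y_def[abs_def] commutes_def)
  have T: "(y n, u n) \<in> T" for n unfolding y_def u_def by (rule opD_opC_in)
  have "Cauchy (\<lambda>n. u n - ?c *\<^sub>R y n)"
  proof (rule metric_CauchyI)
    fix e :: real assume e: "e > 0"
    have "Cauchy y" using y convergent_Cauchy convergentI by blast
    \<comment> \<open>The half length may be zero when a = b; adding 1 allows the division.\<close>
    moreover have rp: "?r + 1 > 0" using ab by (intro add_nonneg_pos divide_nonneg_pos) auto
    moreover have "e / (?r + 1) > 0" by (rule divide_pos_pos[OF e rp])
    ultimately obtain N where N: "\<And>m n. m \<ge> N \<Longrightarrow> n \<ge> N \<Longrightarrow> norm (y m - y n) < e / (?r + 1)"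
      using CauchyD[of y "e / (?r + 1)"] by blast
    have "dist (u m - ?c *\<^sub>R y m) (u n - ?c *\<^sub>R y n) < e" if "m \<ge> N" "n \<ge> N" for m n
    proof -
      have "dist (u m - ?c *\<^sub>R y m) (u n - ?c *\<^sub>R y n) =
          norm (opC (?P (h m - h n)) - ?c *\<^sub>R opD (?P (h m - h n)))"
        by (simp add: dist_norm u_def y_def linear_simps Pl bounded_sa_bounded_linear opC_bounded_sa opD_bounded_sa
            scaleR_diff_right algebra_simps)
      also have "\<dots> \<le> ?r * norm (opD (?P (h m - h n)))" by (rule E_Ioc_opD_bound[OF ab])
      also have "opD (?P (h m - h n)) = y m - y n"
        by (simp add: y_def linear_simps Pl bounded_sa_bounded_linear opD_bounded_sa)
      also have "?r * norm (y m - y n) \<le> (?r + 1) * norm (y m - y n)" by (intro mult_right_mono) auto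
      also have "\<dots> < (?r + 1) * (e / (?r + 1))" by (rule mult_strict_left_mono[OF N[OF that] rp])
      also have "\<dots> = e" using rp by (simp only: times_divide_eq_right nonzero_mult_div_cancel_left)
      finally show ?thesis .
    qed
    then show "\<exists>N. \<forall>m\<ge>N. \<forall>n\<ge>N. dist (u m - ?c *\<^sub>R y m) (u n - ?c *\<^sub>R y n) < e" by blast
  qed
  then obtain v where v: "(\<lambda>n. u n - ?c *\<^sub>R y n) \<longlonglongrightarrow> v"
    using Cauchy_convergent convergent_def by blast
  have "(\<lambda>n. (u n - ?c *\<^sub>R y n) + ?c *\<^sub>R y n) \<longlonglongrightarrow> v + ?c *\<^sub>R ?P x"
    by (intro tendsto_intros v y)
  then have "(\<lambda>n. (y n, u n)) \<longlonglongrightarrow> (?P x, v + ?c *\<^sub>R ?P x)" using y by (intro tendsto_Pair) auto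
  then have "(?P x, v + ?c *\<^sub>R ?P x) \<in> T"
    by (rule closed_sequentially[OF closed, rotated]) (rule T)
  moreover have "norm v \<le> ?r * norm (?P x)"
    by (rule LIMSEQ_le[OF tendsto_norm[OF v] tendsto_mult_left[OF tendsto_norm[OF y]]])
      (use E_Ioc_opD_bound[OF ab] in \<open>auto simp: u_def y_def\<close>)
  ultimately show ?thesis by (intro exI[of _ "v + ?c *\<^sub>R ?P x"]) simp
qed

text \<open>T restricted to a bounded spectral interval; it is applied to every \<open>x\<close>,
  since the projected vector lies in the domain.\<close>

definition T_E :: "real \<Rightarrow> real \<Rightarrow> 'h \<Rightarrow> 'h" where
  "T_E a b x = (SOME u. (E {a<..b} x, u) \<in> T)"

lemma T_E_in: "a \<le> b \<Longrightarrow> (E {a<..b} x, T_E a b x) \<in> T"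
  unfolding T_E_def using E_Ioc_graph[of a b x] by (metis someI_ex)

lemma T_E_eq: "(E {a<..b} x, u) \<in> T \<Longrightarrow> a \<le> b \<Longrightarrow> T_E a b x = u"
  using graph_unique T_E_in by blast

lemma T_E_bound:
  "a \<le> b \<Longrightarrow> norm (T_E a b x - ((a + b) / 2) *\<^sub>R E {a<..b} x) \<le> (b - a) / 2 * norm (E {a<..b} x)"
  using E_Ioc_graph[of a b x] T_E_eq by metis

lemma E_graph: "\<Delta> \<in> sets borel \<Longrightarrow> (x, y) \<in> T \<Longrightarrow> (E \<Delta> x, E \<Delta> y) \<in> T"
  by (rule commutant_graph[OF E_commutant]) (auto simp: bounded_sa_scaleC[OF E_bounded_sa])

lemma E_T_E: assumes "a \<le> b" shows "E {a<..b} (T_E a b x) = T_E a b x"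
proof -
  have "(E {a<..b} (E {a<..b} x), E {a<..b} (T_E a b x)) \<in> T"
    by (intro E_graph T_E_in assms) simp
  moreover have "E {a<..b} (E {a<..b} x) = E {a<..b} x"
    using E_projection[of "{a<..b}"] by (simp add: projection_op_def)
  ultimately have "(E {a<..b} x, E {a<..b} (T_E a b x)) \<in> T" by simp
  from T_E_eq[OF this assms] show ?thesis by simp
qed

lemma E_Ioc_disjoint:
  assumes "a \<le> b" "b \<le> c" shows "E {a<..b} (E {b<..c} x) = 0"
proof -
  have "F a (E {b<..c} x) = F a (F b (E {b<..c} x))" using F_mono(2)[OF assms(1)] by simp
  then show ?thesis using E_Ioc_F(1)[OF assms(2)] F_bounded_sa by (simp add: E_Ioc[OF assms(1)])
qed

lemma E_Ioc_add:
  "a \<le> b \<Longrightarrow> b \<le> c \<Longrightarrow> E {a<..c} x = E {a<..b} x + E {b<..c} x"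
  by (simp add: E_Ioc)

lemma T_E_add:
  assumes ab: "a \<le> b" and bc: "b \<le> c" shows "T_E a c x = T_E a b x + T_E b c x"
proof (rule T_E_eq)
  show "(E {a<..c} x, T_E a b x + T_E b c x) \<in> T"
    unfolding E_Ioc_add[OF assms] by (intro graph_add T_E_in ab bc)
qed (use assms in simp)

text \<open>Both pieces stay in the ranges of their projections, which are orthogonal for disjoint
  intervals.\<close>

lemma T_E_norm_add:
  assumes "a \<le> b" "b \<le> c" shows "(norm (T_E a c x))\<^sup>2 = (norm (T_E a b x))\<^sup>2 + (norm (T_E b c x))\<^sup>2"
proof -
  have "cinner (T_E a b x) (T_E b c x) = cinner (E {a<..b} (T_E a b x)) (E {b<..c} (T_E b c x))"
    by (simp add: E_T_E assms)
  also have "\<dots> = cinner (T_E a b x) (E {a<..b} (E {b<..c} (T_E b c x)))"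
    by (rule bounded_sa_cinner[OF E_bounded_sa]) simp
  also have "\<dots> = 0" by (simp add: E_Ioc_disjoint assms)
  finally show ?thesis by (simp add: T_E_add[OF assms] norm_sq_add)
qed

section \<open>Form and norm of the truncated operator as spectral integrals\<close>

lemma set_integrable_spec_Ioc:
  fixes f :: "real \<Rightarrow> real"
  assumes "continuous_on UNIV f" shows "set_integrable (spec x) {a<..b} f"
proof -
  interpret finite_measure "spec x" by (rule finite_measure_spec)
  have "compact (f ` {a..b})" using assms continuous_on_subset by (intro compact_continuous_image) auto
  then obtain K where K: "\<And>t. t \<in> {a..b} \<Longrightarrow> norm (f t) \<le> K"
    using compact_imp_bounded bounded_iff by (metis imageI)
  have f: "f \<in> borel_measurable borel" using assms by (rule borel_measurable_continuous_onI)
  show ?thesis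
    unfolding set_integrable_def
  proof (rule integrable_const_bound[where B = "\<bar>K\<bar>"])
    show "AE t in spec x. norm (indicat_real {a<..b} t *\<^sub>R f t) \<le> \<bar>K\<bar>"
      by (intro AE_I2) (auto simp: indicator_def intro: order_trans[OF K[unfolded real_norm_def] abs_ge_self])
  qed (use f in measurable)
qed

lemma set_integral_spec_Ioc_bound:
  fixes f :: "real \<Rightarrow> real"
  assumes f: "continuous_on UNIV f" and d: "\<And>t. t \<in> {a<..b} \<Longrightarrow> \<bar>f t - k\<bar> \<le> d"
  shows "\<bar>(LINT t:{a<..b}|spec x. f t) - k * (norm (E {a<..b} x))\<^sup>2\<bar> \<le> d * (norm (E {a<..b} x))\<^sup>2"
proof -
  interpret finite_measure "spec x" by (rule finite_measure_spec)
  let ?I = "{a<..b}"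
  have c: "set_integrable (spec x) ?I (\<lambda>_. r :: real)" for r by (rule set_integrable_spec_Ioc) auto
  have i: "(LINT t:?I|spec x. r) = r * (norm (E ?I x))\<^sup>2" for r :: real
    by (simp add: E_measure set_lebesgue_integral_def measure_def mult.commute)
  have fk: "set_integrable (spec x) ?I (\<lambda>t. f t - k)"
    by (rule set_integral_diff(1)[OF set_integrable_spec_Ioc[OF f] c])
  have "(LINT t:?I|spec x. f t) - k * (norm (E ?I x))\<^sup>2 = (LINT t:?I|spec x. f t - k)"
    unfolding i[symmetric] by (rule set_integral_diff(2)[symmetric]) (rule set_integrable_spec_Ioc[OF f], rule c)
  also have "\<bar>\<dots>\<bar> \<le> (LINT t:?I|spec x. \<bar>f t - k\<bar>)"
    using set_integral_norm_bound[OF fk] by simp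
  also have "\<dots> \<le> (LINT t:?I|spec x. d)"
    by (rule set_integral_mono) (use d f in \<open>auto intro!: set_integrable_spec_Ioc c continuous_intros\<close>)
  finally show ?thesis by (simp add: i)
qed

lemma set_integral_spec_Ioc_add:
  fixes f :: "real \<Rightarrow> real"
  assumes f: "continuous_on UNIV f" and "a \<le> b" "b \<le> c"
  shows "(LINT t:{a<..c}|spec x. f t) = (LINT t:{a<..b}|spec x. f t) + (LINT t:{b<..c}|spec x. f t)"
proof -
  have "{a<..c} = {a<..b} \<union> {b<..c}" using assms by auto
  then show ?thesis
    using set_integral_Un[of "{a<..b}" "{b<..c}" "spec x" f] set_integrable_spec_Ioc[OF f] by auto
qed

text \<open>On a subinterval both sides differ from midpoint times mass by at most half the length
  times mass. Their difference is additive over intervals, so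
  \<open>additive_interval_function_zero\<close> applies.\<close>

lemma T_E_form:
  assumes AB: "A \<le> B" shows "Re (cinner (T_E A B x) x) = (LINT t:{A<..B}|spec x. t)"
proof -
  let ?h = "\<lambda>a b. Re (cinner (T_E a b x) x) - (LINT t:{a<..b}|spec x. t)"
  have "?h A B = 0"
  proof (rule additive_interval_function_zero[where L = 1 and m = "\<lambda>a b. measure (spec x) {a<..b}", OF _ _ _ AB])
    fix a b c assume o: "A \<le> a" "a \<le> b" "b \<le> c" "c \<le> B"
    show "?h a c = ?h a b + ?h b c"
      using o set_integral_spec_Ioc_add[of "\<lambda>t. t" a b c x] by (simp add: T_E_add[OF o(2,3)] cinner_simps)
    interpret finite_measure "spec x" by (rule finite_measure_spec)
    have "{a<..c} = {a<..b} \<union> {b<..c}" using o by auto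
    then show "measure (spec x) {a<..c} = measure (spec x) {a<..b} + measure (spec x) {b<..c}"
      using finite_measure_Union[of "{a<..b}" "{b<..c}"] by auto
  next
    fix a b assume o: "A \<le> a" "a \<le> b" "b \<le> B"
    let ?P = "E {a<..b}" and ?c = "(a + b) / 2" and ?r = "(b - a) / 2"
    have "cinner (T_E a b x) x = cinner (T_E a b x) (?P x)"
      using bounded_sa_cinner[OF E_bounded_sa, of "{a<..b}" "T_E a b x" x] by (simp add: E_T_E[OF o(2)])
    then have "Re (cinner (T_E a b x) x) - ?c * (norm (?P x))\<^sup>2 = Re (cinner (T_E a b x - ?c *\<^sub>R ?P x) (?P x))"
      by (simp add: cinner_simps norm_sq_cinner)
    also have "\<bar>\<dots>\<bar> \<le> norm (T_E a b x - ?c *\<^sub>R ?P x) * norm (?P x)"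
      by (rule order_trans[OF abs_Re_le_cmod Cauchy_Schwarz_cinner])
    also have "\<dots> \<le> (?r * norm (?P x)) * norm (?P x)"
      by (intro mult_right_mono T_E_bound o) simp
    finally have 1: "\<bar>Re (cinner (T_E a b x) x) - ?c * (norm (?P x))\<^sup>2\<bar> \<le> ?r * (norm (?P x))\<^sup>2"
      by (simp add: power2_eq_square mult.assoc)
    have 2: "\<bar>(LINT t:{a<..b}|spec x. t) - ?c * (norm (?P x))\<^sup>2\<bar> \<le> ?r * (norm (?P x))\<^sup>2"
      by (rule set_integral_spec_Ioc_bound) (auto simp: abs_le_iff field_simps)
    have "?r * (norm (?P x))\<^sup>2 + ?r * (norm (?P x))\<^sup>2 = 1 * (b - a) * measure (spec x) {a<..b}"
      using E_measure[of "{a<..b}" x] by (simp add: field_simps)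
    then show "\<bar>?h a b\<bar> \<le> 1 * (b - a) * measure (spec x) {a<..b}" using 1 2 by linarith
  qed
  then show ?thesis by simp
qed

lemma T_E_norm:
  assumes AB: "A \<le> B" shows "(norm (T_E A B x))\<^sup>2 = (LINT t:{A<..B}|spec x. t\<^sup>2)"
proof -
  let ?h = "\<lambda>a b. (norm (T_E a b x))\<^sup>2 - (LINT t:{a<..b}|spec x. t\<^sup>2)"
  define K where "K = \<bar>A\<bar> + \<bar>B\<bar>"
  have cont: "continuous_on UNIV (\<lambda>t :: real. t\<^sup>2)" by (intro continuous_intros)
  have "?h A B = 0"
  proof (rule additive_interval_function_zero[where L = "3 * K" and m = "\<lambda>a b. measure (spec x) {a<..b}", OF _ _ _ AB])
    fix a b c assume o: "A \<le> a" "a \<le> b" "b \<le> c" "c \<le> B"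
    show "?h a c = ?h a b + ?h b c"
      using o set_integral_spec_Ioc_add[OF cont, of a b c x] by (simp add: T_E_norm_add[OF o(2,3)])
    interpret finite_measure "spec x" by (rule finite_measure_spec)
    have "{a<..c} = {a<..b} \<union> {b<..c}" using o by auto
    then show "measure (spec x) {a<..c} = measure (spec x) {a<..b} + measure (spec x) {b<..c}"
      using finite_measure_Union[of "{a<..b}" "{b<..c}"] by auto
  next
    fix a b assume o: "A \<le> a" "a \<le> b" "b \<le> B"
    let ?P = "E {a<..b}" and ?c = "(a + b) / 2" and ?r = "(b - a) / 2"
    define p t where "p = norm (?P x)" and "t = norm (T_E a b x)"
    have cK: "\<bar>?c\<bar> \<le> K" and rK: "?r \<le> K" and r0: "0 \<le> ?r" using o by (auto simp: K_def abs_le_iff field_simps)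
    \<comment> \<open>Factor the difference of squares; the second factor is at most (2K + K) q. It
      is used for the norms of the vectors and, with q = 1, for the integrand. The two errors of
      size r (3K) times the mass add up to the constant L = 3K.\<close>
    have key: "\<bar>s\<^sup>2 - ?c\<^sup>2 * q\<^sup>2\<bar> \<le> ?r * (3 * K) * q\<^sup>2" if s: "\<bar>s - \<bar>?c\<bar> * q\<bar> \<le> ?r * q" "s \<ge> 0" "q \<ge> 0" for s q
    proof -
      have s2: "s + \<bar>?c\<bar> * q \<le> 3 * K * q"
      proof -
        have "s \<le> ?r * q + \<bar>?c\<bar> * q" using s by linarith
        moreover have "?r * q \<le> K * q" "\<bar>?c\<bar> * q \<le> K * q"
          by (rule mult_right_mono[OF rK s(3)], rule mult_right_mono[OF cK s(3)])
        ultimately show ?thesis by linarith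
      qed
      have "\<bar>s\<^sup>2 - ?c\<^sup>2 * q\<^sup>2\<bar> = \<bar>s - \<bar>?c\<bar> * q\<bar> * \<bar>s + \<bar>?c\<bar> * q\<bar>"
        unfolding abs_mult[symmetric] by (simp add: algebra_simps power2_eq_square abs_mult_self_eq)
      also have "\<bar>s + \<bar>?c\<bar> * q\<bar> = s + \<bar>?c\<bar> * q" using s by (intro abs_of_nonneg add_nonneg_nonneg) auto
      also have "\<bar>s - \<bar>?c\<bar> * q\<bar> * (s + \<bar>?c\<bar> * q) \<le> (?r * q) * (3 * K * q)"
        using s r0 by (intro mult_mono s2) auto
      finally show ?thesis by (simp add: power2_eq_square mult_ac)
    qed
    have "\<bar>t - \<bar>?c\<bar> * p\<bar> \<le> norm (T_E a b x - ?c *\<^sub>R ?P x)"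
      using norm_triangle_ineq3[of "T_E a b x" "?c *\<^sub>R ?P x"] by (simp add: t_def p_def)
    also have "\<dots> \<le> ?r * p" unfolding p_def by (rule T_E_bound[OF o(2)])
    finally have 1: "\<bar>t\<^sup>2 - ?c\<^sup>2 * p\<^sup>2\<bar> \<le> ?r * (3 * K) * p\<^sup>2" by (rule key) (auto simp: t_def p_def)
    have 2: "\<bar>(LINT t:{a<..b}|spec x. t\<^sup>2) - ?c\<^sup>2 * p\<^sup>2\<bar> \<le> ?r * (3 * K) * p\<^sup>2"
      unfolding p_def
    proof (rule set_integral_spec_Ioc_bound[OF cont])
      fix w assume w: "w \<in> {a<..b}"
      have "\<bar>w - ?c\<bar> \<le> ?r" using w by (auto simp: abs_le_iff field_simps)
      then have "\<bar>\<bar>w\<bar> - \<bar>?c\<bar> * 1\<bar> \<le> ?r * 1"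
        using order_trans[OF abs_triangle_ineq3[of w ?c]] by (simp only: mult_1_right)
      from key[OF this] show "\<bar>w\<^sup>2 - ?c\<^sup>2\<bar> \<le> ?r * (3 * K)" by simp
    qed
    have "?r * (3 * K) * p\<^sup>2 + ?r * (3 * K) * p\<^sup>2 = 3 * K * (b - a) * measure (spec x) {a<..b}"
      using E_measure[of "{a<..b}" x] by (simp add: field_simps p_def)
    then show "\<bar>?h a b\<bar> \<le> 3 * K * (b - a) * measure (spec x) {a<..b}" using 1 2 unfolding t_def by linarith
  qed
  then show ?thesis by simp
qed

section \<open>Removing the truncation\<close>

lemma spec_Ioc_integrable_square: "integrable (spec x) (\<lambda>t. indicat_real {a<..b} t *\<^sub>R t\<^sup>2)"
  using set_integrable_spec_Ioc[of "\<lambda>t. t\<^sup>2" x a b] unfolding set_integrable_def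
  by (simp add: continuous_on_power)

lemma E_Ioc_limit: "(\<lambda>n. E {- real n<..real n} x) \<longlonglongrightarrow> x"
proof -
  have "(\<lambda>n. F (real n) x - F (- real n) x) \<longlonglongrightarrow> x - 0"
    by (intro tendsto_diff F_top_limit F_bot_limit)
  then show ?thesis by (simp add: E_Ioc)
qed

lemma indicator_Ioc_eventually:
  "(\<lambda>n. indicat_real {- real n<..real n} t *\<^sub>R f t) \<longlonglongrightarrow> (f t :: real)"
proof (rule tendsto_eventually)
  obtain N where N: "\<bar>t\<bar> < real N" using reals_Archimedean2 by blast
  show "\<forall>\<^sub>F n in sequentially. indicat_real {- real n<..real n} t *\<^sub>R f t = f t"
    by (rule eventually_sequentiallyI[of N]) (use N in \<open>auto simp: indicator_def\<close>)
qed

text \<open>The truncated T maps \<open>x\<close> to the projection of \<open>y\<close>, as the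
  projections commute with T. So the truncated second moments are squared norms that converge to
  that of \<open>y\<close>, and monotone convergence applies.\<close>

lemma graph_spec_integrable:
  assumes xy: "(x, y) \<in> T" shows "integrable (spec x) (\<lambda>t. t\<^sup>2)"
proof (rule integrable_monotone_convergence)
  have TE: "T_E (- real n) (real n) x = E {- real n<..real n} y" for n
    by (intro T_E_eq E_graph xy) auto
  show "integrable (spec x) (\<lambda>t. indicat_real {- real n<..real n} t *\<^sub>R t\<^sup>2)" for n
    by (rule spec_Ioc_integrable_square)
  show "AE t in spec x. mono (\<lambda>n. indicat_real {- real n<..real n} t *\<^sub>R t\<^sup>2)"
    by (auto simp: mono_def indicator_def)
  show "AE t in spec x. (\<lambda>n. indicat_real {- real n<..real n} t *\<^sub>R t\<^sup>2) \<longlonglongrightarrow> t\<^sup>2"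
    using indicator_Ioc_eventually[of _ "\<lambda>t. t\<^sup>2"] by simp
  have "(\<lambda>n. (norm (E {- real n<..real n} y))\<^sup>2) \<longlonglongrightarrow> (norm y)\<^sup>2"
    by (intro tendsto_intros E_Ioc_limit)
  then show "(\<lambda>n. LINT t|spec x. indicat_real {- real n<..real n} t *\<^sub>R t\<^sup>2) \<longlonglongrightarrow> (norm y)\<^sup>2"
    using T_E_norm[of "- real n" "real n" x for n] by (simp add: TE set_lebesgue_integral_def)
qed simp

lemma graph_spec_form:
  assumes xy: "(x, y) \<in> T" shows "cinner y x = complex_of_real (\<integral>t. t \<partial>spec x)"
proof -
  interpret finite_measure "spec x" by (rule finite_measure_spec)
  have TE: "T_E (- real n) (real n) x = E {- real n<..real n} y" for n
    by (intro T_E_eq E_graph xy) auto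
  have "(\<lambda>n. Re (cinner (E {- real n<..real n} y) x)) \<longlonglongrightarrow> Re (cinner y x)"
    by (intro tendsto_intros cinner.tendsto E_Ioc_limit)
  then have 1: "(\<lambda>n. LINT t|spec x. indicat_real {- real n<..real n} t *\<^sub>R t) \<longlonglongrightarrow> Re (cinner y x)"
    using T_E_form[of "- real n" "real n" x for n] by (simp add: TE set_lebesgue_integral_def)
  have 2: "(\<lambda>n. LINT t|spec x. indicat_real {- real n<..real n} t *\<^sub>R t) \<longlonglongrightarrow> (\<integral>t. t \<partial>spec x)"
  proof (rule integral_dominated_convergence[where w = "\<lambda>t. 1 + t\<^sup>2"])
    show "integrable (spec x) (\<lambda>t. 1 + t\<^sup>2)" using graph_spec_integrable[OF xy] by auto
    show "AE t in spec x. (\<lambda>n. indicat_real {- real n<..real n} t *\<^sub>R t) \<longlonglongrightarrow> t"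
      using indicator_Ioc_eventually[of _ "\<lambda>t. t"] by simp
    have b: "\<bar>t\<bar> \<le> 1 + t\<^sup>2" for t :: real
      using zero_le_power2[of "\<bar>t\<bar> - 1/2"] by (simp add: power2_eq_square algebra_simps abs_mult_self_eq)
    show "AE t in spec x. norm (indicat_real {- real n<..real n} t *\<^sub>R t) \<le> 1 + t\<^sup>2" for n
      using b by (auto simp: indicator_def)
  qed auto
  have "Im (cinner y x) = 0" using graph_form_real[OF xy] by (metis cinner_commute cnj.sel(2) neg_equal_0_iff_equal)
  then show ?thesis using LIMSEQ_unique[OF 1 2] by (simp add: complex_eq_iff)
qed

text \<open>The truncated images are projections of one another, so their squared distances are
  differences of truncated second moments. They converge, and closedness of T puts the limit into
  the graph.\<close>

lemma spec_integrable_graph: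
  assumes int: "integrable (spec x) (\<lambda>t. t\<^sup>2)" shows "x \<in> Domain T"
proof -
  let ?P = "\<lambda>n. E {- real n<..real n}" and ?t = "\<lambda>n. T_E (- real n) (real n) x"
  let ?a = "\<lambda>n. (norm (?t n))\<^sup>2"
  have Pt: "?P m (?t n) = ?t m" if "m \<le> n" for m n
  proof -
    have "?P m (?P n x) = ?P m x"
      using that by (simp add: E_Ioc bounded_sa_diff[OF F_bounded_sa] F_mono)
    then show ?thesis using E_graph[OF _ T_E_in, of "{- real m<..real m}" "- real n" "real n" x]
      by (intro T_E_eq[symmetric]) auto
  qed
  have est: "(norm (?t n - ?t m))\<^sup>2 = ?a n - ?a m" if "m \<le> n" for m n
    using projection_op_pythagoras[OF E_projection, of "{- real m<..real m}" "?t n"] by (simp add: Pt[OF that])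
  have inc: "incseq ?a"
  proof (rule monoI)
    fix m n :: nat assume "m \<le> n"
    then show "?a m \<le> ?a n" using est[of m n] by (metis zero_le_power2 diff_ge_0_iff_ge)
  qed
  have bd: "?a n \<le> (\<integral>t. t\<^sup>2 \<partial>spec x)" for n
  proof -
    have "?a n = (LINT t|spec x. indicat_real {- real n<..real n} t *\<^sub>R t\<^sup>2)"
      using T_E_norm[of "- real n" "real n" x] by (simp add: set_lebesgue_integral_def)
    also have "\<dots> \<le> (\<integral>t. t\<^sup>2 \<partial>spec x)"
      by (intro integral_mono int spec_Ioc_integrable_square) (auto simp: indicator_def)
    finally show ?thesis .
  qed
  have "convergent ?a"
    by (rule incseq_convergent[OF inc, of "\<integral>t. t\<^sup>2 \<partial>spec x"]) (use bd in \<open>auto simp: convergent_def\<close>)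
  then have "Cauchy ?a" by (rule convergent_Cauchy)
  have "Cauchy ?t"
  proof (rule metric_CauchyI)
    fix e :: real assume e: "e > 0"
    then obtain N where N: "\<And>m n. m \<ge> N \<Longrightarrow> n \<ge> N \<Longrightarrow> norm (?a m - ?a n) < e\<^sup>2"
      using CauchyD[OF \<open>Cauchy ?a\<close>, of "e\<^sup>2"] by auto
    have *: "dist (?t n) (?t m) < e" if "m \<ge> N" "n \<ge> N" "m \<le> n" for m n
    proof -
      have "(norm (?t n - ?t m))\<^sup>2 < e\<^sup>2" using N[OF that(2,1)] est[OF that(3)] by simp
      then show ?thesis using e by (simp add: dist_norm power2_less_imp_less)
    qed
    then show "\<exists>N. \<forall>m\<ge>N. \<forall>n\<ge>N. dist (?t m) (?t n) < e"
      by (metis dist_commute nle_le)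
  qed
  then obtain u where u: "?t \<longlonglongrightarrow> u" using Cauchy_convergent convergent_def by blast
  have "(\<lambda>n. (?P n x, ?t n)) \<longlonglongrightarrow> (x, u)" by (intro tendsto_Pair E_Ioc_limit u)
  then have "(x, u) \<in> T"
    by (rule closed_sequentially[OF closed, rotated]) (rule T_E_in, simp)
  then show ?thesis by blast
qed

lemma resolution_of_identity_E: "resolution_of_identity T E"
  unfolding resolution_of_identity_def spectral_measure_at_E
  using projection_valued_measure_E graph_spec_integrable spec_integrable_graph graph_spec_form by auto

lemma commutant_E: "commutant B \<Longrightarrow> \<Delta> \<in> sets borel \<Longrightarrow> commutes (E \<Delta>) B"
  by (rule E_commutes) (auto simp: commutant_def intro: F_commutes[unfolded commutant_def])

end

text \<open>Two passes through the commutant: the resolvents of \<open>T\<close> commute with those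
  of \<open>S\<close>, hence with \<open>S.E\<close>; so \<open>S.E\<close> commutes with the
  resolvents of \<open>T\<close>, hence with \<open>T.E\<close>.\<close>

lemma commuting_ops_resolvents:
  assumes S: "selfadjoint_graph S" and T: "selfadjoint_graph T"
    and comm: "\<And>c d. c = \<i> \<or> c = - \<i> \<Longrightarrow> d = \<i> \<or> d = - \<i> \<Longrightarrow>
      commutes (selfadjoint_graph.res S c) (selfadjoint_graph.res T d)"
  shows "commuting_ops S T"
proof -
  interpret S: selfadjoint_graph S by (rule S)
  interpret T: selfadjoint_graph T by (rule T)
  have "S.E \<Delta> \<circ> T.E \<Delta>' = T.E \<Delta>' \<circ> S.E \<Delta>" if \<Delta>: "\<Delta> \<in> sets borel" and \<Delta>': "\<Delta>' \<in> sets borel" for \<Delta> \<Delta>'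
  proof -
    have sc: "S.commutant (T.res d)" if "d = \<i> \<or> d = - \<i>" for d
      using comm[OF _ that] T.res_bounded_linear[OF that] by (simp add: S.commutant_def)
    have "T.commutant (S.E \<Delta>)"
      using S.commutant_E[OF sc \<Delta>, of \<i>] S.commutant_E[OF sc \<Delta>, of "- \<i>"]
        bounded_sa_bounded_linear[OF S.E_bounded_sa[OF \<Delta>]]
      by (auto simp: T.commutant_def commutes_def)
    from T.commutant_E[OF this \<Delta>'] show ?thesis by (auto simp: commutes_def)
  qed
  then show ?thesis
    unfolding commuting_ops_def using S.resolution_of_identity_E T.resolution_of_identity_E by blast
qed

section \<open>The convolution algebra\<close>

lemma pts_exists: "\<exists>x. pts x {..<size \<eta>} = (\<eta> :: 'a multiset)"
proof -
  obtain xs where xs: "mset xs = \<eta>" using ex_mset by blast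
  have "map ((!) xs) [0..<length xs] = xs" by (rule map_nth)
  then have "image_mset ((!) xs) (mset [0..<length xs]) = mset xs" by (metis mset_map)
  moreover have "mset [0..<length xs] = mset_set {..<size \<eta>}" using xs by (auto simp: lessThan_atLeast0)
  ultimately have "pts ((!) xs) {..<size \<eta>} = \<eta>" unfolding pts_def xs by (simp only:)
  then show ?thesis by (rule exI[of _ "(!) xs"])
qed

lemma size_pts [simp]: "size (pts x S) = card S"
  by (simp add: pts_def)

lemma pts_image: "inj_on h S \<Longrightarrow> pts x (h ` S) = pts (\<lambda>i. x (h i)) S"
  by (simp add: pts_def image_mset_mset_set[symmetric] multiset.map_comp o_def)

definition covers :: "nat set \<Rightarrow> (nat set \<times> nat set) set" where
  "covers S = {(\<alpha>, \<beta>). \<alpha> \<union> \<beta> = S}"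

lemma finite_covers: "finite S \<Longrightarrow> finite (covers S)"
  by (rule finite_subset[of _ "Pow S \<times> Pow S"]) (auto simp: covers_def)

text \<open>The triple \<open>(\<xi>\<^sub>1, \<xi>\<^sub>2, \<xi>\<^sub>3)\<close> is encoded by \<open>\<alpha> = \<xi>\<^sub>1 \<union> \<xi>\<^sub>2\<close> and \<open>\<beta> = \<xi>\<^sub>2 \<union> \<xi>\<^sub>3\<close>.\<close>

lemma conv_pts:
  assumes S: "finite S"
  shows "(G1 \<star> G2) (pts x S) = (\<Sum>(\<alpha>, \<beta>)\<in>covers S. G1 (pts x \<alpha>) * G2 (pts x \<beta>))"
proof -
  obtain h where h: "bij_betw h {..<card S} S"
    using ex_bij_betw_nat_finite[OF S] by (auto simp: lessThan_atLeast0)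
  let ?n = "card S" and ?y = "\<lambda>i. x (h i)"
  have inj: "inj_on h {..<?n}" and im: "h ` {..<?n} = S" using h by (auto simp: bij_betw_def)
  have sub: "pts ?y \<xi> = pts x (h ` \<xi>)" if "\<xi> \<subseteq> {..<?n}" for \<xi>
    by (rule pts_image[symmetric, OF inj_on_subset[OF inj that]])
  have "pts ?y {..<?n} = pts x S" using sub[of "{..<?n}"] im by simp
  from conv_eq[OF this] have "(G1 \<star> G2) (pts x S) =
      (\<Sum>(a, b, c)\<in>P3 ?n. G1 (pts ?y (a \<union> b)) * G2 (pts ?y (b \<union> c)))" by simp
  also have "\<dots> = (\<Sum>(\<alpha>, \<beta>)\<in>covers S. G1 (pts x \<alpha>) * G2 (pts x \<beta>))"
  proof (rule sum.reindex_bij_witness[where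
        j = "\<lambda>(a, b, c). (h ` (a \<union> b), h ` (b \<union> c))" and
        i = "\<lambda>(\<alpha>, \<beta>). ({i \<in> {..<?n}. h i \<in> \<alpha> - \<beta>}, {i \<in> {..<?n}. h i \<in> \<alpha> \<inter> \<beta>}, {i \<in> {..<?n}. h i \<in> \<beta> - \<alpha>})"],
      goal_cases)
    case (1 t)
    obtain a b c where t: "t = (a, b, c)" by (cases t)
    have s: "a \<subseteq> {..<?n}" "b \<subseteq> {..<?n}" "c \<subseteq> {..<?n}" and d: "a \<inter> b = {}" "a \<inter> c = {}" "b \<inter> c = {}"
      using 1 by (auto simp: t P3_def)
    have m: "h i \<in> h ` \<xi> \<longleftrightarrow> i \<in> \<xi>" if "i \<in> {..<?n}" "\<xi> \<subseteq> {..<?n}" for i \<xi>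
      using inj_on_image_mem_iff[OF inj] that by auto
    define A B where "A = h ` (a \<union> b)" and "B = h ` (b \<union> c)"
    have AB: "h i \<in> A \<longleftrightarrow> i \<in> a \<union> b" "h i \<in> B \<longleftrightarrow> i \<in> b \<union> c" if "i \<in> {..<?n}" for i
      unfolding A_def B_def by (rule m[OF that], use s in blast)+
    have "{i \<in> {..<?n}. h i \<in> A - B} = {i \<in> {..<?n}. i \<in> (a \<union> b) - (b \<union> c)}"
      "{i \<in> {..<?n}. h i \<in> A \<inter> B} = {i \<in> {..<?n}. i \<in> (a \<union> b) \<inter> (b \<union> c)}"
      "{i \<in> {..<?n}. h i \<in> B - A} = {i \<in> {..<?n}. i \<in> (b \<union> c) - (a \<union> b)}"
      using AB by (auto cong: conj_cong)
    moreover have "{i \<in> {..<?n}. i \<in> (a \<union> b) - (b \<union> c)} = a"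
      "{i \<in> {..<?n}. i \<in> (a \<union> b) \<inter> (b \<union> c)} = b" "{i \<in> {..<?n}. i \<in> (b \<union> c) - (a \<union> b)} = c"
      using s d by auto
    ultimately have "{i \<in> {..<?n}. h i \<in> A - B} = a" "{i \<in> {..<?n}. h i \<in> A \<inter> B} = b"
      "{i \<in> {..<?n}. h i \<in> B - A} = c" by (simp_all only:)
    then show ?case by (simp add: t A_def B_def del: image_Un)
  next
    case (2 t)
    obtain a b c where t: "t = (a, b, c)" by (cases t)
    have "a \<union> b \<union> (b \<union> c) = {..<?n}" using 2 by (auto simp: t P3_def)
    then show ?case by (simp only: t prod.case covers_def mem_Collect_eq image_Un[symmetric] im)
  next
    case (3 t)
    obtain \<alpha> \<beta> where t: "t = (\<alpha>, \<beta>)" by (cases t)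
    have s: "\<alpha> \<subseteq> S" "\<beta> \<subseteq> S" using 3 by (auto simp: t covers_def)
    have 1: "h ` {i \<in> {..<?n}. h i \<in> A} = A" if "A \<subseteq> S" for A
    proof -
      have "h ` {i \<in> {..<?n}. h i \<in> A} = A \<inter> h ` {..<?n}" by blast
      then show ?thesis using that by (simp only: im Int_absorb2)
    qed
    have 2: "{i \<in> {..<?n}. h i \<in> A - B} \<union> {i \<in> {..<?n}. h i \<in> A \<inter> B} = {i \<in> {..<?n}. h i \<in> A}"
      "{i \<in> {..<?n}. h i \<in> A \<inter> B} \<union> {i \<in> {..<?n}. h i \<in> B - A} = {i \<in> {..<?n}. h i \<in> B}" for A B
      by auto
    show ?case unfolding t prod.case 2 1[OF s(1)] 1[OF s(2)] ..
  next
    case (4 t)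
    have "h i \<in> S" if "i < ?n" for i using im that by auto
    then show ?case using 4 by (cases t) (auto simp: P3_def covers_def)
  next
    case (5 t)
    obtain a b c where t: "t = (a, b, c)" by (cases t)
    have "a \<union> b \<subseteq> {..<?n}" "b \<union> c \<subseteq> {..<?n}" using 5 by (auto simp: t P3_def)
    then show ?case by (simp add: t sub)
  qed
  finally show ?thesis .
qed

text \<open>The K-transform of configuration space analysis, the sum over all finite
  subconfigurations. Subsets of an index set replace submultisets, so that coinciding points are
  counted separately.\<close>

definition K_transform :: "('a multiset \<Rightarrow> complex) \<Rightarrow> (nat \<Rightarrow> 'a) \<Rightarrow> nat set \<Rightarrow> complex" where
  "K_transform G x U = (\<Sum>S\<in>Pow U. G (pts x S))"

text \<open>Each pair of subsets of \<open>U\<close> covers exactly one set, its union; grouping all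
  pairs by their unions turns the double sum into the product.\<close>

lemma K_transform_conv:
  assumes U: "finite U" shows "K_transform (G1 \<star> G2) x U = K_transform G1 x U * K_transform G2 x U"
proof -
  let ?f = "\<lambda>(\<alpha>, \<beta>). G1 (pts x \<alpha>) * G2 (pts x \<beta>)"
  have "K_transform (G1 \<star> G2) x U = (\<Sum>S\<in>Pow U. \<Sum>p\<in>{p \<in> Pow U \<times> Pow U. (\<lambda>(\<alpha>, \<beta>). \<alpha> \<union> \<beta>) p = S}. ?f p)"
    unfolding K_transform_def
  proof (rule sum.cong[OF refl])
    fix S assume S: "S \<in> Pow U"
    have "{p \<in> Pow U \<times> Pow U. (\<lambda>(\<alpha>, \<beta>). \<alpha> \<union> \<beta>) p = S} = covers S" using S by (auto simp: covers_def)
    then show "(G1 \<star> G2) (pts x S) = (\<Sum>p\<in>{p \<in> Pow U \<times> Pow U. (\<lambda>(\<alpha>, \<beta>). \<alpha> \<union> \<beta>) p = S}. ?f p)"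
      using conv_pts[of S] S finite_subset[OF _ U] by simp
  qed
  also have "\<dots> = (\<Sum>p\<in>Pow U \<times> Pow U. ?f p)"
    by (rule sum.group) (use U in auto)
  also have "\<dots> = K_transform G1 x U * K_transform G2 x U"
    by (simp add: K_transform_def sum_product sum.cartesian_product)
  finally show ?thesis .
qed

text \<open>Moebius inversion by induction: the top term is the transform minus the terms of the
  proper subsets.\<close>

lemma K_transform_inject:
  fixes G H :: "'a multiset \<Rightarrow> complex"
  assumes eq: "\<And>x U. finite U \<Longrightarrow> K_transform G x U = K_transform H x U" shows "G = H"
proof
  fix \<eta> :: "'a multiset"
  have *: "G (pts x S) = H (pts x S)" if "finite S" for x S
    using that
  proof (induction S rule: finite_psubset_induct)
    case (psubset S)
    have d: "K_transform G x S = G (pts x S) + (\<Sum>\<alpha>\<in>Pow S - {S}. G (pts x \<alpha>))" for G :: "'a multiset \<Rightarrow> complex"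
      unfolding K_transform_def by (rule sum.remove) (use psubset.hyps in auto)
    have "(\<Sum>\<alpha>\<in>Pow S - {S}. G (pts x \<alpha>)) = (\<Sum>\<alpha>\<in>Pow S - {S}. H (pts x \<alpha>))"
      by (rule sum.cong) (use psubset.IH in auto)
    then show ?case using d[of G] d[of H] eq[OF psubset.hyps, of x] by simp
  qed
  obtain x where "pts x {..<size \<eta>} = \<eta>" using pts_exists by blast
  then show "G \<eta> = H \<eta>" using *[of "{..<size \<eta>}" x] by simp
qed

section \<open>Laws of the convolution, read off from products of complex numbers\<close>

lemma K_transform_add: "K_transform (\<lambda>\<eta>. G \<eta> + H \<eta>) x U = K_transform G x U + K_transform H x U"
  by (simp add: K_transform_def sum.distrib)

lemma K_transform_scale: "K_transform (\<lambda>\<eta>. c * G \<eta>) x U = c * K_transform G x U"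
  by (simp add: K_transform_def sum_distrib_left)

lemma K_transform_cnj: "K_transform (cnj \<circ> G) x U = cnj (K_transform G x U)"
  by (simp add: K_transform_def)

lemma conv_assoc: "(G \<star> H) \<star> J = G \<star> (H \<star> J)"
  by (rule K_transform_inject) (simp add: K_transform_conv)

lemma conv_left_commute: "G \<star> (H \<star> J) = H \<star> (G \<star> J)"
  by (rule K_transform_inject) (simp add: K_transform_conv)

lemma conv_add_right: "G \<star> (\<lambda>\<eta>. H \<eta> + J \<eta>) = (\<lambda>\<eta>. (G \<star> H) \<eta> + (G \<star> J) \<eta>)"
  by (rule K_transform_inject) (simp add: K_transform_conv K_transform_add algebra_simps)

lemma conv_scale_right: "G \<star> (\<lambda>\<eta>. c * H \<eta>) = (\<lambda>\<eta>. c * (G \<star> H) \<eta>)"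
  by (rule K_transform_inject) (simp add: K_transform_conv K_transform_scale algebra_simps)

lemma cnj_conv: "cnj \<circ> (G \<star> H) = (cnj \<circ> G) \<star> (cnj \<circ> H)"
  by (rule K_transform_inject) (simp add: K_transform_conv K_transform_cnj)

lemma cnj_one_particle: "cnj \<circ> one_particle \<phi> = one_particle \<phi>"
  by (auto simp: one_particle_def)

lemma one_particle_pts: "one_particle \<phi> (pts x {i}) = complex_of_real (\<phi> (x i))"
  by (simp add: one_particle_def pts_def)

text \<open>Only singletons contribute from the first factor, and the second set must then be all of
  \<open>S\<close> or miss just that point. Supports, smoothness and bounds of the convolution are
  all derived from this formula.\<close>

lemma one_particle_conv_pts:
  assumes S: "finite S"
  shows "(one_particle \<phi> \<star> G) (pts x S) =
    (\<Sum>i\<in>S. complex_of_real (\<phi> (x i)) * (G (pts x S) + G (pts x (S - {i}))))"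
proof -
  let ?f = "\<lambda>(\<alpha>, \<beta>). one_particle \<phi> (pts x \<alpha>) * G (pts x \<beta>)"
  \<comment> \<open>The Boolean says whether the point \<open>i\<close> is shared by both
    factors.\<close>
  let ?g = "\<lambda>(i, b). ({i}, if b then S else S - {i})"
  have im: "?g ` (S \<times> UNIV) \<subseteq> covers S" by (auto simp: covers_def split: if_splits)
  have "(one_particle \<phi> \<star> G) (pts x S) = sum ?f (covers S)" by (rule conv_pts[OF S])
  also have "\<dots> = sum ?f (?g ` (S \<times> UNIV))"
  proof (rule sum.mono_neutral_right[OF finite_covers[OF S] im], rule ballI)
    fix p assume p: "p \<in> covers S - ?g ` (S \<times> UNIV)"
    obtain \<alpha> \<beta> where p': "p = (\<alpha>, \<beta>)" by (cases p)
    have "card \<alpha> \<noteq> 1"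
    proof
      assume "card \<alpha> = 1"
      then obtain i where i: "\<alpha> = {i}" by (auto simp: card_1_singleton_iff)
      have c: "insert i \<beta> = S" using p by (simp add: p' i covers_def)
      then have "\<beta> = S \<or> \<beta> = S - {i}" by auto
      then have "p = ?g (i, True) \<or> p = ?g (i, False)" by (auto simp: p' i)
      moreover have "i \<in> S" using c by auto
      ultimately show False using p by blast
    qed
    then show "?f p = 0" by (simp add: p' one_particle_def)
  qed
  also have "\<dots> = (\<Sum>q\<in>S \<times> UNIV. ?f (?g q))"
    by (subst sum.reindex) (auto simp: inj_on_def split: if_splits)
  also have "\<dots> = (\<Sum>i\<in>S. \<Sum>b\<in>UNIV. ?f (?g (i, b)))"
    unfolding sum.cartesian_product by (rule sum.cong) auto
  also have "\<dots> = (\<Sum>i\<in>S. complex_of_real (\<phi> (x i)) * (G (pts x S) + G (pts x (S - {i}))))"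
    by (rule sum.cong) (simp_all add: UNIV_bool one_particle_pts algebra_simps)
  finally show ?thesis .
qed

section \<open>Sequences of test functions\<close>

lemma Ck_on_power_continuous:
  "Ck_on_power k n W f \<Longrightarrow> continuous_map (subtopology (power_top n) W) euclidean f"
  by (cases k) auto

lemma Ck_on_power_Suc: "Ck_on_power (Suc k) n W f \<Longrightarrow> Ck_on_power k n W f"
proof (induction k arbitrary: f)
  case (Suc k)
  show ?case
    unfolding Ck_on_power.simps(2)[of k]
  proof (intro conjI allI impI ballI)
    fix i b assume "i < n" "b \<in> (Basis :: 'a set)"
    then obtain h where "Ck_on_power (Suc k) n W h"
      "\<forall>y\<in>W. ((\<lambda>t. f (y(i := y i + t *\<^sub>R b))) has_vector_derivative h y) (at 0)"
      using Suc.prems unfolding Ck_on_power.simps(2)[of "Suc k"] by blast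
    then show "\<exists>h. Ck_on_power k n W h \<and>
        (\<forall>y\<in>W. ((\<lambda>t. f (y(i := y i + t *\<^sub>R b))) has_vector_derivative h y) (at 0))"
      using Suc.IH by blast
  qed (rule Ck_on_power_continuous[OF Suc.prems])
qed auto

lemma Ck_on_power_const: "Ck_on_power k n W (\<lambda>_. c)"
proof (induction k arbitrary: c)
  case (Suc k)
  show ?case
    unfolding Ck_on_power.simps(2)
    by (intro conjI allI impI ballI exI[of _ "\<lambda>_. 0"]) (auto simp: Suc intro!: derivative_intros)
qed auto

lemma Ck_on_power_add:
  assumes "Ck_on_power k n W f" "Ck_on_power k n W g" shows "Ck_on_power k n W (\<lambda>y. f y + g y)"
  using assms
proof (induction k arbitrary: f g)
  case 0
  then show ?case by (simp add: continuous_map_add)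
next
  case (Suc k)
  show ?case
    unfolding Ck_on_power.simps(2)
  proof (intro conjI allI impI ballI)
    show "continuous_map (subtopology (power_top n) W) euclidean (\<lambda>y. f y + g y)"
      by (intro continuous_map_add Ck_on_power_continuous[OF Suc.prems(1)] Ck_on_power_continuous[OF Suc.prems(2)])
    fix i b assume ib: "i < n" "b \<in> (Basis :: 'a set)"
    obtain f' where f': "Ck_on_power k n W f'"
      "\<And>y. y \<in> W \<Longrightarrow> ((\<lambda>t. f (y(i := y i + t *\<^sub>R b))) has_vector_derivative f' y) (at 0)"
      using Suc.prems(1) ib unfolding Ck_on_power.simps(2) by blast
    obtain g' where g': "Ck_on_power k n W g'"
      "\<And>y. y \<in> W \<Longrightarrow> ((\<lambda>t. g (y(i := y i + t *\<^sub>R b))) has_vector_derivative g' y) (at 0)"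
      using Suc.prems(2) ib unfolding Ck_on_power.simps(2) by blast
    show "\<exists>h. Ck_on_power k n W h \<and>
        (\<forall>y\<in>W. ((\<lambda>t. f (y(i := y i + t *\<^sub>R b)) + g (y(i := y i + t *\<^sub>R b))) has_vector_derivative h y) (at 0))"
      using f' g' Suc.IH by (intro exI[of _ "\<lambda>y. f' y + g' y"]) (auto intro: has_vector_derivative_add)
  qed
qed

lemma Ck_on_power_mult:
  assumes "Ck_on_power k n W f" "Ck_on_power k n W g" shows "Ck_on_power k n W (\<lambda>y. f y * g y)"
  using assms
proof (induction k arbitrary: f g)
  case 0
  then show ?case by (simp add: continuous_map_atin tendsto_mult)
next
  case (Suc k)
  show ?case
    unfolding Ck_on_power.simps(2)
  proof (intro conjI allI impI ballI)
    show "continuous_map (subtopology (power_top n) W) euclidean (\<lambda>y. f y * g y)"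
      using Ck_on_power_continuous[OF Suc.prems(1)] Ck_on_power_continuous[OF Suc.prems(2)]
      by (simp add: continuous_map_atin tendsto_mult)
    fix i b assume ib: "i < n" "b \<in> (Basis :: 'a set)"
    obtain f' where f': "Ck_on_power k n W f'"
      "\<And>y. y \<in> W \<Longrightarrow> ((\<lambda>t. f (y(i := y i + t *\<^sub>R b))) has_vector_derivative f' y) (at 0)"
      using Suc.prems(1) ib unfolding Ck_on_power.simps(2) by blast
    obtain g' where g': "Ck_on_power k n W g'"
      "\<And>y. y \<in> W \<Longrightarrow> ((\<lambda>t. g (y(i := y i + t *\<^sub>R b))) has_vector_derivative g' y) (at 0)"
      using Suc.prems(2) ib unfolding Ck_on_power.simps(2) by blast
    have "Ck_on_power k n W (\<lambda>y. f y * g' y + f' y * g y)"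
      by (rule Ck_on_power_add[OF Suc.IH[OF Ck_on_power_Suc[OF Suc.prems(1)] g'(1)]
            Suc.IH[OF f'(1) Ck_on_power_Suc[OF Suc.prems(2)]]])
    moreover have "((\<lambda>t. f (y(i := y i + t *\<^sub>R b)) * g (y(i := y i + t *\<^sub>R b))) has_vector_derivative
        (f y * g' y + f' y * g y)) (at 0)" if "y \<in> W" for y
      using has_vector_derivative_mult[OF f'(2)[OF that] g'(2)[OF that]] by simp
    ultimately show "\<exists>h. Ck_on_power k n W h \<and>
        (\<forall>y\<in>W. ((\<lambda>t. f (y(i := y i + t *\<^sub>R b)) * g (y(i := y i + t *\<^sub>R b))) has_vector_derivative h y) (at 0))"
      by blast
  qed
qed

lemma Ck_on_power_sum:
  "(\<And>i. i \<in> I \<Longrightarrow> Ck_on_power k n W (f i)) \<Longrightarrow> Ck_on_power k n W (\<lambda>y. \<Sum>i\<in>I. f i y)"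
  by (induction I rule: infinite_finite_induct) (auto intro: Ck_on_power_const Ck_on_power_add)

lemma continuous_map_power_coordinate:
  "i < n \<Longrightarrow> continuous_map (subtopology (power_top n) W) euclidean (\<lambda>y. y i)"
  by (intro continuous_map_from_subtopology continuous_map_product_projection) simp

text \<open>Differentiation in a coordinate that \<open>s\<close> selects gives the partial
  derivative of \<open>f\<close> in the selecting position, unique by injectivity; in any other
  coordinate it gives zero. This treats functions of n variables that ignore some of them.\<close>

lemma Ck_on_power_reindex:
  assumes "Ck_on_power k m V f" and s: "inj_on s {..<m}" "s ` {..<m} \<subseteq> {..<n}"
    and V: "\<And>y. y \<in> W \<Longrightarrow> (\<lambda>j\<in>{..<m}. y (s j)) \<in> V"
  shows "Ck_on_power k n W (\<lambda>y. f (\<lambda>j\<in>{..<m}. y (s j)))"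
  using assms(1)
proof (induction k arbitrary: f)
  have r: "continuous_map (subtopology (power_top n) W) (subtopology (power_top m) V) (\<lambda>y. \<lambda>j\<in>{..<m}. y (s j))"
  proof (rule continuous_map_into_subtopology)
    show "continuous_map (subtopology (power_top n) W) (power_top m) (\<lambda>y. \<lambda>j\<in>{..<m}. y (s j))"
      unfolding continuous_map_componentwise using s
      by (auto intro!: continuous_map_power_coordinate)
  qed (use V in auto)
  have cont: "continuous_map (subtopology (power_top n) W) euclidean (\<lambda>y. f (\<lambda>j\<in>{..<m}. y (s j)))"
    if "continuous_map (subtopology (power_top m) V) euclidean f" for f :: "(nat \<Rightarrow> 'a) \<Rightarrow> complex"
    using continuous_map_compose[OF r that] by (simp add: o_def)
  {
    case 0
    then show ?case unfolding Ck_on_power.simps Ck_on.simps by (rule cont)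
  next
    case (Suc k)
    show ?case
      unfolding Ck_on_power.simps(2)
    proof (intro conjI allI impI ballI)
      show "continuous_map (subtopology (power_top n) W) euclidean (\<lambda>y. f (\<lambda>j\<in>{..<m}. y (s j)))"
        by (rule cont[OF Ck_on_power_continuous[OF Suc.prems]])
      fix i b assume ib: "i < n" "b \<in> (Basis :: 'a set)"
      show "\<exists>h. Ck_on_power k n W h \<and> (\<forall>y\<in>W. ((\<lambda>t. f (\<lambda>j\<in>{..<m}. (y(i := y i + t *\<^sub>R b)) (s j)))
          has_vector_derivative h y) (at 0))"
      proof (cases "\<exists>j<m. s j = i")
        case True
        then obtain j where j: "j < m" "s j = i" by blast
        obtain f' where f': "Ck_on_power k m V f'"
          "\<And>y. y \<in> V \<Longrightarrow> ((\<lambda>t. f (y(j := y j + t *\<^sub>R b))) has_vector_derivative f' y) (at 0)"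
          using Suc.prems j ib unfolding Ck_on_power.simps(2) by blast
        have "((\<lambda>t. f (\<lambda>j\<in>{..<m}. (y(i := y i + t *\<^sub>R b)) (s j))) has_vector_derivative
            f' (\<lambda>j\<in>{..<m}. y (s j))) (at 0)" if "y \<in> W" for y
        proof -
          have "(\<lambda>l\<in>{..<m}. (y(i := z)) (s l)) = (\<lambda>l\<in>{..<m}. y (s l))(j := z)" for z
            using j s(1) by (auto simp: fun_eq_iff restrict_def inj_on_def)
          then show ?thesis using f'(2)[OF V[OF that]] j by simp
        qed
        then show ?thesis using Suc.IH[OF f'(1)] by blast
      next
        case False
        then have "(\<lambda>l\<in>{..<m}. (y(i := z)) (s l)) = (\<lambda>l\<in>{..<m}. y (s l))" for y :: "nat \<Rightarrow> 'a" and z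
          by (auto simp: fun_eq_iff restrict_def)
        then show ?thesis
          by (intro exI[of _ "\<lambda>_. 0"]) (auto intro: Ck_on_power_const)
      qed
    qed
  }
qed

lemma Ck_on_power_of_coordinate:
  fixes \<phi> :: "'e::euclidean_space \<Rightarrow> real"
  assumes "Ck_on k V \<phi>" and i: "i < n" and V: "\<And>y. y \<in> W \<Longrightarrow> y i \<in> V"
  shows "Ck_on_power k n W (\<lambda>y. complex_of_real (\<phi> (y i)))"
  using assms(1)
proof (induction k arbitrary: \<phi>)
  have cont: "continuous_map (subtopology (power_top n) W) euclidean (\<lambda>y. complex_of_real (\<phi> (y i)))"
    if "continuous_on V \<phi>" for \<phi> :: "'e \<Rightarrow> real"
  proof -
    have 1: "continuous_map (subtopology (power_top n) W) (top_of_set V) (\<lambda>y. y i)"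
      by (intro continuous_map_into_subtopology continuous_map_power_coordinate[OF i]) (use V in auto)
    have 2: "continuous_map (top_of_set V) euclidean (\<lambda>z. complex_of_real (\<phi> z))"
      using that by (auto intro: continuous_on_of_real)
    show ?thesis using continuous_map_compose[OF 1 2] by (simp add: o_def)
  qed
  {
    case 0
    then show ?case unfolding Ck_on_power.simps Ck_on.simps by (rule cont)
  next
    case (Suc k)
    show ?case
      unfolding Ck_on_power.simps(2)
    proof (intro conjI allI impI ballI)
      show "continuous_map (subtopology (power_top n) W) euclidean (\<lambda>y. complex_of_real (\<phi> (y i)))"
        using Suc.prems by (intro cont) simp
      fix j b assume jb: "j < n" "b \<in> (Basis :: 'e set)"
      show "\<exists>h. Ck_on_power k n W h \<and> (\<forall>y\<in>W. ((\<lambda>t. complex_of_real (\<phi> ((y(j := y j + t *\<^sub>R b)) i)))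
          has_vector_derivative h y) (at 0))"
      proof (cases "j = i")
        case True
        obtain h where h: "Ck_on k V h" "\<And>y. y \<in> V \<Longrightarrow> ((\<lambda>t. \<phi> (y + t *\<^sub>R b)) has_vector_derivative h y) (at 0)"
          using Suc.prems jb by auto
        have "((\<lambda>t. complex_of_real (\<phi> (y i + t *\<^sub>R b))) has_vector_derivative complex_of_real (h (y i))) (at 0)"
          if "y \<in> W" for y
          by (rule bounded_linear.has_vector_derivative[OF bounded_linear_of_real h(2)[OF V[OF that]]])
        then show ?thesis using Suc.IH[OF h(1)] True by auto
      next
        case False
        then show ?thesis by (intro exI[of _ "\<lambda>_. 0"]) (auto intro: Ck_on_power_const)
      qed
    qed
  }
qed

section \<open>Supports and smoothness of finite sequences\<close>

lemma set_mset_pts [simp]: "finite S \<Longrightarrow> set_mset (pts x S) = x ` S"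
  by (simp add: pts_def)

lemma pts_cong: "(\<And>i. i \<in> S \<Longrightarrow> x i = y i) \<Longrightarrow> pts x S = pts y S"
  unfolding pts_def by (cases "finite S") (auto intro: image_mset_cong)

definition supported_on :: "'a set \<Rightarrow> nat \<Rightarrow> ('a multiset \<Rightarrow> complex) \<Rightarrow> bool" where
  "supported_on \<Lambda> N G \<longleftrightarrow> (\<forall>\<eta>. G \<eta> \<noteq> 0 \<longrightarrow> set_mset \<eta> \<subseteq> \<Lambda> \<and> size \<eta> \<le> N)"

definition smooth_sequence ::
  "('a::topological_space, 'd::finite) chart set \<Rightarrow> ('a multiset \<Rightarrow> complex) \<Rightarrow> bool" where
  "smooth_sequence A G \<longleftrightarrow> (\<forall>n C k. (\<forall>i<n. C i \<in> A) \<longrightarrow>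
     Ck_on_power k n (\<Pi>\<^sub>E i\<in>{..<n}. chart_range (C i))
       (\<lambda>y. G (pts (\<lambda>i\<in>{..<n}. chart_inv (C i) (y i)) {..<n})))"

lemma supported_on_mono: "supported_on \<Lambda> N G \<Longrightarrow> \<Lambda> \<subseteq> \<Lambda>' \<Longrightarrow> N \<le> N' \<Longrightarrow> supported_on \<Lambda>' N' G"
  by (force simp: supported_on_def)

lemma Hausdorff_space_euclidean_t2: "Hausdorff_space (euclidean :: 'a::t2_space topology)"
  unfolding Hausdorff_space_def disjnt_def using hausdorff by (simp, meson)

text \<open>The compact supports at the finitely many levels have compact coordinate projections,
  whose union serves as one common \<Lambda>. Conversely, the support at level n is closed in the
  compact power of \<Lambda>. Sums and convolutions are easier to control with a common
  \<Lambda>.\<close>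

lemma Ffin_iff:
  fixes A :: "('a::t2_space, 'd::finite) chart set"
  shows "G \<in> Ffin A \<longleftrightarrow> smooth_sequence A G \<and> (\<exists>\<Lambda> N. compact \<Lambda> \<and> supported_on \<Lambda> N G)"
proof
  assume G: "G \<in> Ffin A"
  then obtain N where N: "\<And>\<eta>. size \<eta> > N \<Longrightarrow> G \<eta> = 0" by (auto simp: Ffin_def)
  let ?K = "\<lambda>n. power_top n closure_of {x \<in> topspace (power_top n). G (pts x {..<n}) \<noteq> 0}"
  define \<Lambda> where "\<Lambda> = (\<Union>n\<in>{..N}. \<Union>i\<in>{..<n}. (\<lambda>x. x i) ` ?K n)"
  have K: "compactin (power_top n) (?K n)" for n
    using G by (auto simp: Ffin_def smooth_compact_power_def)
  have "compact ((\<lambda>x. x i) ` ?K n)" if "i < n" for i n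
    using image_compactin[OF K continuous_map_product_projection[of i "{..<n}" "\<lambda>_. euclidean"]] that by simp
  then have "compact \<Lambda>" unfolding \<Lambda>_def by (intro compact_UN) auto
  moreover have "supported_on \<Lambda> N G"
    unfolding supported_on_def
  proof (intro allI impI conjI)
    fix \<eta> assume nz: "G \<eta> \<noteq> 0"
    then show sz: "size \<eta> \<le> N" using N by (meson not_le_imp_less)
    obtain x where x: "pts x {..<size \<eta>} = \<eta>" using pts_exists by blast
    \<comment> \<open>Points of the power are extensional, while an enumeration is arbitrary outside
      its index set.\<close>
    define y where "y = restrict x {..<size \<eta>}"
    have "pts y {..<size \<eta>} = pts x {..<size \<eta>}" by (rule pts_cong) (simp add: y_def)
    then have y: "pts y {..<size \<eta>} = \<eta>" by (simp only: x)
    have "y \<in> {x \<in> topspace (power_top (size \<eta>)). G (pts x {..<size \<eta>}) \<noteq> 0}"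
      using nz y by (simp add: PiE_iff) (simp add: y_def)
    then have "y \<in> ?K (size \<eta>)" using closure_of_subset[of "{x \<in> topspace (power_top (size \<eta>)). G (pts x {..<size \<eta>}) \<noteq> 0}" "power_top (size \<eta>)"] by blast
    then have "y i \<in> \<Lambda>" if "i < size \<eta>" for i
      using sz that unfolding \<Lambda>_def by blast
    moreover have "set_mset \<eta> = y ` {..<size \<eta>}" using set_mset_pts[of "{..<size \<eta>}" y] by (simp add: y)
    ultimately show "set_mset \<eta> \<subseteq> \<Lambda>" by auto
  qed
  moreover have "smooth_sequence A G"
    using G unfolding Ffin_def smooth_compact_power_def smooth_on_power_def smooth_sequence_def by blast
  ultimately show "smooth_sequence A G \<and> (\<exists>\<Lambda> N. compact \<Lambda> \<and> supported_on \<Lambda> N G)" by blast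
next
  assume "smooth_sequence A G \<and> (\<exists>\<Lambda> N. compact \<Lambda> \<and> supported_on \<Lambda> N G)"
  then obtain \<Lambda> N where sm: "smooth_sequence A G" and \<Lambda>: "compact \<Lambda>" and G: "supported_on \<Lambda> N G" by blast
  have "compactin (power_top n) (power_top n closure_of {x \<in> topspace (power_top n). G (pts x {..<n}) \<noteq> 0})" for n
  proof (rule closed_compactin)
    show c: "compactin (power_top n) (\<Pi>\<^sub>E i\<in>{..<n}. \<Lambda>)" using \<Lambda> by (simp add: compactin_PiE)
    have "Hausdorff_space (power_top n :: (nat \<Rightarrow> 'a) topology)"
      by (simp add: Hausdorff_space_product_topology Hausdorff_space_euclidean_t2)
    then have "closedin (power_top n) (\<Pi>\<^sub>E i\<in>{..<n}. \<Lambda>)" using c by (rule compactin_imp_closedin)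
    moreover have "{x \<in> topspace (power_top n). G (pts x {..<n}) \<noteq> 0} \<subseteq> (\<Pi>\<^sub>E i\<in>{..<n}. \<Lambda>)"
    proof
      fix x assume x: "x \<in> {x \<in> topspace (power_top n). G (pts x {..<n}) \<noteq> 0}"
      then have "set_mset (pts x {..<n}) \<subseteq> \<Lambda>" using G unfolding supported_on_def by blast
      then show "x \<in> (\<Pi>\<^sub>E i\<in>{..<n}. \<Lambda>)" using x by (auto simp: PiE_iff)
    qed
    ultimately show "power_top n closure_of {x \<in> topspace (power_top n). G (pts x {..<n}) \<noteq> 0} \<subseteq> (\<Pi>\<^sub>E i\<in>{..<n}. \<Lambda>)"
      by (intro closure_of_minimal)
  qed simp
  moreover have "\<forall>\<eta>. size \<eta> > N \<longrightarrow> G \<eta> = 0" using G by (force simp: supported_on_def)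
  ultimately show "G \<in> Ffin A"
    using sm unfolding Ffin_def smooth_compact_power_def smooth_on_power_def smooth_sequence_def by blast
qed

lemma Ffin_zero: "(\<lambda>_. 0) \<in> Ffin (A :: ('a::t2_space, 'd::finite) chart set)"
  unfolding Ffin_iff smooth_sequence_def supported_on_def
  by (auto intro: Ck_on_power_const compact_empty)

lemma Ffin_add:
  fixes A :: "('a::t2_space, 'd::finite) chart set"
  assumes "G \<in> Ffin A" "H \<in> Ffin A" shows "(\<lambda>\<eta>. G \<eta> + H \<eta>) \<in> Ffin A"
proof -
  obtain \<Lambda> N \<Lambda>' N' where *: "compact \<Lambda>" "supported_on \<Lambda> N G" "compact \<Lambda>'" "supported_on \<Lambda>' N' H"
    using assms unfolding Ffin_iff by blast
  have "supported_on (\<Lambda> \<union> \<Lambda>') (max N N') (\<lambda>\<eta>. G \<eta> + H \<eta>)"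
    unfolding supported_on_def
  proof (intro allI impI)
    fix \<eta> assume "G \<eta> + H \<eta> \<noteq> 0"
    then have "G \<eta> \<noteq> 0 \<or> H \<eta> \<noteq> 0" by auto
    then show "set_mset \<eta> \<subseteq> \<Lambda> \<union> \<Lambda>' \<and> size \<eta> \<le> max N N'"
      using *(2,4) unfolding supported_on_def by (meson le_max_iff_disj le_supI1 le_supI2)
  qed
  moreover have "smooth_sequence A (\<lambda>\<eta>. G \<eta> + H \<eta>)"
    using assms unfolding Ffin_iff smooth_sequence_def by (auto intro: Ck_on_power_add)
  ultimately show ?thesis unfolding Ffin_iff using compact_Un[OF *(1,3)] by blast
qed

lemma Ffin_scale:
  fixes A :: "('a::t2_space, 'd::finite) chart set"
  assumes "G \<in> Ffin A" shows "(\<lambda>\<eta>. c * G \<eta>) \<in> Ffin A"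
proof -
  obtain \<Lambda> N where *: "compact \<Lambda>" "supported_on \<Lambda> N G" using assms unfolding Ffin_iff by blast
  have "supported_on \<Lambda> N (\<lambda>\<eta>. c * G \<eta>)" using *(2) by (simp add: supported_on_def)
  moreover have "smooth_sequence A (\<lambda>\<eta>. c * G \<eta>)"
    using assms unfolding Ffin_iff smooth_sequence_def by (auto intro: Ck_on_power_mult Ck_on_power_const)
  ultimately show ?thesis unfolding Ffin_iff using *(1) by blast
qed

lemma test_function_Ck:
  "\<phi> \<in> test_functions A \<Longrightarrow> C \<in> A \<Longrightarrow> Ck_on k (chart_range C) (\<phi> \<circ> chart_inv C)"
  by (simp add: test_functions_def smooth_on_def)

lemma test_function_supp:
  assumes "\<phi> \<in> test_functions A"
  obtains \<Lambda> where "compact \<Lambda>" "\<And>x. \<phi> x \<noteq> 0 \<Longrightarrow> x \<in> \<Lambda>"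
  using assms that[of "closure {x. \<phi> x \<noteq> 0}"] closure_subset[of "{x. \<phi> x \<noteq> 0}"]
  by (auto simp: test_functions_def)

lemma one_particle_Ffin:
  fixes A :: "('a::t2_space, 'd::finite) chart set"
  assumes \<phi>: "\<phi> \<in> test_functions A" shows "one_particle \<phi> \<in> Ffin A"
proof -
  obtain \<Lambda> where \<Lambda>: "compact \<Lambda>" "\<And>x. \<phi> x \<noteq> 0 \<Longrightarrow> x \<in> \<Lambda>" using test_function_supp[OF \<phi>] by blast
  have "supported_on \<Lambda> 1 (one_particle \<phi>)"
    unfolding supported_on_def
  proof (intro allI impI)
    fix \<eta> :: "'a multiset" assume nz: "one_particle \<phi> \<eta> \<noteq> 0"
    then have "size \<eta> = 1" by (auto simp: one_particle_def split: if_splits)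
    then obtain x where "\<eta> = {#x#}" by (metis One_nat_def size_1_singleton_mset)
    then show "set_mset \<eta> \<subseteq> \<Lambda> \<and> size \<eta> \<le> 1" using nz \<Lambda>(2) by (auto simp: one_particle_def)
  qed
  moreover have "smooth_sequence A (one_particle \<phi>)"
    unfolding smooth_sequence_def
  proof (intro allI impI)
    fix n k and C :: "nat \<Rightarrow> ('a, 'd) chart" assume C: "\<forall>i<n. C i \<in> A"
    let ?W = "\<Pi>\<^sub>E i\<in>{..<n}. chart_range (C i)"
    show "Ck_on_power k n ?W (\<lambda>y. one_particle \<phi> (pts (\<lambda>i\<in>{..<n}. chart_inv (C i) (y i)) {..<n}))"
    proof (cases "n = 1")
      case True
      have "Ck_on_power k n ?W (\<lambda>y. complex_of_real ((\<phi> \<circ> chart_inv (C 0)) (y 0)))"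
        by (rule Ck_on_power_of_coordinate[OF test_function_Ck[OF \<phi>, of "C 0"]]) (use C True in auto)
      moreover have "one_particle \<phi> (pts (\<lambda>i\<in>{..<n}. chart_inv (C i) (y i)) {..<n}) =
          complex_of_real ((\<phi> \<circ> chart_inv (C 0)) (y 0))" for y
        by (simp add: True lessThan_Suc one_particle_pts)
      ultimately show ?thesis by simp
    next
      case False
      then show ?thesis by (simp add: one_particle_def Ck_on_power_const)
    qed
  qed
  ultimately show ?thesis unfolding Ffin_iff using \<Lambda>(1) by blast
qed

lemma supported_on_one_particle_conv:
  assumes G: "supported_on \<Lambda> N G" and \<phi>: "\<And>x. \<phi> x \<noteq> 0 \<Longrightarrow> x \<in> \<Lambda>"
  shows "supported_on \<Lambda> (Suc N) (one_particle \<phi> \<star> G)"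
  unfolding supported_on_def
proof (intro allI impI)
  fix \<eta> assume nz: "(one_particle \<phi> \<star> G) \<eta> \<noteq> 0"
  let ?S = "{..<size \<eta>}"
  obtain x where x: "pts x ?S = \<eta>" using pts_exists by blast
  have "(\<Sum>i\<in>?S. complex_of_real (\<phi> (x i)) * (G (pts x ?S) + G (pts x (?S - {i})))) \<noteq> 0"
    using nz one_particle_conv_pts[of ?S \<phi> G x] by (simp add: x)
  then obtain i where i: "i \<in> ?S" "complex_of_real (\<phi> (x i)) * (G (pts x ?S) + G (pts x (?S - {i}))) \<noteq> 0"
    by (metis (mono_tags, lifting) sum.neutral)
  then have xi: "x i \<in> \<Lambda>" and "G (pts x ?S) \<noteq> 0 \<or> G (pts x (?S - {i})) \<noteq> 0" using \<phi> by auto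
  then have "set_mset (pts x ?S) \<subseteq> \<Lambda> \<and> size (pts x ?S) \<le> N \<or>
      set_mset (pts x (?S - {i})) \<subseteq> \<Lambda> \<and> size (pts x (?S - {i})) \<le> N"
    using G unfolding supported_on_def by blast
  moreover have "set_mset \<eta> = insert (x i) (x ` (?S - {i}))" "set_mset \<eta> = x ` ?S"
    using i set_mset_pts[of ?S x] by (auto simp: x)
  ultimately show "set_mset \<eta> \<subseteq> \<Lambda> \<and> size \<eta> \<le> Suc N" using xi i by auto
qed

text \<open>The increasing enumeration of the indices other than \<open>i\<close>, so that deleting
  a point becomes a reindexing.\<close>

definition skip :: "nat \<Rightarrow> nat \<Rightarrow> nat" where "skip i j = (if j < i then j else Suc j)"

lemma inj_on_skip: "inj_on (skip i) S"
  by (auto simp: inj_on_def skip_def split: if_splits)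

lemma skip_image: "i < n \<Longrightarrow> skip i ` {..<n - 1} = {..<n} - {i}"
proof (intro equalityI subsetI)
  fix j assume "i < n" "j \<in> {..<n} - {i}"
  then show "j \<in> skip i ` {..<n - 1}"
    by (intro image_eqI[of _ _ "if j < i then j else j - 1"]) (auto simp: skip_def)
qed (auto simp: skip_def split: if_splits)

text \<open>In \<open>one_particle_conv_pts\<close> the term with the i-th point deleted is a smooth
  function of n - 1 variables composed with \<open>skip i\<close>; the charts have to be reindexed
  along with the points.\<close>

lemma one_particle_conv_Ffin:
  fixes A :: "('a::t2_space, 'd::finite) chart set"
  assumes \<phi>: "\<phi> \<in> test_functions A" and G: "G \<in> Ffin A" shows "one_particle \<phi> \<star> G \<in> Ffin A"
proof -
  obtain \<Lambda> where \<Lambda>: "compact \<Lambda>" "\<And>x. \<phi> x \<noteq> 0 \<Longrightarrow> x \<in> \<Lambda>" using test_function_supp[OF \<phi>] by blast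
  obtain \<Lambda>' N where \<Lambda>': "compact \<Lambda>'" "supported_on \<Lambda>' N G" and sm: "smooth_sequence A G"
    using G unfolding Ffin_iff by blast
  have "supported_on (\<Lambda> \<union> \<Lambda>') (Suc N) (one_particle \<phi> \<star> G)"
    using \<Lambda>(2) by (intro supported_on_one_particle_conv supported_on_mono[OF \<Lambda>'(2)]) auto
  moreover have "smooth_sequence A (one_particle \<phi> \<star> G)"
    unfolding smooth_sequence_def
  proof (intro allI impI)
    fix n k and C :: "nat \<Rightarrow> ('a, 'd) chart" assume C: "\<forall>i<n. C i \<in> A"
    let ?W = "\<Pi>\<^sub>E i\<in>{..<n}. chart_range (C i)"
    let ?p = "\<lambda>y. \<lambda>i\<in>{..<n}. chart_inv (C i) (y i)"
    let ?q = "\<lambda>i z. \<lambda>j\<in>{..<n - 1}. chart_inv (C (skip i j)) (z j)"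
    let ?r = "\<lambda>i y. \<lambda>j\<in>{..<n - 1}. y (skip i j)"
    have sk: "skip i j < n" if "i < n" "j < n - 1" for i j
      using that by (auto simp: skip_def)
    have "Ck_on_power k n ?W (\<lambda>y. \<Sum>i\<in>{..<n}. complex_of_real ((\<phi> \<circ> chart_inv (C i)) (y i)) *
        (G (pts (?p y) {..<n}) + G (pts (?q i (?r i y)) {..<n - 1})))"
    proof (intro Ck_on_power_sum Ck_on_power_mult Ck_on_power_add)
      fix i assume i: "i \<in> {..<n}"
      show "Ck_on_power k n ?W (\<lambda>y. complex_of_real ((\<phi> \<circ> chart_inv (C i)) (y i)))"
        by (rule Ck_on_power_of_coordinate[OF test_function_Ck[OF \<phi>, of "C i"]]) (use C i in auto)
      show "Ck_on_power k n ?W (\<lambda>y. G (pts (?p y) {..<n}))"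
        using sm C unfolding smooth_sequence_def by blast
      show "Ck_on_power k n ?W (\<lambda>y. G (pts (?q i (?r i y)) {..<n - 1}))"
      proof (rule Ck_on_power_reindex[where s = "skip i"])
        have "\<forall>j<n - 1. C (skip i j) \<in> A" using C sk i by auto
        then show "Ck_on_power k (n - 1) (\<Pi>\<^sub>E j\<in>{..<n - 1}. chart_range (C (skip i j)))
            (\<lambda>z. G (pts (?q i z) {..<n - 1}))"
          using sm[unfolded smooth_sequence_def, rule_format, of "n - 1" "\<lambda>j. C (skip i j)" k] by simp
        show "?r i y \<in> (\<Pi>\<^sub>E j\<in>{..<n - 1}. chart_range (C (skip i j)))" if "y \<in> ?W" for y
          using that sk i by (auto simp: PiE_iff)
      qed (use sk i inj_on_skip in auto)
    qed
    moreover have "(one_particle \<phi> \<star> G) (pts (?p y) {..<n}) =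
        (\<Sum>i\<in>{..<n}. complex_of_real ((\<phi> \<circ> chart_inv (C i)) (y i)) *
          (G (pts (?p y) {..<n}) + G (pts (?q i (?r i y)) {..<n - 1})))" for y
    proof -
      have "pts (?p y) ({..<n} - {i}) = pts (?q i (?r i y)) {..<n - 1}" if "i < n" for i
      proof -
        have "pts (?p y) ({..<n} - {i}) = pts (\<lambda>j. ?p y (skip i j)) {..<n - 1}"
          using pts_image[OF inj_on_skip, of "?p y" i "{..<n - 1}"] skip_image[OF that] by simp
        also have "\<dots> = pts (?q i (?r i y)) {..<n - 1}"
          by (rule pts_cong) (use sk[OF that] in auto)
        finally show ?thesis .
      qed
      then show ?thesis by (subst one_particle_conv_pts) (auto intro!: sum.cong)
    qed
    ultimately show "Ck_on_power k n ?W (\<lambda>y. (one_particle \<phi> \<star> G) (pts (?p y) {..<n}))" by simp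
  qed
  ultimately show ?thesis unfolding Ffin_iff using compact_Un[OF \<Lambda>(1) \<Lambda>'(1)] by blast
qed

text \<open>Regularity is known only in coordinates. Products of chart domains are open and cover
  the power, and the local statements are pasted together.\<close>

lemma Ffin_continuous:
  fixes A :: "('a::t2_space, 'd::finite) chart set"
  assumes A: "smooth_atlas A" and G: "G \<in> Ffin A"
  shows "continuous_map (power_top n) euclidean (\<lambda>x. G (pts x {..<n}))"
proof (rule pasting_lemma[where I = "{C. \<forall>i<n. C i \<in> A}" and T = "\<lambda>C. \<Pi>\<^sub>E i\<in>{..<n}. fst (C i)"
      and f = "\<lambda>_ x. G (pts x {..<n})"])
  fix C :: "nat \<Rightarrow> ('a, 'd) chart" assume C: "C \<in> {C. \<forall>i<n. C i \<in> A}"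
  have ch: "open (fst (C i))" "homeomorphism (fst (C i)) (chart_range (C i)) (snd (C i)) (chart_inv (C i))"
    if "i < n" for i
    using A C that by (auto simp: smooth_atlas_def is_chart_def)
  let ?U = "\<Pi>\<^sub>E i\<in>{..<n}. fst (C i)" and ?W = "\<Pi>\<^sub>E i\<in>{..<n}. chart_range (C i)"
  let ?c = "\<lambda>x. \<lambda>i\<in>{..<n}. snd (C i) (x i)" and ?p = "\<lambda>y. \<lambda>i\<in>{..<n}. chart_inv (C i) (y i)"
  show "openin (power_top n) ?U" using ch(1) by (simp add: openin_PiE)
  have "continuous_map (subtopology (power_top n) ?U) (subtopology (power_top n) ?W) ?c"
  proof (rule continuous_map_into_subtopology)
    show "continuous_map (subtopology (power_top n) ?U) (power_top n) ?c"
      unfolding continuous_map_componentwise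
    proof (intro conjI ballI)
      fix i assume i: "i \<in> {..<n}"
      have "continuous_map (subtopology (power_top n) ?U) (top_of_set (fst (C i))) (\<lambda>x. x i)"
        using continuous_map_power_coordinate[of i n ?U] i by (auto intro!: continuous_map_into_subtopology)
      moreover have "continuous_map (top_of_set (fst (C i))) euclidean (snd (C i))"
        using ch(2)[of i] i by (simp add: homeomorphism_def)
      ultimately have "continuous_map (subtopology (power_top n) ?U) euclidean (snd (C i) \<circ> (\<lambda>x. x i))"
        by (rule continuous_map_compose)
      then show "continuous_map (subtopology (power_top n) ?U) euclidean (\<lambda>x. ?c x i)"
        using i by (simp add: o_def)
    qed auto
    show "?c \<in> topspace (subtopology (power_top n) ?U) \<rightarrow> ?W"
      by (auto simp: chart_range_def)
  qed
  moreover have "continuous_map (subtopology (power_top n) ?W) euclidean (\<lambda>y. G (pts (?p y) {..<n}))"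
    using G C Ck_on_power_continuous unfolding Ffin_iff smooth_sequence_def by blast
  ultimately have "continuous_map (subtopology (power_top n) ?U) euclidean ((\<lambda>y. G (pts (?p y) {..<n})) \<circ> ?c)"
    by (rule continuous_map_compose)
  then show "continuous_map (subtopology (power_top n) ?U) euclidean (\<lambda>x. G (pts x {..<n}))"
  proof (rule continuous_map_eq)
    fix x assume x: "x \<in> topspace (subtopology (power_top n) ?U)"
    have "chart_inv (C i) (snd (C i) (x i)) = x i" if "i < n" for i
      using ch(2)[OF that] x that by (auto simp: homeomorphism_def PiE_iff)
    then have "pts (?p (?c x)) {..<n} = pts x {..<n}" by (intro pts_cong) auto
    then show "((\<lambda>y. G (pts (?p y) {..<n})) \<circ> ?c) x = G (pts x {..<n})" by (simp only: o_apply)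
  qed
next
  fix x assume x: "x \<in> topspace (power_top n :: (nat \<Rightarrow> 'a) topology)"
  have "\<forall>i. \<exists>C\<in>A. x i \<in> fst C" using A by (auto simp: smooth_atlas_def)
  then obtain C where "\<And>i. C i \<in> A" "\<And>i. x i \<in> fst (C i)" by metis
  then show "\<exists>C. C \<in> {C. \<forall>i<n. C i \<in> A} \<and> x \<in> (\<Pi>\<^sub>E i\<in>{..<n}. fst (C i)) \<and> G (pts x {..<n}) = G (pts x {..<n})"
    using x by (intro exI[of _ C]) (auto simp: PiE_iff)
qed simp

text \<open>At each level a continuous function on the compact power of \<Lambda>, zero elsewhere;
  only finitely many levels occur.\<close>

lemma Ffin_bounded:
  fixes A :: "('a::t2_space, 'd::finite) chart set"
  assumes A: "smooth_atlas A" and G: "G \<in> Ffin A"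
  shows "\<exists>s\<ge>0. \<forall>\<eta>. norm (G \<eta>) \<le> s"
proof -
  obtain \<Lambda> N where *: "compact \<Lambda>" "supported_on \<Lambda> N G" using G unfolding Ffin_iff by blast
  have "\<exists>s. \<forall>\<eta>. size \<eta> = n \<longrightarrow> norm (G \<eta>) \<le> s" for n
  proof -
    have "compactin (power_top n) (\<Pi>\<^sub>E i\<in>{..<n}. \<Lambda>)" using *(1) by (simp add: compactin_PiE)
    from image_compactin[OF this Ffin_continuous[OF A G]]
    have "bounded ((\<lambda>x. G (pts x {..<n})) ` (\<Pi>\<^sub>E i\<in>{..<n}. \<Lambda>))" by (simp add: compact_imp_bounded)
    then obtain s where s: "\<And>x. x \<in> (\<Pi>\<^sub>E i\<in>{..<n}. \<Lambda>) \<Longrightarrow> norm (G (pts x {..<n})) \<le> s"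
      unfolding bounded_iff by blast
    have "norm (G \<eta>) \<le> max s 0" if sz: "size \<eta> = n" for \<eta>
    proof (cases "G \<eta> = 0")
      case False
      obtain x where x: "pts x {..<n} = \<eta>" using pts_exists[of \<eta>] unfolding sz by (rule exE)
      have r: "pts (restrict x {..<n}) {..<n} = \<eta>" unfolding x[symmetric] by (rule pts_cong) simp
      have "set_mset \<eta> \<subseteq> \<Lambda>" using False *(2) by (simp add: supported_on_def)
      then have "restrict x {..<n} \<in> (\<Pi>\<^sub>E i\<in>{..<n}. \<Lambda>)" by (auto simp flip: x)
      from s[OF this] show ?thesis by (simp add: r)
    qed simp
    then show ?thesis by blast
  qed
  then obtain s where s: "\<And>n \<eta>. size \<eta> = n \<Longrightarrow> norm (G \<eta>) \<le> s n" by metis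
  have "norm (G \<eta>) \<le> (\<Sum>n\<le>N. \<bar>s n\<bar>)" for \<eta>
  proof (cases "G \<eta> = 0")
    case False
    then have "size \<eta> \<in> {..N}" using *(2) by (simp add: supported_on_def)
    then have "\<bar>s (size \<eta>)\<bar> \<le> (\<Sum>n\<le>N. \<bar>s n\<bar>)" by (intro member_le_sum) auto
    then show ?thesis using s[of \<eta> "size \<eta>"] by linarith
  qed (simp add: sum_nonneg)
  then show ?thesis by (intro exI[of _ "\<Sum>n\<le>N. \<bar>s n\<bar>"]) (auto intro: sum_nonneg)
qed

section \<open>Moment bounds\<close>

lemma openin_restrict_conf_topology:
  assumes "openin conf_topology U" shows "simple_confs \<inter> U \<in> sets conf_borel"
proof -
  let ?G = "{U. openin (subtopology conf_topology simple_confs) U}"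
  have "?G \<subseteq> Pow simple_confs" by (auto simp: openin_subtopology)
  then have "sets conf_borel = sigma_sets simple_confs ?G" unfolding conf_borel_def by (rule sets_measure_of)
  moreover have "simple_confs \<inter> U \<in> ?G" using assms by (auto simp: openin_subtopology)
  ultimately show ?thesis by (auto intro: sigma_sets.Basic)
qed

text \<open>Fixing the number of points and leaving \<Lambda> are both open conditions, so the set
  is a difference of two relatively open ones.\<close>

lemma simple_confs_in_sets:
  fixes \<Lambda> :: "'a::t2_space set"
  assumes "compact \<Lambda>" shows "simple_confs_in \<Lambda> n \<in> sets conf_borel"
proof -
  have "openin conf_topology {\<eta> :: 'a multiset. size \<eta> = n}"
    unfolding openin_conf_topology
  proof
    fix m
    have "{x \<in> topspace (power_top m). pts x {..<m} \<in> {\<eta> :: 'a multiset. size \<eta> = n}} =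
        (if m = n then topspace (power_top m) else {})" by auto
    then show "openin (power_top m) {x \<in> topspace (power_top m). pts x {..<m} \<in> {\<eta> :: 'a multiset. size \<eta> = n}}"
      by (cases "m = n") (simp_all only: simp_thms if_True if_False openin_topspace openin_empty)
  qed
  moreover have "openin conf_topology {\<eta>. \<not> set_mset \<eta> \<subseteq> \<Lambda>}"
    unfolding openin_conf_topology
  proof
    fix m
    have "openin (power_top m) {x \<in> topspace (power_top m). x i \<in> - \<Lambda>}" if "i < m" for i
      by (rule openin_continuous_map_preimage[OF continuous_map_product_projection])
        (use that compact_imp_closed[OF assms] in auto)
    then have "openin (power_top m) (\<Union>i<m. {x \<in> topspace (power_top m). x i \<in> - \<Lambda>})" by auto
    moreover have "(\<Union>i<m. {x \<in> topspace (power_top m). x i \<in> - \<Lambda>}) =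
        {x \<in> topspace (power_top m). pts x {..<m} \<in> {\<eta>. \<not> set_mset \<eta> \<subseteq> \<Lambda>}}" by auto
    ultimately show "openin (power_top m) {x \<in> topspace (power_top m). pts x {..<m} \<in> {\<eta>. \<not> set_mset \<eta> \<subseteq> \<Lambda>}}"
      by (simp only:)
  qed
  ultimately have "(simple_confs \<inter> {\<eta>. size \<eta> = n}) - (simple_confs \<inter> {\<eta>. \<not> set_mset \<eta> \<subseteq> \<Lambda>}) \<in> sets conf_borel"
    by (intro sets.Diff openin_restrict_conf_topology)
  moreover have "simple_confs_in \<Lambda> n =
      (simple_confs \<inter> {\<eta>. size \<eta> = n}) - (simple_confs \<inter> {\<eta>. \<not> set_mset \<eta> \<subseteq> \<Lambda>})"
    by (auto simp: simple_confs_in_def)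
  ultimately show ?thesis by simp
qed

text \<open>There are N + 1 levels, and the mass of each is at most C^N because C is at least
  1.\<close>

lemma integral_supported_bound:
  fixes \<Lambda> :: "'a::t2_space set" and G :: "'a multiset \<Rightarrow> complex"
  assumes \<rho>: "sets \<rho> = sets conf_borel" and \<Lambda>: "compact \<Lambda>"
    and C: "\<And>n. emeasure \<rho> (simple_confs_in \<Lambda> n) \<le> ennreal (C ^ n)" "C \<ge> 1"
    and G: "supported_on \<Lambda> N G" "\<And>\<eta>. norm (G \<eta>) \<le> s"
  shows "norm (\<integral>\<eta>. G \<eta> \<partial>\<rho>) \<le> real (Suc N) * (s * C ^ N)"
proof -
  have s: "s \<ge> 0" using G(2)[of "{#}"] norm_ge_zero order_trans by blast
  have B0: "0 \<le> real (Suc N) * (s * C ^ N)" using s C by (intro mult_nonneg_nonneg) auto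
  show ?thesis
  proof (cases "integrable \<rho> G")
    case True
    let ?S = "\<lambda>k. simple_confs_in \<Lambda> k"
    have m: "?S k \<in> sets \<rho>" for k by (simp add: \<rho> simple_confs_in_sets[OF \<Lambda>])
    have fin: "emeasure \<rho> (?S k) < \<infinity>" for k using C(1)[of k] by (simp add: le_less_trans)
    have meas: "measure \<rho> (?S k) \<le> C ^ k" for k
      unfolding measure_def using C by (intro enn2real_leI) auto
    have int: "integrable \<rho> (\<lambda>\<eta>. s * indicator (?S k) \<eta> :: real)" for k
      using m fin by (intro integrable_mult_right integrable_real_indicator) auto
    have sp: "space \<rho> = simple_confs"
      using sets_eq_imp_space_eq[OF \<rho>] by (auto simp: conf_borel_def space_measure_of_conv)
    have "norm (\<integral>\<eta>. G \<eta> \<partial>\<rho>) \<le> (\<integral>\<eta>. norm (G \<eta>) \<partial>\<rho>)" by (rule integral_norm_bound)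
    also have "\<dots> \<le> (\<integral>\<eta>. (\<Sum>k\<le>N. s * indicator (?S k) \<eta>) \<partial>\<rho>)"
    proof (rule integral_mono)
      show "integrable \<rho> (\<lambda>\<eta>. norm (G \<eta>))" using True by simp
      show "integrable \<rho> (\<lambda>\<eta>. \<Sum>k\<le>N. s * indicator (?S k) \<eta> :: real)" using int by (intro Bochner_Integration.integrable_sum)
      fix \<eta> assume \<eta>: "\<eta> \<in> space \<rho>"
      show "norm (G \<eta>) \<le> (\<Sum>k\<le>N. s * indicator (?S k) \<eta>)"
      proof (cases "G \<eta> = 0")
        case True
        then show ?thesis using s by (auto intro!: sum_nonneg)
      next
        case False
        then have i: "\<eta> \<in> ?S (size \<eta>)" "size \<eta> \<in> {..N}"
          using G(1) \<eta> sp by (auto simp: supported_on_def simple_confs_in_def)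
        have "s = s * indicator (?S (size \<eta>)) \<eta>" using i(1) by simp
        also have "\<dots> \<le> (\<Sum>k\<le>N. s * indicator (?S k) \<eta>)"
          by (rule member_le_sum) (use i s in auto)
        finally show ?thesis using G(2)[of \<eta>] by linarith
      qed
    qed
    also have "\<dots> = (\<Sum>k\<le>N. s * measure \<rho> (?S k))"
      using int m fin by (subst Bochner_Integration.integral_sum) auto
    also have "\<dots> \<le> (\<Sum>k\<le>N. s * C ^ N)"
    proof (intro sum_mono mult_left_mono s)
      fix k assume "k \<in> {..N}"
      then show "measure \<rho> (?S k) \<le> C ^ N"
        using power_increasing[of k N C] C(2) order_trans[OF meas] by auto
    qed
    finally show ?thesis by simp
  next
    \<comment> \<open>The integral of a nonintegrable function has the value 0, so the bound holds
      trivially.\<close>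
    case False
    then show ?thesis using B0 by (simp add: not_integrable_integral_eq)
  qed
qed

text \<open>At most N + 1 points can contribute, each with two values of \<open>G\<close>. This
  factor grows with every further convolution and is the source of the factorial.\<close>

lemma one_particle_conv_bound:
  assumes G: "supported_on \<Lambda> N G" "\<And>\<eta>. norm (G \<eta>) \<le> s"
    and \<phi>: "\<And>x. \<phi> x \<noteq> 0 \<Longrightarrow> x \<in> \<Lambda>" "\<And>x. \<bar>\<phi> x\<bar> \<le> c"
  shows "norm ((one_particle \<phi> \<star> G) \<eta>) \<le> real (Suc N) * (2 * c * s)"
proof -
  have s: "s \<ge> 0" using G(2)[of "{#}"] norm_ge_zero order_trans by blast
  have c: "c \<ge> 0" using \<phi>(2) abs_ge_zero order_trans by blast
  show ?thesis
  proof (cases "(one_particle \<phi> \<star> G) \<eta> = 0")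
    case False
    then have sz: "size \<eta> \<le> Suc N"
      using supported_on_one_particle_conv[OF G(1) \<phi>(1)] by (simp add: supported_on_def)
    let ?S = "{..<size \<eta>}"
    obtain x where x: "pts x ?S = \<eta>" using pts_exists by blast
    have "(one_particle \<phi> \<star> G) \<eta> =
        (\<Sum>i\<in>?S. complex_of_real (\<phi> (x i)) * (G (pts x ?S) + G (pts x (?S - {i}))))"
      using one_particle_conv_pts[of ?S \<phi> G x] by (simp add: x)
    also have "norm \<dots> \<le> (\<Sum>i\<in>?S. c * (s + s))"
    proof (rule sum_norm_le)
      fix i
      have "norm (G (pts x ?S) + G (pts x (?S - {i}))) \<le> s + s"
        by (rule order_trans[OF norm_triangle_ineq add_mono[OF G(2) G(2)]])
      then show "norm (complex_of_real (\<phi> (x i)) * (G (pts x ?S) + G (pts x (?S - {i})))) \<le> c * (s + s)"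
        unfolding norm_mult norm_of_real by (rule mult_mono[OF \<phi>(2) _ c norm_ge_zero])
    qed
    also have "\<dots> = real (size \<eta>) * (2 * c * s)" by simp
    also have "\<dots> \<le> real (Suc N) * (2 * c * s)" using sz s c by (intro mult_right_mono) auto
    finally show ?thesis .
  qed (use s c in auto)
qed

text \<open>The factors N + 1, ..., N + n of the successive convolutions multiply to (N + n)! / N!;
  the denominator is given away.\<close>

lemma conv_funpow_bound:
  assumes G: "supported_on \<Lambda> N G" "\<And>\<eta>. norm (G \<eta>) \<le> s"
    and \<phi>: "\<And>x. \<phi> x \<noteq> 0 \<Longrightarrow> x \<in> \<Lambda>" "\<And>x. \<bar>\<phi> x\<bar> \<le> c"
  shows "supported_on \<Lambda> (N + n) (((\<star>) (one_particle \<phi>) ^^ n) G) \<and>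
    (\<forall>\<eta>. norm (((\<star>) (one_particle \<phi>) ^^ n) G \<eta>) \<le> s * (2 * c) ^ n * fact (N + n))"
proof (induction n)
  case 0
  have s: "s \<ge> 0" using G(2)[of "{#}"] norm_ge_zero order_trans by blast
  have "norm (G \<eta>) \<le> s * fact N" for \<eta>
    using G(2)[of \<eta>] mult_left_mono[OF fact_ge_1[of N] s] by simp
  then show ?case using G by simp
next
  case (Suc n)
  then have "supported_on \<Lambda> (N + n) (((\<star>) (one_particle \<phi>) ^^ n) G)"
    "\<And>\<eta>. norm (((\<star>) (one_particle \<phi>) ^^ n) G \<eta>) \<le> s * (2 * c) ^ n * fact (N + n)" by auto
  from supported_on_one_particle_conv[OF this(1) \<phi>(1)] one_particle_conv_bound[OF this \<phi>]
  show ?case by (simp add: mult_ac)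
qed

lemma supported_on_conv:
  assumes G: "supported_on \<Lambda> N G" and H: "supported_on \<Lambda> M H"
  shows "supported_on \<Lambda> (N + M) (G \<star> H)"
  unfolding supported_on_def
proof (intro allI impI)
  fix \<eta> assume nz: "(G \<star> H) \<eta> \<noteq> 0"
  let ?S = "{..<size \<eta>}"
  obtain x where x: "pts x ?S = \<eta>" using pts_exists by blast
  have "(\<Sum>(\<alpha>, \<beta>)\<in>covers ?S. G (pts x \<alpha>) * H (pts x \<beta>)) \<noteq> 0"
    using nz conv_pts[of ?S G H x] by (simp add: x)
  then obtain p where "p \<in> covers ?S" "(\<lambda>(\<alpha>, \<beta>). G (pts x \<alpha>) * H (pts x \<beta>)) p \<noteq> 0"
    by (rule sum.not_neutral_contains_not_neutral)
  then obtain \<alpha> \<beta> where ab: "\<alpha> \<union> \<beta> = ?S" and nz: "G (pts x \<alpha>) \<noteq> 0" "H (pts x \<beta>) \<noteq> 0"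
    by (auto simp: covers_def)
  have fin: "finite \<alpha>" "finite \<beta>" using ab by (metis finite_Un finite_lessThan)+
  have *: "x ` \<alpha> \<subseteq> \<Lambda>" "card \<alpha> \<le> N" "x ` \<beta> \<subseteq> \<Lambda>" "card \<beta> \<le> M"
    using G H nz fin unfolding supported_on_def by (metis set_mset_pts size_pts)+
  have "set_mset \<eta> = x ` (\<alpha> \<union> \<beta>)" using set_mset_pts[of ?S x] by (simp add: x ab)
  moreover have "size \<eta> \<le> card \<alpha> + card \<beta>" using card_Un_le[of \<alpha> \<beta>] by (simp add: ab)
  ultimately show "set_mset \<eta> \<subseteq> \<Lambda> \<and> size \<eta> \<le> N + M" using * by auto
qed

text \<open>The sum runs over pairs of subsets of at most N + M indices, of which there are at most
  4^(N + M).\<close>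

lemma conv_bounded:
  assumes G: "supported_on \<Lambda> N G" "\<And>\<eta>. norm (G \<eta>) \<le> s" and H: "supported_on \<Lambda> M H" "\<And>\<eta>. norm (H \<eta>) \<le> t"
  shows "norm ((G \<star> H) \<eta>) \<le> 4 ^ (N + M) * (s * t)"
proof -
  have s: "s \<ge> 0" using G(2)[of "{#}"] norm_ge_zero order_trans by blast
  have t: "t \<ge> 0" using H(2)[of "{#}"] norm_ge_zero order_trans by blast
  show ?thesis
  proof (cases "(G \<star> H) \<eta> = 0")
    case False
    then have sz: "size \<eta> \<le> N + M"
      using supported_on_conv[OF G(1) H(1)] by (simp add: supported_on_def)
    let ?S = "{..<size \<eta>}"
    obtain x where x: "pts x ?S = \<eta>" using pts_exists by blast
    have "card (covers ?S) \<le> card (Pow ?S \<times> Pow ?S)"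
      by (rule card_mono) (auto simp: covers_def)
    also have "\<dots> = 4 ^ size \<eta>"
      by (simp add: card_cartesian_product card_Pow flip: power_mult_distrib)
    also have "\<dots> \<le> 4 ^ (N + M)" using sz by (rule power_increasing) simp
    finally have "real (card (covers ?S)) \<le> real (4 ^ (N + M))" by (rule of_nat_mono)
    then have card: "real (card (covers ?S)) \<le> 4 ^ (N + M)" by simp
    have "(G \<star> H) \<eta> = (\<Sum>(\<alpha>, \<beta>)\<in>covers ?S. G (pts x \<alpha>) * H (pts x \<beta>))"
      using conv_pts[of ?S G H x] by (simp add: x)
    also have "norm \<dots> \<le> (\<Sum>p\<in>covers ?S. s * t)"
      by (rule sum_norm_le) (auto simp: norm_mult intro!: mult_mono G(2) H(2) s)
    also have "\<dots> = real (card (covers ?S)) * (s * t)" by simp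
    also have "\<dots> \<le> 4 ^ (N + M) * (s * t)" using card s t by (intro mult_right_mono) auto
    finally show ?thesis .
  qed (use s t in auto)
qed

lemma fact_add_le: "(fact (m + n) :: real) \<le> 2 ^ (m + n) * fact m * fact n"
proof -
  have "(fact (m + n) :: real) = fact m * fact n * real ((m + n) choose m)"
    using arg_cong[OF binomial_fact_lemma[of m "m + n"], of real] by simp
  also have "\<dots> \<le> fact m * fact n * 2 ^ (m + n)"
  proof (rule mult_left_mono)
    show "real ((m + n) choose m) \<le> 2 ^ (m + n)"
      using binomial_le_pow2[of "m + n" m] by (metis of_nat_le_iff of_nat_numeral of_nat_power)
  qed simp
  finally show ?thesis by (simp add: mult_ac)
qed

section \<open>Closures of symmetric operators\<close>

lemma closure_prod_sequential:
  fixes x :: "'b::metric_space" and y :: "'c::metric_space"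
  shows "(x, y) \<in> closure T \<longleftrightarrow> (\<exists>a b. (\<forall>n. (a n, b n) \<in> T) \<and> a \<longlonglongrightarrow> x \<and> b \<longlonglongrightarrow> y)"
proof
  assume "(x, y) \<in> closure T"
  then obtain f where f: "\<forall>n. f n \<in> T" "f \<longlonglongrightarrow> (x, y)" unfolding closure_sequential by blast
  then show "\<exists>a b. (\<forall>n. (a n, b n) \<in> T) \<and> a \<longlonglongrightarrow> x \<and> b \<longlonglongrightarrow> y"
    using tendsto_fst[OF f(2)] tendsto_snd[OF f(2)]
    by (intro exI[of _ "\<lambda>n. fst (f n)"] exI[of _ "\<lambda>n. snd (f n)"]) auto
next
  assume "\<exists>a b. (\<forall>n. (a n, b n) \<in> T) \<and> a \<longlonglongrightarrow> x \<and> b \<longlonglongrightarrow> y"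
  then obtain a b where "\<forall>n. (a n, b n) \<in> T" "a \<longlonglongrightarrow> x" "b \<longlonglongrightarrow> y" by blast
  then show "(x, y) \<in> closure T"
    unfolding closure_sequential by (intro exI[of _ "\<lambda>n. (a n, b n)"]) (auto intro: tendsto_Pair)
qed

text \<open>Dense range of T + i and T - i becomes surjectivity for the closure: by
  \<open>symmetric_graph_norm_le\<close> a convergent sequence of images has convergent
  preimages.\<close>

lemma selfadjoint_graph_closure:
  fixes T :: "('h::complex_hilbert \<times> 'h) set"
  assumes zero: "(0, 0) \<in> T"
    and add: "\<And>x y x' y'. (x, y) \<in> T \<Longrightarrow> (x', y') \<in> T \<Longrightarrow> (x + x', y + y') \<in> T"
    and scale: "\<And>c x y. (x, y) \<in> T \<Longrightarrow> (c *\<^sub>C x, c *\<^sub>C y) \<in> T"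
    and sym: "\<And>x y x' y'. (x, y) \<in> T \<Longrightarrow> (x', y') \<in> T \<Longrightarrow> cinner y x' = cinner x y'"
    and dom: "closure (Domain T) = UNIV"
    and range: "\<And>c. c = \<i> \<or> c = - \<i> \<Longrightarrow> closure ((\<lambda>(x, y). y + c *\<^sub>C x) ` T) = UNIV"
  shows "selfadjoint_graph (closure T)"
proof
  have add': "(x + x', y + y') \<in> closure T" if "(x, y) \<in> closure T" "(x', y') \<in> closure T" for x y x' y'
  proof -
    from that obtain a b a' b' where *: "\<forall>n. (a n, b n) \<in> T" "a \<longlonglongrightarrow> x" "b \<longlonglongrightarrow> y"
      "\<forall>n. (a' n, b' n) \<in> T" "a' \<longlonglongrightarrow> x'" "b' \<longlonglongrightarrow> y'" unfolding closure_prod_sequential by blast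
    show ?thesis
      unfolding closure_prod_sequential using * add
      by (intro exI[of _ "\<lambda>n. a n + a' n"] exI[of _ "\<lambda>n. b n + b' n"]) (auto intro: tendsto_add)
  qed
  have scale': "(c *\<^sub>C x, c *\<^sub>C y) \<in> closure T" if "(x, y) \<in> closure T" for c x y
  proof -
    from that obtain a b where *: "\<forall>n. (a n, b n) \<in> T" "a \<longlonglongrightarrow> x" "b \<longlonglongrightarrow> y"
      unfolding closure_prod_sequential by blast
    show ?thesis
      unfolding closure_prod_sequential using * scale
      by (intro exI[of _ "\<lambda>n. c *\<^sub>C a n"] exI[of _ "\<lambda>n. c *\<^sub>C b n"])
        (auto intro: bounded_linear.tendsto[OF bounded_linear_scaleC])
  qed
  show sym': "cinner y x' = cinner x y'" if "(x, y) \<in> closure T" "(x', y') \<in> closure T" for x y x' y'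
  proof -
    from that obtain a b a' b' where *: "\<forall>n. (a n, b n) \<in> T" "a \<longlonglongrightarrow> x" "b \<longlonglongrightarrow> y"
      "\<forall>n. (a' n, b' n) \<in> T" "a' \<longlonglongrightarrow> x'" "b' \<longlonglongrightarrow> y'" unfolding closure_prod_sequential by blast
    have "(\<lambda>n. cinner (b n) (a' n)) \<longlonglongrightarrow> cinner y x'" by (intro cinner.tendsto *)
    moreover have "(\<lambda>n. cinner (a n) (b' n)) \<longlonglongrightarrow> cinner x y'" by (intro cinner.tendsto *)
    moreover have "cinner (b n) (a' n) = cinner (a n) (b' n)" for n using * sym by blast
    ultimately show ?thesis using LIMSEQ_unique by simp
  qed
  have sub: "T \<subseteq> closure T" by (rule closure_subset)
  \<comment> \<open>A densely defined symmetric operator is closable: by symmetry, two values at the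
    same vector have the same scalar products with the dense domain.\<close>
  have "single_valued (closure T)"
    unfolding single_valued_def
  proof (intro allI impI)
    fix x y y' assume xy: "(x, y) \<in> closure T" "(x, y') \<in> closure T"
    have "y - y' = 0"
    proof (rule eq_zero_if_orthogonal_dense[OF dom])
      fix v assume "v \<in> Domain T"
      then obtain w where w: "(v, w) \<in> closure T" using sub by auto
      have "cinner v y = cinner w x" "cinner v y' = cinner w x"
        using sym'[OF w xy(1)] sym'[OF w xy(2)] by simp_all
      then show "cinner v (y - y') = 0" by (simp add: cinner_simps)
    qed
    then show "y = y'" by simp
  qed
  then show "lin_operator (closure T)"
    unfolding lin_operator_def using zero sub add' scale' by blast
  show "closed (closure T)" by simp
  fix c :: complex and h :: 'h assume c: "c = \<i> \<or> c = - \<i>"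
  have "h \<in> closure ((\<lambda>(x, y). y + c *\<^sub>C x) ` T)" using range[OF c] by simp
  then obtain s where s: "\<forall>n. s n \<in> (\<lambda>(x, y). y + c *\<^sub>C x) ` T" "s \<longlonglongrightarrow> h"
    unfolding closure_sequential by blast
  then have "\<forall>n. \<exists>x y. (x, y) \<in> T \<and> s n = y + c *\<^sub>C x" by fast
  then obtain x y where xy: "\<And>n. (x n, y n) \<in> T" "\<And>n. s n = y n + c *\<^sub>C x n" by metis
  have le: "norm (x m - x n) \<le> norm (s m - s n)" for m n
  proof -
    have "(x m - x n, y m - y n) \<in> T"
      using add[OF xy(1)[of m] scale[OF xy(1)[of n], of "-1"]] by (simp add: scaleC_minus_one)
    then have "cinner (y m - y n) (x m - x n) = cinner (x m - x n) (y m - y n)" using sym by blast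
    from symmetric_graph_norm_le[OF this c] show ?thesis
      by (simp add: xy(2) scaleC_diff_right algebra_simps)
  qed
  have "Cauchy s" using s(2) by (intro convergent_Cauchy convergentI)
  have "Cauchy x"
  proof (rule metric_CauchyI)
    fix e :: real assume "e > 0"
    then obtain N where "\<And>m n. m \<ge> N \<Longrightarrow> n \<ge> N \<Longrightarrow> norm (s m - s n) < e"
      using CauchyD[OF \<open>Cauchy s\<close>] by blast
    then show "\<exists>N. \<forall>m\<ge>N. \<forall>n\<ge>N. dist (x m) (x n) < e"
      unfolding dist_norm using le by (meson le_less_trans)
  qed
  then obtain l where l: "x \<longlonglongrightarrow> l" using Cauchy_convergent convergent_def by blast
  have "(\<lambda>n. s n - c *\<^sub>C x n) \<longlonglongrightarrow> h - c *\<^sub>C l"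
    by (intro tendsto_diff s bounded_linear.tendsto[OF bounded_linear_scaleC] l)
  then have "y \<longlonglongrightarrow> h - c *\<^sub>C l" by (simp add: xy(2))
  then show "\<exists>l. (l, h - c *\<^sub>C l) \<in> closure T"
    unfolding closure_prod_sequential using xy(1) l by blast
qed

section \<open>The operators \<open>A\<^sub>\<phi>\<close>\<close>

locale correlation_space =
  fixes A :: "('a::t2_space, 'd::finite) chart set"
    and \<rho> :: "'a multiset measure"
    and \<iota> :: "('a multiset \<Rightarrow> complex) \<Rightarrow> 'h::complex_hilbert"
  assumes atlas: "smooth_atlas A"
    and rho_sets: "sets \<rho> = sets conf_borel"
    and rho_bound: "\<And>\<Lambda>. compact \<Lambda> \<Longrightarrow>
      \<exists>C>0. \<forall>n. emeasure \<rho> (simple_confs_in \<Lambda> n) \<le> ennreal (C ^ n)"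
    and completion: "hilbert_completion A \<rho> \<iota>"
begin

lemma iota_add: "G \<in> Ffin A \<Longrightarrow> H \<in> Ffin A \<Longrightarrow> \<iota> (\<lambda>\<eta>. G \<eta> + H \<eta>) = \<iota> G + \<iota> H"
  and iota_scale: "G \<in> Ffin A \<Longrightarrow> \<iota> (\<lambda>\<eta>. c * G \<eta>) = c *\<^sub>C \<iota> G"
  and cinner_iota: "G \<in> Ffin A \<Longrightarrow> H \<in> Ffin A \<Longrightarrow> cinner (\<iota> G) (\<iota> H) = a_form \<rho> G (cnj \<circ> H)"
  and iota_dense: "closure (\<iota> ` Ffin A) = UNIV"
  using completion by (simp_all add: hilbert_completion_def)

lemma iota_zero: "\<iota> (\<lambda>_. 0) = 0"
  using iota_scale[OF Ffin_zero, of 0] by simp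

text \<open>The function \<phi> is real, so its sequence is fixed by conjugation and can be moved
  across the form by the laws of the convolution.\<close>

lemma one_particle_symmetric:
  assumes \<phi>: "\<phi> \<in> test_functions A" and G: "G \<in> Ffin A" "H \<in> Ffin A"
  shows "cinner (\<iota> (one_particle \<phi> \<star> G)) (\<iota> H) = cinner (\<iota> G) (\<iota> (one_particle \<phi> \<star> H))"
proof -
  have "(one_particle \<phi> \<star> G) \<star> (cnj \<circ> H) = G \<star> (cnj \<circ> (one_particle \<phi> \<star> H))"
    unfolding cnj_conv cnj_one_particle by (simp only: conv_assoc conv_left_commute)
  then show ?thesis using G one_particle_conv_Ffin[OF \<phi>] by (simp add: cinner_iota a_form_def)
qed

lemma conv_funpow_Ffin:
  "\<phi> \<in> test_functions A \<Longrightarrow> G \<in> Ffin A \<Longrightarrow> ((\<star>) (one_particle \<phi>) ^^ n) G \<in> Ffin A"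
  by (induction n) (auto intro: one_particle_conv_Ffin)

text \<open>\<open>\<parallel>A\<^sub>\<phi>\<^sup>k G\<parallel>\<^sup>2\<close> is the integral of the \<open>2 k\<close>-fold convolution of \<open>G \<star> cnj G\<close> with
  \<open>\<phi>\<close>, hence at most of order \<open>(2 k)!\<close>.\<close>

lemma analytic_orbit_iota:
  assumes \<phi>: "\<phi> \<in> test_functions A" and G: "G \<in> Ffin A"
  shows "\<exists>D>0. analytic_orbit D (\<lambda>k. \<iota> (((\<star>) (one_particle \<phi>) ^^ k) G))"
proof -
  let ?G = "\<lambda>k. ((\<star>) (one_particle \<phi>) ^^ k) G"
  obtain \<Lambda>\<^sub>1 where \<Lambda>1: "compact \<Lambda>\<^sub>1" "\<And>x. \<phi> x \<noteq> 0 \<Longrightarrow> x \<in> \<Lambda>\<^sub>1" using test_function_supp[OF \<phi>] by blast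
  obtain \<Lambda>\<^sub>2 N where \<Lambda>2: "compact \<Lambda>\<^sub>2" "supported_on \<Lambda>\<^sub>2 N G" using G unfolding Ffin_iff by blast
  define \<Lambda> where "\<Lambda> = \<Lambda>\<^sub>1 \<union> \<Lambda>\<^sub>2"
  have \<Lambda>: "compact \<Lambda>" using \<Lambda>1 \<Lambda>2 by (simp add: \<Lambda>_def compact_Un)
  have sG: "supported_on \<Lambda> N G" by (rule supported_on_mono[OF \<Lambda>2(2)]) (auto simp: \<Lambda>_def)
  have s\<phi>: "x \<in> \<Lambda>" if "\<phi> x \<noteq> 0" for x using \<Lambda>1(2)[OF that] by (simp add: \<Lambda>_def)
  obtain s where s: "s \<ge> 0" "\<And>\<eta>. norm (G \<eta>) \<le> s" using Ffin_bounded[OF atlas G] by blast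
  obtain c0 where c0: "\<And>\<eta>. norm (one_particle \<phi> \<eta>) \<le> c0"
    using Ffin_bounded[OF atlas one_particle_Ffin[OF \<phi>]] by blast
  \<comment> \<open>The maxima with 1, here and for \<open>C\<close>, keep \<open>D\<close> positive
    even for \<phi> = 0, and \<open>integral_supported_bound\<close> requires C \<ge> 1.\<close>
  define c where "c = max c0 1"
  have c1: "c \<ge> 1" by (simp add: c_def)
  have c: "\<bar>\<phi> x\<bar> \<le> c" for x
    using c0[of "{#x#}"] by (simp add: one_particle_def c_def)
  obtain C0 where C0: "C0 > 0" "\<And>n. emeasure \<rho> (simple_confs_in \<Lambda> n) \<le> ennreal (C0 ^ n)"
    using rho_bound[OF \<Lambda>] by blast
  define C where "C = max C0 1"
  have C1: "C \<ge> 1" by (simp add: C_def)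
  have C: "emeasure \<rho> (simple_confs_in \<Lambda> n) \<le> ennreal (C ^ n)" for n
  proof (rule order_trans[OF C0(2)])
    show "ennreal (C0 ^ n) \<le> ennreal (C ^ n)"
      using C0(1) by (intro ennreal_leI power_mono) (auto simp: C_def)
  qed
  define H where "H = G \<star> (cnj \<circ> G)"
  have sG': "supported_on \<Lambda> N (cnj \<circ> G)" and bG': "norm ((cnj \<circ> G) \<eta>) \<le> s" for \<eta>
    using sG s(2) by (simp_all add: supported_on_def)
  define t where "t = 4 ^ (N + N) * (s * s)"
  have t0: "t \<ge> 0" using s by (simp add: t_def)
  have sH: "supported_on \<Lambda> (N + N) H" unfolding H_def by (rule supported_on_conv[OF sG sG'])
  have bH: "norm (H \<eta>) \<le> t" for \<eta>
    unfolding H_def t_def by (rule conv_bounded[OF sG s(2) sG' bG'])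
  \<comment> \<open>All factors \<phi> from both sides are collected in front, which leaves the
    fixed sequence \<open>H\<close> with fixed support and bound.\<close>
  have GG: "?G j \<star> (cnj \<circ> ?G k) = ((\<star>) (one_particle \<phi>) ^^ (j + k)) H" for j k
  proof (induction j)
    case 0
    have "((\<star>) (one_particle \<phi>) ^^ Suc k) J = one_particle \<phi> \<star> ((\<star>) (one_particle \<phi>) ^^ k) J" for k J
      by simp
    then have "cnj \<circ> ?G k = ((\<star>) (one_particle \<phi>) ^^ k) (cnj \<circ> G)"
      by (induction k) (simp_all only: funpow_0 cnj_conv cnj_one_particle)
    moreover have "G \<star> ((\<star>) (one_particle \<phi>) ^^ k) J = ((\<star>) (one_particle \<phi>) ^^ k) (G \<star> J)" for J
      by (induction k) (simp_all add: conv_left_commute[of G])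
    ultimately show ?case by (simp add: H_def)
  next
    case (Suc j)
    then show ?case by (simp add: conv_assoc)
  qed
  \<comment> \<open>The number of levels, \<open>Suc ?n\<close>, is absorbed into the factorial: (n
    + 1) n! = (p + 2k)!.\<close>
  define p where "p = Suc (N + N)"
  define K where "K = t * C ^ (N + N) * 2 ^ p * fact p"
  have K0: "K \<ge> 0" using t0 C1 by (simp add: K_def)
  \<comment> \<open>Collects everything to the power 2k: 2c from the convolutions, \<open>C\<close>
    from the measure, and 2 from each of the two splittings of the factorial.\<close>
  define D where "D = 8 * c * C"
  have D0: "D > 0" using c1 C1 by (simp add: D_def)
  have norm_sq: "(norm (\<iota> (?G k)))\<^sup>2 \<le> K * (D ^ k * fact k)\<^sup>2" for k
  proof -
    let ?n = "N + N + (k + k)"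
    have b: "supported_on \<Lambda> ?n (((\<star>) (one_particle \<phi>) ^^ (k + k)) H)"
      "\<And>\<eta>. norm (((\<star>) (one_particle \<phi>) ^^ (k + k)) H \<eta>) \<le> t * (2 * c) ^ (k + k) * fact ?n"
      using conv_funpow_bound[OF sH bH s\<phi> c, where n = "k + k"] by auto
    have "(norm (\<iota> (?G k)))\<^sup>2 = Re (a_form \<rho> (?G k) (cnj \<circ> ?G k))"
      using conv_funpow_Ffin[OF \<phi> G] by (simp add: norm_sq_cinner cinner_iota)
    also have "\<dots> \<le> norm (\<integral>\<eta>. ((\<star>) (one_particle \<phi>) ^^ (k + k)) H \<eta> \<partial>\<rho>)"
      unfolding a_form_def GG by (rule complex_Re_le_cmod)
    also have "\<dots> \<le> real (Suc ?n) * (t * (2 * c) ^ (k + k) * fact ?n * C ^ ?n)"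
      by (rule integral_supported_bound[OF rho_sets \<Lambda> C C1 b])
    also have "\<dots> = (t * (2 * c) ^ (k + k) * C ^ ?n) * fact (p + (k + k))"
      by (simp add: p_def)
    also have "\<dots> \<le> (t * (2 * c) ^ (k + k) * C ^ ?n) *
        (2 ^ (p + (k + k)) * fact p * (2 ^ (k + k) * fact k * fact k))"
    proof (rule mult_left_mono)
      have "(fact (p + (k + k)) :: real) \<le> 2 ^ (p + (k + k)) * fact p * fact (k + k)" by (rule fact_add_le)
      also have "\<dots> \<le> 2 ^ (p + (k + k)) * fact p * (2 ^ (k + k) * fact k * fact k)"
        by (intro mult_left_mono fact_add_le) simp
      finally show "(fact (p + (k + k)) :: real) \<le> 2 ^ (p + (k + k)) * fact p * (2 ^ (k + k) * fact k * fact k)" .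
    qed (use t0 c1 C1 in simp)
    also have "\<dots> = K * (D ^ k * fact k)\<^sup>2"
    proof -
      have "(8 :: real) ^ k = 2 ^ k * 2 ^ k * 2 ^ k" by (simp flip: power_mult_distrib)
      then show ?thesis
        by (simp add: K_def D_def power_add power_mult_distrib power2_eq_square mult_ac)
    qed
    finally show ?thesis .
  qed
  have "norm (\<iota> (?G k)) \<le> sqrt K * D ^ k * fact k" for k
  proof (rule power2_le_imp_le)
    show "(norm (\<iota> (?G k)))\<^sup>2 \<le> (sqrt K * D ^ k * fact k)\<^sup>2"
      using norm_sq[of k] K0 by (simp add: power_mult_distrib)
  qed (use K0 D0 in simp)
  moreover have "cinner (\<iota> (?G (Suc j))) (\<iota> (?G k)) = cinner (\<iota> (?G j)) (\<iota> (?G (Suc k)))" for j k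
    using one_particle_symmetric[OF \<phi> conv_funpow_Ffin[OF \<phi> G] conv_funpow_Ffin[OF \<phi> G]] by simp
  ultimately have "analytic_orbit D (\<lambda>k. \<iota> (?G k))"
    unfolding analytic_orbit_def using K0 by (intro conjI allI exI[of _ "sqrt K"]) auto
  then show ?thesis using D0 by blast
qed

text \<open>The operator \<open>A_op\<close> plus \<open>c\<close> at the level of sequences, where
  the algebraic laws hold as equations between functions before classes are formed.\<close>

definition shift :: "('a \<Rightarrow> real) \<Rightarrow> complex \<Rightarrow> ('a multiset \<Rightarrow> complex) \<Rightarrow> 'a multiset \<Rightarrow> complex" where
  "shift \<phi> c G = (\<lambda>\<eta>. (one_particle \<phi> \<star> G) \<eta> + c * G \<eta>)"

lemma shift_Ffin: "\<phi> \<in> test_functions A \<Longrightarrow> G \<in> Ffin A \<Longrightarrow> shift \<phi> c G \<in> Ffin A"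
  unfolding shift_def by (intro Ffin_add Ffin_scale one_particle_conv_Ffin)

lemma iota_shift:
  "\<phi> \<in> test_functions A \<Longrightarrow> G \<in> Ffin A \<Longrightarrow> \<iota> (shift \<phi> c G) = \<iota> (one_particle \<phi> \<star> G) + c *\<^sub>C \<iota> G"
  unfolding shift_def by (simp add: iota_add iota_scale Ffin_scale one_particle_conv_Ffin)

lemma shift_add: "shift \<phi> c (\<lambda>\<eta>. G \<eta> + H \<eta>) = (\<lambda>\<eta>. shift \<phi> c G \<eta> + shift \<phi> c H \<eta>)"
  by (simp add: shift_def conv_add_right algebra_simps)

lemma shift_scale: "shift \<phi> c (\<lambda>\<eta>. d * G \<eta>) = (\<lambda>\<eta>. d * shift \<phi> c G \<eta>)"
  by (simp add: shift_def conv_scale_right algebra_simps)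

lemma conv_shift: "H \<star> shift \<phi> c G = shift \<phi> c (H \<star> G)"
  by (simp add: shift_def conv_add_right conv_scale_right conv_left_commute[of H])

lemma shift_commute: "shift \<phi> c (shift \<psi> d G) = shift \<psi> d (shift \<phi> c G)"
proof -
  have "shift \<phi> c (shift \<psi> d G) = (\<lambda>\<eta>. shift \<psi> d (one_particle \<phi> \<star> G) \<eta> + c * shift \<psi> d G \<eta>)"
    unfolding shift_def[of \<phi>] conv_shift ..
  also have "\<dots> = shift \<psi> d (shift \<phi> c G)"
    by (simp only: shift_def[of \<phi>] shift_add shift_scale)
  finally show ?thesis .
qed

text \<open>Analyticity is exploited along whole orbits, so all powers applied to a sequence must
  remain in the space. Invariance under all test functions lets the image under one shift serve as
  the space for another.\<close>

definition invariant_subspace :: "('a multiset \<Rightarrow> complex) set \<Rightarrow> bool" where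
  "invariant_subspace V \<longleftrightarrow> V \<subseteq> Ffin A \<and> (\<lambda>_. 0) \<in> V \<and>
     (\<forall>G\<in>V. \<forall>H\<in>V. (\<lambda>\<eta>. G \<eta> + H \<eta>) \<in> V) \<and> (\<forall>c. \<forall>G\<in>V. (\<lambda>\<eta>. c * G \<eta>) \<in> V) \<and>
     (\<forall>\<phi>\<in>test_functions A. \<forall>G\<in>V. one_particle \<phi> \<star> G \<in> V)"

lemma invariant_subspace_Ffin: "invariant_subspace (Ffin A)"
  by (auto simp: invariant_subspace_def intro: Ffin_zero Ffin_add Ffin_scale one_particle_conv_Ffin)

lemma invariant_subspace_shift:
  assumes V: "invariant_subspace V" and \<phi>: "\<phi> \<in> test_functions A"
  shows "invariant_subspace (shift \<phi> c ` V)"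
  unfolding invariant_subspace_def
proof (intro conjI ballI allI)
  show "shift \<phi> c ` V \<subseteq> Ffin A" using V \<phi> shift_Ffin by (auto simp: invariant_subspace_def)
  have "shift \<phi> c (\<lambda>_. 0) = (\<lambda>_. 0)" using shift_scale[of \<phi> c 0 "\<lambda>_. 0"] by simp
  then show "(\<lambda>_. 0) \<in> shift \<phi> c ` V" using V by (metis imageI invariant_subspace_def)
next
  fix G H assume "G \<in> shift \<phi> c ` V" "H \<in> shift \<phi> c ` V"
  then show "(\<lambda>\<eta>. G \<eta> + H \<eta>) \<in> shift \<phi> c ` V"
    using V by (auto simp: invariant_subspace_def simp flip: shift_add)
next
  fix d G assume "G \<in> shift \<phi> c ` V"
  then show "(\<lambda>\<eta>. d * G \<eta>) \<in> shift \<phi> c ` V"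
    using V by (auto simp: invariant_subspace_def simp flip: shift_scale)
next
  fix \<psi> G assume "\<psi> \<in> test_functions A" "G \<in> shift \<phi> c ` V"
  then show "one_particle \<psi> \<star> G \<in> shift \<phi> c ` V"
    using V by (auto simp: invariant_subspace_def conv_shift)
qed

text \<open>For \<open>u\<close> orthogonal to the image, applying the operator along an orbit in
  \<open>V\<close> multiplies the scalar product with \<open>u\<close> by -c each time. As c is not
  real, \<open>analytic_orbit_orthogonal\<close> makes \<open>u\<close> orthogonal to
  \<open>\<iota>\<close> applied to all of \<open>V\<close>, which is dense.\<close>

lemma shift_dense:
  assumes V: "invariant_subspace V" and dense: "closure (\<iota> ` V) = UNIV"
    and \<phi>: "\<phi> \<in> test_functions A" and c: "Im c \<noteq> 0"
  shows "closure (\<iota> ` shift \<phi> c ` V) = UNIV"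
proof (rule dense_if_orthogonal_trivial)
  let ?W = "shift \<phi> c ` V"
  have W: "invariant_subspace ?W" by (rule invariant_subspace_shift[OF V \<phi>])
  then have WF: "?W \<subseteq> Ffin A" by (simp add: invariant_subspace_def)
  have VF: "V \<subseteq> Ffin A" using V by (simp add: invariant_subspace_def)
  show "0 \<in> \<iota> ` ?W" using W iota_zero by (metis imageI invariant_subspace_def)
  show "x + y \<in> \<iota> ` ?W" if xy: "x \<in> \<iota> ` ?W" "y \<in> \<iota> ` ?W" for x y
  proof -
    obtain G H where GH: "G \<in> ?W" "H \<in> ?W" "x = \<iota> G" "y = \<iota> H" using xy by blast
    then have "x + y = \<iota> (\<lambda>\<eta>. G \<eta> + H \<eta>)" using WF iota_add by (metis subsetD)
    moreover have "(\<lambda>\<eta>. G \<eta> + H \<eta>) \<in> ?W" using W GH by (simp only: invariant_subspace_def)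
    ultimately show ?thesis by blast
  qed
  show "d *\<^sub>C x \<in> \<iota> ` ?W" if x: "x \<in> \<iota> ` ?W" for d x
  proof -
    obtain G where G: "G \<in> ?W" "x = \<iota> G" using x by blast
    then have "d *\<^sub>C x = \<iota> (\<lambda>\<eta>. d * G \<eta>)" using WF iota_scale by (metis subsetD)
    moreover have "(\<lambda>\<eta>. d * G \<eta>) \<in> ?W" using W G by (simp only: invariant_subspace_def)
    ultimately show ?thesis by blast
  qed
  fix u assume u: "\<And>v. v \<in> \<iota> ` ?W \<Longrightarrow> cinner v u = 0"
  show "u = 0"
  proof (rule eq_zero_if_orthogonal_dense[OF dense])
    fix v assume "v \<in> \<iota> ` V"
    then obtain G where G: "G \<in> V" "v = \<iota> G" by blast
    let ?v = "\<lambda>k. \<iota> (((\<star>) (one_particle \<phi>) ^^ k) G)"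
    have GV: "((\<star>) (one_particle \<phi>) ^^ k) G \<in> V" for k
      by (induction k) (use V \<phi> G in \<open>auto simp: invariant_subspace_def\<close>)
    have eig: "cinner (?v (Suc k)) u = - c * cinner (?v k) u" for k
    proof -
      have "cinner (\<iota> (shift \<phi> c (((\<star>) (one_particle \<phi>) ^^ k) G))) u = 0" using GV by (intro u) blast
      then have "cinner (?v (Suc k)) u + c * cinner (?v k) u = 0"
        using iota_shift[OF \<phi>, of "((\<star>) (one_particle \<phi>) ^^ k) G" c] GV[of k] VF by (auto simp: cinner_simps)
      then show ?thesis by (simp add: eq_neg_iff_add_eq_0)
    qed
    obtain D where D: "D > 0" "analytic_orbit D ?v"
      using analytic_orbit_iota[OF \<phi>, of G] G VF by blast
    have "cinner (?v 0) u = 0"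
      by (rule analytic_orbit_orthogonal[OF D(2,1), where z = "- c"]) (use eig c in auto)
    then show "cinner v u = 0" by (simp add: G)
  qed
qed

section \<open>The graphs of the operators and their resolvents\<close>

lemma A_op_zero: "(0, 0) \<in> A_op A \<iota> \<phi>"
proof -
  have "one_particle \<phi> \<star> (\<lambda>_. 0) = (\<lambda>_. 0)" using conv_scale_right[of "one_particle \<phi>" 0 "\<lambda>_. 0"] by simp
  then have "(0, 0) = (\<iota> (\<lambda>_. 0), \<iota> (one_particle \<phi> \<star> (\<lambda>_. 0)))" by (simp add: iota_zero)
  then show ?thesis unfolding A_op_def using Ffin_zero by blast
qed

lemma A_op_add:
  assumes \<phi>: "\<phi> \<in> test_functions A" and "(x, y) \<in> A_op A \<iota> \<phi>" "(x', y') \<in> A_op A \<iota> \<phi>"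
  shows "(x + x', y + y') \<in> A_op A \<iota> \<phi>"
proof -
  obtain G H where GH: "G \<in> Ffin A" "H \<in> Ffin A" "x = \<iota> G" "x' = \<iota> H"
    "y = \<iota> (one_particle \<phi> \<star> G)" "y' = \<iota> (one_particle \<phi> \<star> H)" using assms(2,3) by (auto simp: A_op_def)
  let ?J = "\<lambda>\<eta>. G \<eta> + H \<eta>"
  have "x + x' = \<iota> ?J" "y + y' = \<iota> (one_particle \<phi> \<star> ?J)"
    using GH one_particle_conv_Ffin[OF \<phi>] by (simp_all add: iota_add conv_add_right)
  then show ?thesis unfolding A_op_def using Ffin_add[OF GH(1,2)] by blast
qed

lemma A_op_scale:
  assumes \<phi>: "\<phi> \<in> test_functions A" and "(x, y) \<in> A_op A \<iota> \<phi>"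
  shows "(c *\<^sub>C x, c *\<^sub>C y) \<in> A_op A \<iota> \<phi>"
proof -
  obtain G where G: "G \<in> Ffin A" "x = \<iota> G" "y = \<iota> (one_particle \<phi> \<star> G)"
    using assms(2) by (auto simp: A_op_def)
  let ?J = "\<lambda>\<eta>. c * G \<eta>"
  have "c *\<^sub>C x = \<iota> ?J" "c *\<^sub>C y = \<iota> (one_particle \<phi> \<star> ?J)"
    using G one_particle_conv_Ffin[OF \<phi>] by (simp_all add: iota_scale conv_scale_right)
  then show ?thesis unfolding A_op_def using Ffin_scale[OF G(1)] by blast
qed

lemma A_op_Domain: "Domain (A_op A \<iota> \<phi>) = \<iota> ` Ffin A"
  by (auto simp: A_op_def)

lemma A_op_shift: "\<phi> \<in> test_functions A \<Longrightarrow> (\<lambda>(x, y). y + c *\<^sub>C x) ` A_op A \<iota> \<phi> = \<iota> ` shift \<phi> c ` Ffin A"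
proof (intro equalityI subsetI)
  assume \<phi>: "\<phi> \<in> test_functions A"
  fix z assume "z \<in> (\<lambda>(x, y). y + c *\<^sub>C x) ` A_op A \<iota> \<phi>"
  then obtain G where "G \<in> Ffin A" "z = \<iota> (one_particle \<phi> \<star> G) + c *\<^sub>C \<iota> G" by (auto simp: A_op_def)
  then show "z \<in> \<iota> ` shift \<phi> c ` Ffin A" using iota_shift[OF \<phi>] by (metis imageI)
next
  assume \<phi>: "\<phi> \<in> test_functions A"
  fix z assume "z \<in> \<iota> ` shift \<phi> c ` Ffin A"
  then obtain G where G: "G \<in> Ffin A" "z = \<iota> (one_particle \<phi> \<star> G) + c *\<^sub>C \<iota> G" using iota_shift[OF \<phi>] by auto
  then have "(\<iota> G, \<iota> (one_particle \<phi> \<star> G)) \<in> A_op A \<iota> \<phi>" by (auto simp: A_op_def)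
  then show "z \<in> (\<lambda>(x, y). y + c *\<^sub>C x) ` A_op A \<iota> \<phi>" using G(2) by force
qed

lemma selfadjoint_graph_A_op:
  assumes \<phi>: "\<phi> \<in> test_functions A" shows "selfadjoint_graph (closure (A_op A \<iota> \<phi>))"
proof -
  have sym: "cinner y x' = cinner x y'" if "(x, y) \<in> A_op A \<iota> \<phi>" "(x', y') \<in> A_op A \<iota> \<phi>" for x y x' y'
    using that one_particle_symmetric[OF \<phi>] by (auto simp: A_op_def)
  have range: "closure ((\<lambda>(x, y). y + c *\<^sub>C x) ` A_op A \<iota> \<phi>) = UNIV" if "c = \<i> \<or> c = - \<i>" for c
    unfolding A_op_shift[OF \<phi>]
    by (rule shift_dense[OF invariant_subspace_Ffin iota_dense \<phi>]) (use that in auto)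
  have dom: "closure (Domain (A_op A \<iota> \<phi>)) = UNIV"
    unfolding A_op_Domain by (rule iota_dense)
  show ?thesis
    by (rule selfadjoint_graph_closure[OF A_op_zero A_op_add[OF \<phi>] A_op_scale[OF \<phi>] sym dom range])
qed

lemma essentially_selfadjoint_A_op:
  assumes \<phi>: "\<phi> \<in> test_functions A" shows "essentially_selfadjoint_op (A_op A \<iota> \<phi>)"
proof -
  interpret selfadjoint_graph "closure (A_op A \<iota> \<phi>)" by (rule selfadjoint_graph_A_op[OF \<phi>])
  \<comment> \<open>Since the closure is single valued, so is the graph itself: the class of the
    convolution depends only on the class of \<open>G\<close>.\<close>
  have "single_valued (closure (A_op A \<iota> \<phi>))" using lin by (simp only: lin_operator_def)
  then have "single_valued (A_op A \<iota> \<phi>)" by (rule single_valued_subset[OF closure_subset])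
  then have "lin_operator (A_op A \<iota> \<phi>)"
    unfolding lin_operator_def using A_op_zero A_op_add[OF \<phi>] A_op_scale[OF \<phi>]
    by (auto simp: split_beta)
  then show ?thesis
    using selfadjoint by (simp add: essentially_selfadjoint_op_def A_op_Domain iota_dense)
qed

text \<open>The closure contains the original graph, which gives the resolvent explicitly on a dense
  set.\<close>

lemma res_iota_shift:
  assumes \<phi>: "\<phi> \<in> test_functions A" and c: "c = \<i> \<or> c = - \<i>" and G: "G \<in> Ffin A"
  shows "selfadjoint_graph.res (closure (A_op A \<iota> \<phi>)) c (\<iota> (shift \<phi> c G)) = \<iota> G"
proof -
  interpret selfadjoint_graph "closure (A_op A \<iota> \<phi>)" by (rule selfadjoint_graph_A_op[OF \<phi>])
  have "(\<iota> G, \<iota> (one_particle \<phi> \<star> G)) \<in> A_op A \<iota> \<phi>" using G by (auto simp: A_op_def)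
  then have "(\<iota> G, \<iota> (shift \<phi> c G) - c *\<^sub>C \<iota> G) \<in> closure (A_op A \<iota> \<phi>)"
    using closure_subset by (auto simp: iota_shift[OF \<phi> G])
  then show ?thesis by (rule res_eq[OF c])
qed

lemma commuting_A_op:
  assumes \<phi>: "\<phi> \<in> test_functions A" and \<psi>: "\<psi> \<in> test_functions A"
  shows "commuting_ops (closure (A_op A \<iota> \<phi>)) (closure (A_op A \<iota> \<psi>))"
proof (rule commuting_ops_resolvents)
  interpret S: selfadjoint_graph "closure (A_op A \<iota> \<phi>)" by (rule selfadjoint_graph_A_op[OF \<phi>])
  interpret T: selfadjoint_graph "closure (A_op A \<iota> \<psi>)" by (rule selfadjoint_graph_A_op[OF \<psi>])
  fix c d :: complex assume c: "c = \<i> \<or> c = - \<i>" and d: "d = \<i> \<or> d = - \<i>"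
  \<comment> \<open>On this set each resolvent removes its own shift, as the shifts can be
    interchanged; both products return the class of \<open>G\<close>. Density and boundedness extend
    the identity to the whole space.\<close>
  let ?W = "\<iota> ` shift \<phi> c ` shift \<psi> d ` Ffin A"
  have dense: "closure ?W = UNIV"
    by (intro shift_dense invariant_subspace_shift invariant_subspace_Ffin iota_dense \<phi> \<psi>) (use c d in auto)
  have l: "bounded_linear (\<lambda>h. S.res c (T.res d h) - T.res d (S.res c h))"
    by (intro bounded_linear_sub bounded_linear_compose[OF S.res_bounded_linear[OF c]]
        bounded_linear_compose[OF T.res_bounded_linear[OF d]] S.res_bounded_linear[OF c] T.res_bounded_linear[OF d])
  have zero: "S.res c (T.res d h) - T.res d (S.res c h) = 0" if hW: "h \<in> ?W" for h
  proof -
    obtain G where G: "G \<in> Ffin A" and h: "h = \<iota> (shift \<phi> c (shift \<psi> d G))" using hW by blast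
    have "S.res c h = \<iota> (shift \<psi> d G)" unfolding h by (rule res_iota_shift[OF \<phi> c shift_Ffin[OF \<psi> G]])
    moreover have "T.res d h = \<iota> (shift \<phi> c G)"
      unfolding h shift_commute[of \<phi>] by (rule res_iota_shift[OF \<psi> d shift_Ffin[OF \<phi> G]])
    ultimately show ?thesis using res_iota_shift[OF \<phi> c G] res_iota_shift[OF \<psi> d G] by simp
  qed
  show "commutes (S.res c) (T.res d)"
    unfolding commutes_def
  proof
    fix h
    have "h \<in> closure ?W" using dense by simp
    then obtain w where w: "\<forall>n. w n \<in> ?W" "w \<longlonglongrightarrow> h" unfolding closure_sequential by blast
    have "(\<lambda>n. S.res c (T.res d (w n)) - T.res d (S.res c (w n))) \<longlonglongrightarrow> S.res c (T.res d h) - T.res d (S.res c h)"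
      by (rule bounded_linear.tendsto[OF l w(2)])
    moreover have "(\<lambda>n. S.res c (T.res d (w n)) - T.res d (S.res c (w n))) = (\<lambda>n. 0)"
      using zero w(1) by (intro ext) blast
    ultimately have "S.res c (T.res d h) - T.res d (S.res c h) = 0"
      using LIMSEQ_unique[OF tendsto_const] by metis
    then show "S.res c (T.res d h) = T.res d (S.res c h)" by simp
  qed
qed (rule selfadjoint_graph_A_op[OF \<phi>], rule selfadjoint_graph_A_op[OF \<psi>])

end

theorem lemma2:
  fixes A :: "('a::{t2_space, second_countable_topology}, 'd::finite) chart set"
    and g :: "('a, 'd) chart \<Rightarrow> 'a \<Rightarrow> real ^ 'd ^ 'd"
    and \<rho> :: "'a multiset measure"
    and \<iota> :: "('a multiset \<Rightarrow> complex) \<Rightarrow> 'h::complex_hilbert"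
  assumes manifold: "oriented_riemannian_manifold A g"
    and connected: "connected (UNIV :: 'a set)"
    and noncompact: "\<not> compact (UNIV :: 'a set)"
    and rho_sets: "sets \<rho> = sets conf_borel"
    and rho_empty: "emeasure \<rho> {{#}} = 1"
    and rho_bound: "\<And>\<Lambda>. compact \<Lambda> \<Longrightarrow>
      \<exists>C>0. \<forall>n. emeasure \<rho> (simple_confs_in \<Lambda> n) \<le> ennreal (C ^ n)"
    and rho_pos: "\<And>G. G \<in> Ffin A \<Longrightarrow> a_form \<rho> G (cnj \<circ> G) \<in> \<real>\<^sub>\<ge>\<^sub>0"
    and completion: "hilbert_completion A \<rho> \<iota>"
  shows "(\<forall>\<phi>\<in>test_functions A. essentially_selfadjoint_op (A_op A \<iota> \<phi>)) \<and>
    (\<forall>\<phi>\<in>test_functions A. selfadjoint_op (closure (A_op A \<iota> \<phi>))) \<and>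
    (\<forall>\<phi>\<in>test_functions A. \<forall>\<psi>\<in>test_functions A.
       commuting_ops (closure (A_op A \<iota> \<phi>)) (closure (A_op A \<iota> \<psi>)))"
proof -
  interpret correlation_space A \<rho> \<iota>
    using manifold rho_sets rho_bound completion
    by unfold_locales (auto simp: oriented_riemannian_manifold_def oriented_atlas_def)
  show ?thesis
    using essentially_selfadjoint_A_op commuting_A_op unfolding essentially_selfadjoint_op_def by blast
qed

end
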